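(* Let $p\ge 1$ and suppose that the random vector $f(x)$ has a density $p_{f(x)}$ on the probability simplex $\triangle^K$ that is Lipschitz continuous. Then the Dirichlet kernel based calibration error estimator is consistent: with $(x_1,y_1),\dots,(x_n,y_n)$ i.i.d. copies of $(x,y)$ and for a suitable bandwidth sequence $h=h_n>0$ with $h_n\to 0$ as $n\to\infty$, $$\underset{n\to\infty}{\operatorname{plim}}\ \frac1n\sum_{j=1}^n\left\|\frac{\sum_{i\ne j}k_{\mathrm{Dir}}(f(x_j);f(x_i))\,y_i}{\sum_{i\neq j}k_{\mathrm{Dir}}(f(x_j);f(x_i))}-f(x_j)\right\|_p^p=\mathbb{E}\Bigl[\bigl\|\mathbb{E}[y\mid f(x)]-f(x)\bigr\|_p^p\Bigr],$$ where $\operatorname{plim}$ denotes the limit in probability.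
   Context: Let $(\Omega,\mathcal A,\mathbb P)$ be a probability space, $K\ge 2$, $x:\Omega\to\mathbb{R}^d$ a random variable (features), and $y$ a random class label among $K$ classes, identified with its one-hot encoding, i.e. $y$ takes values in $\{e_1,\dots,e_K\}\subset\mathbb{R}^K$ (the standard basis). The classifier is a fixed measurable map $f:\mathbb{R}^d\to\triangle^K$, where $\triangle^K=\{s\in[0,1]^K:\sum_{k=1}^K s_k=1\}$ is the $(K-1)$-dimensional probability simplex. Densities on $\triangle^K$ are with respect to $(K-1)$-dimensional Lebesgue measure (using $K-1$ of the coordinates). The conditional expectation $\mathbb{E}[y\mid f(x)]$ is thus a random vector in $\triangle^K$. For a bandwidth $h>0$, the Dirichlet kernel is, for $s,t\in\triangle^K$, $$k_{\mathrm{Dir}}(s;t)=\frac{\Gamma\bigl(\sum_{k=1}^K\alpha_k\bigr)}{\prod_{k=1}^K\Gamma(\alpha_k)}\prod_{k=1}^K s_k^{\alpha_k-1},\qquad \alpha_k=\frac{t_k}{h}+1 .$$ In the estimator based on $n$ samples the bandwidth is $h=h_n$. *)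

theory Defs
  imports "HOL-Probability.Probability"
begin

definition prob_simplex :: "(real ^ 'k) set"
  where "prob_simplex = {s. (\<forall>k. s $ k \<in> {0..1}) \<and> (\<Sum>k\<in>UNIV. s $ k) = 1}"

text \<open>
  The reference measure is Lebesgue measure in the coordinates other than \<open>c\<close>, carried to the
  simplex by solving \<open>\<Sum>k. s $ k = 1\<close> for the coordinate \<open>c\<close>. It does not depend on \<open>c\<close>.
\<close>

definition simplex_chart :: "'k \<Rightarrow> ('k \<Rightarrow> real) \<Rightarrow> real ^ 'k"
  where "simplex_chart c u = (\<chi> k. if k = c then 1 - (\<Sum>i\<in>UNIV - {c}. u i) else u k)"

definition simplex_lebesgue :: "'k \<Rightarrow> (real ^ 'k) measure"
  where "simplex_lebesgue c =
    restrict_space (distr (\<Pi>\<^sub>M k\<in>UNIV - {c}. lborel) borel (simplex_chart c)) prob_simplex"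

text \<open>\<^const>\<open>distr\<close> is only meaningful for a measurable map.\<close>

lemma simplex_chart_measurable:
  "simplex_chart c \<in> (\<Pi>\<^sub>M k\<in>UNIV - {c}. lborel) \<rightarrow>\<^sub>M borel"
proof (rule borel_measurable_euclidean_space[THEN iffD2], rule ballI)
  fix b :: "real ^ 'a" assume "b \<in> Basis"
  then obtain k where b: "b = axis k 1"
    by (auto simp: Basis_vec_def)
  have "(\<lambda>u. simplex_chart c u \<bullet> b) =
      (\<lambda>u. if k = c then 1 - (\<Sum>i\<in>UNIV - {c}. u i) else u k)"
    by (simp add: b simplex_chart_def inner_axis)
  also have "\<dots> \<in> borel_measurable (\<Pi>\<^sub>M k\<in>UNIV - {c}. lborel)"
    by (cases "k = c") (auto intro!: borel_measurable_diff borel_measurable_sum)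
  finally show "(\<lambda>u. simplex_chart c u \<bullet> b) \<in> borel_measurable (\<Pi>\<^sub>M k\<in>UNIV - {c}. lborel)" .
qed

text \<open>
  Since \<open>0 powr 0 = 0\<close> in HOL, the factor \<open>s\<^sub>k\<close> to the power \<open>\<alpha>\<^sub>k - 1\<close> is written with an
  explicit case so that it is \<open>1\<close> when \<open>\<alpha>\<^sub>k = 1\<close>, also on the face \<open>s\<^sub>k = 0\<close>.
\<close>

definition dirichlet_kernel :: "real \<Rightarrow> real ^ 'k \<Rightarrow> real ^ 'k \<Rightarrow> real"
  where "dirichlet_kernel h s t =
    (let \<alpha> = (\<lambda>k. t $ k / h + 1)
     in Gamma (\<Sum>k\<in>UNIV. \<alpha> k) / (\<Prod>k\<in>UNIV. Gamma (\<alpha> k)) *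
        (\<Prod>k\<in>UNIV. if \<alpha> k = 1 then 1 else (s $ k) powr (\<alpha> k - 1)))"

definition lp_norm :: "real \<Rightarrow> real ^ 'k \<Rightarrow> real"
  where "lp_norm p v = (\<Sum>k\<in>UNIV. \<bar>v $ k\<bar> powr p) powr (1 / p)"

text \<open>The sample is indexed by \<open>{..<n}\<close>; \<open>z j\<close> is the prediction \<open>f(x\<^sub>j)\<close> and \<open>l j\<close> the label \<open>y\<^sub>j\<close>.\<close>

definition calibration_estimator ::
    "real \<Rightarrow> real \<Rightarrow> nat \<Rightarrow> (nat \<Rightarrow> real ^ 'k) \<Rightarrow> (nat \<Rightarrow> real ^ 'k) \<Rightarrow> real"
  where "calibration_estimator p h n z l =
    1 / real n * (\<Sum>j<n.
      lp_norm p ((\<Sum>i\<in>{..<n} - {j}. dirichlet_kernel h (z j) (z i) *\<^sub>R l i) /\<^sub>R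
                   (\<Sum>i\<in>{..<n} - {j}. dirichlet_kernel h (z j) (z i)) - z j) powr p)"

text \<open>\<open>E[Y | Z]\<close> for a random vector \<open>Y\<close>, taken componentwise, given the sigma-algebra of \<open>Z\<close>.\<close>

definition vec_cond_exp ::
    "'a measure \<Rightarrow> ('a \<Rightarrow> 'b::topological_space) \<Rightarrow> ('a \<Rightarrow> real ^ 'k) \<Rightarrow> 'a \<Rightarrow> real ^ 'k"
  where "vec_cond_exp M Z Y \<omega> =
    (\<chi> k. real_cond_exp M (vimage_algebra (space M) Z borel) (\<lambda>\<omega>. Y \<omega> $ k) \<omega>)"

definition iid_copies ::
    "'a measure \<Rightarrow> ('a \<Rightarrow> 'b::topological_space) \<Rightarrow> (nat \<Rightarrow> 'a \<Rightarrow> 'b) \<Rightarrow> bool"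
  where "iid_copies M W V \<longleftrightarrow>
    prob_space.indep_vars M (\<lambda>_. borel) V UNIV \<and>
    (\<forall>i. distr M borel (V i) = distr M borel W)"

definition tendsto_in_prob :: "'a measure \<Rightarrow> (nat \<Rightarrow> 'a \<Rightarrow> real) \<Rightarrow> real \<Rightarrow> bool"
  where "tendsto_in_prob M V c \<longleftrightarrow>
    (\<forall>n. V n \<in> borel_measurable M) \<and>
    (\<forall>\<epsilon>>0. (\<lambda>n. measure M {\<omega> \<in> space M. \<bar>V n \<omega> - c\<bar> > \<epsilon>}) \<longlonglongrightarrow> 0)"

end

theory Submission
  imports Defs
begin

text \<open>
  Write \<open>Z = f(x)\<close>, let \<open>m\<close> be a regression function, \<open>m(Z) = E[y | Z]\<close>, and let
  \<open>R\<^sub>h(s) = \<integral> k(s; t) m(t) g(t) dt / \<integral> k(s; t) g(t) dt\<close>. For fixed \<open>h\<close>, the leave-one-out ratios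
  converge in \<open>L\<^sup>1\<close> to \<open>R\<^sub>h(Z)\<close> by a second moment bound, and the law of large numbers gives the limit
  \<open>E \<parallel>R\<^sub>h(Z) - Z\<parallel>\<^sub>p\<^sup>p\<close> of the estimator. So it suffices to show \<open>R\<^sub>h(Z) \<rightarrow> m(Z)\<close> in \<open>L\<^sup>1\<close> as \<open>h \<rightarrow> 0\<close> and
  to let \<open>h\<^sub>n\<close> tend to \<open>0\<close> slowly enough, without any rates.

  Since \<open>k(\<cdot>; t)\<close> is a probability density concentrating at \<open>t\<close>, replacing \<open>m\<close> by a continuous function
  that is close to it in \<open>L\<^sup>1\<close> reduces the claim to a lower bound of \<open>\<integral> k(s; t) g(t) dt\<close>, uniform in small \<open>h\<close>,
  at almost every \<open>s\<close> with \<open>g(s) > 0\<close>. No Stirling asymptotics are needed for it: by Chebyshev, \<open>k(\<cdot>; t)\<close> has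
  mass at least \<open>1/2\<close> in a box of side \<open>O(sqrt h)\<close> around \<open>t\<close>, and on this scale \<open>k(s'; t)\<close> and \<open>k(s; t)\<close>
  agree up to a constant factor.
\<close>

section \<open>Sums over an i.i.d. sample\<close>

text \<open>The kernel is a density in its first argument, while the estimator sums over the second.
  Integrating errors over \<open>s\<close> first is therefore cheap, which is why they are measured
  in L1. For fixed \<open>s\<close>, however, nothing normalises the integral of k(s; t) g(t) over
  t, so the denominator of the ratio needs a lower bound of its own; the points with g(s) = 0 carry
  no mass and drop out.

  The bandwidth sequence must be fixed before the sample: it may depend on the law of (f(x), y) but
  not on the copies. Hence the law \<nu> is a parameter separate from M, and the sample bounds come
  with a threshold for n that serves every sample with law \<nu>.

  Two conventions are at work throughout. A quotient with denominator 0 is 0 and so still lies in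
  the unit interval, which covers the empty leave-one-out sum at n = 1. The copies share only the
  law of (x, y), so their labels are one-hot almost surely and not everywhere; the estimator is
  therefore replaced by a modification that is bounded at every sample point.\<close>

locale iid_sample = prob_space M + law: prob_space \<nu>
  for M :: "'a measure" and \<nu> :: "'w measure" +
  fixes V :: "nat \<Rightarrow> 'a \<Rightarrow> 'w"
  assumes indep: "indep_vars (\<lambda>_. \<nu>) V UNIV"
    and distr_eq: "distr M \<nu> (V i) = \<nu>"
begin

lemma measurable_sample [measurable]: "V i \<in> M \<rightarrow>\<^sub>M \<nu>"
  using indep by (auto simp: indep_vars_def2)

lemma integral_sample:
  fixes F :: "'w \<Rightarrow> real"
  assumes [measurable]: "F \<in> borel_measurable \<nu>"
  shows "expectation (\<lambda>x. F (V i x)) = (\<integral>w. F w \<partial>\<nu>)"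
  using integral_distr[OF measurable_sample, of F i] by (simp add: distr_eq)

text \<open>\<open>indep_var\<close> relates variables with values in one common type, so the single
  variable \<open>V l\<close> is doubled to match the pair \<open>(V i, V j)\<close>.\<close>

lemma indep_var_pair:
  assumes "i \<noteq> j" "j \<noteq> l" "i \<noteq> l"
  shows "indep_var (\<nu> \<Otimes>\<^sub>M \<nu>) (\<lambda>x. (V i x, V j x)) (\<nu> \<Otimes>\<^sub>M \<nu>) (\<lambda>x. (V l x, V l x))"
proof -
  have "indep_var (PiM {i,j} (\<lambda>_. \<nu>)) (\<lambda>x. restrict (\<lambda>i. V i x) {i,j})
      (PiM {l} (\<lambda>_. \<nu>)) (\<lambda>x. restrict (\<lambda>i. V i x) {l})"
    by (rule indep_var_restrict[OF indep]) (use assms in auto)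
  from indep_var_compose[OF this, of "\<lambda>r. (r i, r j)" "\<nu> \<Otimes>\<^sub>M \<nu>" "\<lambda>r. (r l, r l)" "\<nu> \<Otimes>\<^sub>M \<nu>"]
  show ?thesis by (simp add: comp_def)
qed

lemma indep_var_sample:
  assumes "i \<noteq> l"
  shows "indep_var \<nu> (V i) \<nu> (V l)"
proof -
  have "indep_var (PiM {i} (\<lambda>_. \<nu>)) (\<lambda>x. restrict (\<lambda>i. V i x) {i})
      (PiM {l} (\<lambda>_. \<nu>)) (\<lambda>x. restrict (\<lambda>i. V i x) {l})"
    by (rule indep_var_restrict[OF indep]) (use assms in auto)
  from indep_var_compose[OF this, of "\<lambda>r. r i" \<nu> "\<lambda>r. r l" \<nu>]
  show ?thesis by (simp add: comp_def)
qed

lemma distr_pair: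
  assumes "i \<noteq> l"
  shows "distr M (\<nu> \<Otimes>\<^sub>M \<nu>) (\<lambda>x. (V i x, V l x)) = \<nu> \<Otimes>\<^sub>M \<nu>"
  using indep_var_sample[OF assms] unfolding indep_var_distribution_eq by (simp add: distr_eq)

text \<open>With \<open>V i\<close> and \<open>V j\<close> frozen, only the factor
  \<open>u (V i x, V l x)\<close> is random, and it is centered in its second argument. Independence
  turns the freezing into Fubini over the law of the pair times the law of the doubled
  \<open>V l\<close>.\<close>

lemma cross_term_zero:
  fixes u :: "'w \<times> 'w \<Rightarrow> real"
  assumes [measurable]: "u \<in> borel_measurable (\<nu> \<Otimes>\<^sub>M \<nu>)"
    and bnd: "\<And>w w'. w \<in> space \<nu> \<Longrightarrow> w' \<in> space \<nu> \<Longrightarrow> \<bar>u (w, w')\<bar> \<le> C"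
    and centered: "\<And>w. w \<in> space \<nu> \<Longrightarrow> (\<integral>w'. u (w, w') \<partial>\<nu>) = 0"
    and "i \<noteq> j" "j \<noteq> l" "i \<noteq> l"
  shows "expectation (\<lambda>x. u (V i x, V j x) * u (V i x, V l x)) = 0"
proof -
  let ?N = "distr M (\<nu> \<Otimes>\<^sub>M \<nu>) (\<lambda>x. (V l x, V l x))"
  interpret P: pair_prob_space \<nu> \<nu> ..
  interpret N: prob_space ?N by (rule prob_space_distr) simp
  interpret T: pair_prob_space "\<nu> \<Otimes>\<^sub>M \<nu>" ?N ..
  let ?F = "\<lambda>z. u (fst z) * u (fst (fst z), fst (snd z))"
  have F: "?F \<in> borel_measurable ((\<nu> \<Otimes>\<^sub>M \<nu>) \<Otimes>\<^sub>M (\<nu> \<Otimes>\<^sub>M \<nu>))" by measurable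
  then have F': "?F \<in> borel_measurable ((\<nu> \<Otimes>\<^sub>M \<nu>) \<Otimes>\<^sub>M ?N)" by simp
  have b: "AE z in (\<nu> \<Otimes>\<^sub>M \<nu>) \<Otimes>\<^sub>M ?N. norm (?F z) \<le> C * C"
    by (rule AE_I2) (auto simp: space_pair_measure abs_mult intro!: mult_mono bnd intro: order_trans[OF abs_ge_zero bnd])
  have int: "integrable ((\<nu> \<Otimes>\<^sub>M \<nu>) \<Otimes>\<^sub>M ?N) ?F"
    by (rule T.integrable_const_bound[OF b F'])
  have joint: "distr M ((\<nu> \<Otimes>\<^sub>M \<nu>) \<Otimes>\<^sub>M (\<nu> \<Otimes>\<^sub>M \<nu>)) (\<lambda>x. ((V i x, V j x), (V l x, V l x))) =
      (\<nu> \<Otimes>\<^sub>M \<nu>) \<Otimes>\<^sub>M ?N"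
    using indep_var_pair[OF assms(4-6)] distr_pair[OF assms(4)]
    unfolding indep_var_distribution_eq by simp
  have "expectation (\<lambda>x. u (V i x, V j x) * u (V i x, V l x)) =
      expectation (\<lambda>x. ?F ((V i x, V j x), (V l x, V l x)))" by simp
  also have "\<dots> = (\<integral>z. ?F z \<partial>((\<nu> \<Otimes>\<^sub>M \<nu>) \<Otimes>\<^sub>M ?N))"
    unfolding joint[symmetric] by (rule integral_distr[OF _ F, symmetric]) simp
  also have "\<dots> = (\<integral>x. (\<integral>b. ?F (x, b) \<partial>?N) \<partial>(\<nu> \<Otimes>\<^sub>M \<nu>))"
    by (rule T.integral_fst'[OF int, symmetric])
  also have "\<dots> = (\<integral>x. 0 \<partial>(\<nu> \<Otimes>\<^sub>M \<nu>))"
  proof (rule Bochner_Integration.integral_cong)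
    fix x assume "x \<in> space (\<nu> \<Otimes>\<^sub>M \<nu>)"
    then obtain w a where x: "x = (w, a)" "w \<in> space \<nu>" by (auto simp: space_pair_measure)
    then have "(\<integral>b. ?F (x, b) \<partial>?N) = expectation (\<lambda>x. u (w, a) * u (w, V l x))"
      by (subst integral_distr) auto
    also have "\<dots> = u (w, a) * (\<integral>w'. u (w, w') \<partial>\<nu>)"
      using integral_sample[of "\<lambda>w'. u (w, w')" l] x by simp
    finally show "(\<integral>b. ?F (x, b) \<partial>?N) = 0" using centered x by simp
  qed simp
  finally show ?thesis by simp
qed

text \<open>The shared first argument \<open>V j\<close> makes the summands dependent, but by
  \<open>cross_term_zero\<close> they are uncorrelated. So only the diagonal of the expanded square
  survives, and the second moment grows like \<open>card I\<close> instead of its square.\<close>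

lemma L1_centered_sum:
  fixes u :: "'w \<times> 'w \<Rightarrow> real"
  assumes [measurable]: "u \<in> borel_measurable (\<nu> \<Otimes>\<^sub>M \<nu>)"
    and bnd: "\<And>w w'. w \<in> space \<nu> \<Longrightarrow> w' \<in> space \<nu> \<Longrightarrow> \<bar>u (w, w')\<bar> \<le> C"
    and centered: "\<And>w. w \<in> space \<nu> \<Longrightarrow> (\<integral>w'. u (w, w') \<partial>\<nu>) = 0"
    and C: "C > 0" and I: "finite I" "j \<notin> I"
  shows "expectation (\<lambda>x. \<bar>\<Sum>i\<in>I. u (V j x, V i x)\<bar>) \<le> C * sqrt (card I)"
proof (cases "I = {}")
  case False
  have V: "V i x \<in> space \<nu>" if "x \<in> space M" for i x
    using measurable_space[OF measurable_sample that] .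
  have int: "integrable M (\<lambda>x. u (V j x, V i x) * u (V j x, V i' x))" for i i'
    by (rule integrable_const_bound[where B="C*C"])
       (use C in \<open>auto simp: abs_mult intro!: mult_mono bnd V\<close>)
  have int1: "integrable M (\<lambda>x. u (V j x, V i x))" for i
    by (rule integrable_const_bound[where B="C"]) (auto intro!: bnd V)
  let ?S = "\<lambda>x. \<Sum>i\<in>I. u (V j x, V i x)"
  have sq: "(?S x)^2 = (\<Sum>i\<in>I. \<Sum>i'\<in>I. u (V j x, V i x) * u (V j x, V i' x))" for x
    by (simp add: power2_eq_square sum_product)
  have intsq: "integrable M (\<lambda>x. (?S x)^2)" unfolding sq using int by auto
  have "expectation (\<lambda>x. (?S x)^2) =
      (\<Sum>i\<in>I. \<Sum>i'\<in>I. expectation (\<lambda>x. u (V j x, V i x) * u (V j x, V i' x)))"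
    unfolding sq using int by (simp add: Bochner_Integration.integral_sum)
  also have "\<dots> \<le> (\<Sum>i\<in>I. \<Sum>i'\<in>I. if i = i' then C * C else 0)"
  proof (intro sum_mono)
    fix i i' assume ii: "i \<in> I" "i' \<in> I"
    show "expectation (\<lambda>x. u (V j x, V i x) * u (V j x, V i' x)) \<le> (if i = i' then C * C else 0)"
    proof (cases "i = i'")
      case True
      have "expectation (\<lambda>x. u (V j x, V i x) * u (V j x, V i' x)) \<le> C * C"
      proof (rule integral_le_const[OF int AE_I2])
        fix x assume w: "x \<in> space M"
        have "u (V j x, V i x) * u (V j x, V i' x) \<le> \<bar>u (V j x, V i x)\<bar> * \<bar>u (V j x, V i' x)\<bar>"
          by (metis abs_ge_self abs_mult)
        also have "\<dots> \<le> C * C" using C by (intro mult_mono bnd V w) auto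
        finally show "u (V j x, V i x) * u (V j x, V i' x) \<le> C * C" .
      qed
      then show ?thesis using True by simp
    next
      case False
      then have "expectation (\<lambda>x. u (V j x, V i x) * u (V j x, V i' x)) = 0"
        using ii I by (intro cross_term_zero[where C=C] bnd centered) auto
      then show ?thesis using False by simp
    qed
  qed
  also have "\<dots> = card I * C^2" using I by (simp add: power2_eq_square)
  finally have ES: "expectation (\<lambda>x. (?S x)^2) \<le> card I * C^2" .
  \<comment> \<open>The inequality \<open>am\<close> stands in for Cauchy-Schwarz. The square of
    this \<open>a\<close> is the bound on the second moment, so the two halves balance and add up to
    \<open>a\<close> itself.\<close>
  define a where "a = C * sqrt (card I)"
  have a: "a > 0" using C False I by (simp add: a_def card_gt_0_iff)
  have am: "\<bar>x\<bar> \<le> (x^2 / a + a) / 2" for x :: real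
  proof -
    have "0 \<le> (\<bar>x\<bar> - a)^2" by simp
    then have "2 * a * \<bar>x\<bar> \<le> x^2 + a^2" by (simp add: power2_eq_square algebra_simps)
    then show ?thesis using a by (simp add: field_simps power2_eq_square)
  qed
  have "expectation (\<lambda>x. \<bar>?S x\<bar>) \<le> expectation (\<lambda>x. ((?S x)^2 / a + a) / 2)"
    by (rule integral_mono) (use intsq int1 am in auto)
  also have "\<dots> = (expectation (\<lambda>x. (?S x)^2) / a + a) / 2"
    using intsq by (simp add: prob_space)
  also have "\<dots> \<le> ((card I * C^2) / a + a) / 2"
    using ES a by (simp add: divide_right_mono)
  also have "(card I * C^2) / a = a"
  proof -
    have "a * a = card I * C^2" by (simp add: a_def power2_eq_square algebra_simps)
    then show ?thesis using a by (simp add: field_simps)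
  qed
  finally show ?thesis by (simp add: a_def)
qed simp

end

section \<open>Elementary estimates for powers, ratios and small denominators\<close>

lemma abs_powr_lipschitz:
  fixes a b p :: real
  assumes p: "p \<ge> 1" and "\<bar>a\<bar> \<le> 1" "\<bar>b\<bar> \<le> 1"
  shows "\<bar>\<bar>a\<bar> powr p - \<bar>b\<bar> powr p\<bar> \<le> p * \<bar>a - b\<bar>"
proof -
  have *: "y powr p - x powr p \<le> p * (y - x)" if xy: "0 \<le> x" "x < y" "y \<le> 1" for x y :: real
  proof -
    \<comment> \<open>The mean value theorem asks for differentiability only inside the interval, so
      \<open>x = 0\<close> is harmless. Inside, the slope \<open>p * z powr (p - 1)\<close> is at
      most \<open>p\<close> because \<open>z < 1\<close> and \<open>p \<ge> 1\<close>.\<close>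
    have "\<exists>l z. x < z \<and> z < y \<and> ((\<lambda>x. x powr p) has_real_derivative l) (at z) \<and>
        y powr p - x powr p = (y - x) * l"
    proof (rule MVT[OF xy(2)])
      show "continuous_on {x..y} (\<lambda>x. x powr p)"
        using xy p by (intro continuous_on_powr' continuous_intros) auto
      show "(\<lambda>x. x powr p) differentiable (at t)" if "x < t" "t < y" for t
        using that xy by (intro differentiableI[OF has_real_derivative_powr[THEN has_field_derivative_imp_has_derivative]]) auto
    qed
    then obtain l z where z: "z > x" "z < y" "((\<lambda>x. x powr p) has_real_derivative l) (at z)"
      and l: "y powr p - x powr p = (y - x) * l" by blast
    have "l = p * z powr (p - 1)"
      using DERIV_unique[OF z(3) has_real_derivative_powr[of z p]] z xy by simp
    note z = z(1,2) l[unfolded this]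
    have "z powr (p - 1) \<le> 1" using z xy p by (intro powr_le1) auto
    then show ?thesis using z xy p by (simp add: mult_left_mono mult.commute mult_le_one)
  qed
  have "\<bar>y powr p - x powr p\<bar> \<le> p * \<bar>y - x\<bar>" if xy: "0 \<le> x" "x \<le> y" "y \<le> 1" for x y :: real
    using *[of x y] xy p powr_mono2[of p x y] by (cases "x = y") auto
  from this[of "\<bar>a\<bar>" "\<bar>b\<bar>"] this[of "\<bar>b\<bar>" "\<bar>a\<bar>"] assms
  have "\<bar>\<bar>a\<bar> powr p - \<bar>b\<bar> powr p\<bar> \<le> p * \<bar>\<bar>a\<bar> - \<bar>b\<bar>\<bar>"
    by (cases "\<bar>a\<bar> \<le> \<bar>b\<bar>") (auto simp: abs_minus_commute)
  also have "\<dots> \<le> p * \<bar>a - b\<bar>" using p by (intro mult_left_mono) auto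
  finally show ?thesis .
qed

text \<open>A positive random denominator may come arbitrarily close to 0. The events
  \<open>A m\<close> decrease to a null set, so continuity from above confines the trouble to an
  event of small probability.\<close>

lemma (in prob_space) small_prob_below:
  fixes D :: "'a \<Rightarrow> real"
  assumes [measurable]: "D \<in> borel_measurable M" and pos: "AE w in M. D w > 0" and "e > 0"
  obtains d where "d > 0" "prob {w \<in> space M. D w < d} < e"
proof -
  define A where "A m = {w \<in> space M. D w < 1 / real (Suc m)}" for m
  have Aev [measurable]: "A m \<in> sets M" for m unfolding A_def by measurable
  have "decseq A"
  proof (rule decseq_SucI)
    fix m
    have "1 / real (Suc (Suc m)) \<le> 1 / real (Suc m)" by (simp add: frac_le)
    then show "A (Suc m) \<subseteq> A m" unfolding A_def by (smt (verit) Collect_mono)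
  qed
  then have "(\<lambda>m. prob (A m)) \<longlonglongrightarrow> prob (\<Inter>m. A m)"
    by (intro finite_Lim_measure_decseq) auto
  also have "prob (\<Inter>m. A m) = 0"
  proof (rule prob_eq_0[THEN iffD2])
    show "AE w in M. w \<notin> (\<Inter>m. A m)"
      using pos
    proof (rule AE_mp, intro AE_I2 impI)
      fix w assume "D w > 0"
      then obtain m where "1 / real (Suc m) < D w"
        using reals_Archimedean[of "D w"] by (auto simp: inverse_eq_divide)
      then show "w \<notin> (\<Inter>m. A m)" unfolding A_def by (auto intro!: exI[of _ m] simp: not_less)
    qed
  qed simp
  finally have "eventually (\<lambda>m. prob (A m) < e) sequentially"
    using \<open>e > 0\<close> by (rule order_tendstoD)
  then obtain m where "prob (A m) < e" by (auto simp: eventually_sequentially)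
  then show ?thesis by (intro that[of "1 / real (Suc m)"]) (auto simp: A_def)
qed

text \<open>The case \<open>b = 0\<close> is included on purpose: division by 0 gives 0, which keeps
  empty or vanishing leave-one-out sums inside the unit interval.\<close>

lemma ratio_in_unit:
  fixes a b :: real
  assumes "0 \<le> a" "a \<le> b"
  shows "a / b \<in> {0..1}"
  using assms by (cases "b = 0") auto

text \<open>The decomposition in the proof charges the error of \<open>B\<close> with the factor
  \<open>A / B\<close>, which is at most 1. Thus only the limit denominator \<open>D\<close> has to
  stay away from 0; the random denominator \<open>B\<close> may even vanish.\<close>

lemma ratio_diff_bound:
  fixes A B Q D m d :: real
  assumes "0 \<le> A" "A \<le> B" "0 < D" "d \<le> D" "d > 0" "m > 0" "0 \<le> Q" "Q \<le> D"
  shows "\<bar>A / B - Q / D\<bar> \<le> (\<bar>A - m * Q\<bar> + \<bar>B - m * D\<bar>) / (m * d)"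
proof -
  have r: "A / B \<in> {0..1}" using assms by (intro ratio_in_unit)
  have "A / B - Q / D = ((A - m * Q) - A / B * (B - m * D)) / (m * D)"
    using assms by (cases "B = 0") (auto simp: field_simps)
  also have "\<bar>\<dots>\<bar> = \<bar>(A - m * Q) - A / B * (B - m * D)\<bar> / (m * D)"
    using assms by (simp add: abs_div)
  also have "\<dots> \<le> (\<bar>A - m * Q\<bar> + \<bar>B - m * D\<bar>) / (m * D)"
  proof (rule divide_right_mono)
    have "\<bar>A / B * (B - m * D)\<bar> \<le> 1 * \<bar>B - m * D\<bar>"
      unfolding abs_mult by (rule mult_right_mono) (use r in auto)
    then have "\<bar>A - m * Q\<bar> + \<bar>A / B * (B - m * D)\<bar> \<le> \<bar>A - m * Q\<bar> + \<bar>B - m * D\<bar>"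
      by (simp only: mult_1 add_left_mono)
    with abs_triangle_ineq4
    show "\<bar>(A - m * Q) - A / B * (B - m * D)\<bar> \<le> \<bar>A - m * Q\<bar> + \<bar>B - m * D\<bar>"
      by (rule order_trans)
  qed (use assms in auto)
  also have "\<dots> \<le> (\<bar>A - m * Q\<bar> + \<bar>B - m * D\<bar>) / (m * d)"
    using assms by (intro divide_left_mono mult_left_mono mult_pos_pos) auto
  finally show ?thesis .
qed

text \<open>Where the limit denominator is below \<open>d\<close>, an event of small probability,
  both ratios lie in the unit interval and are compared trivially. Elsewhere their difference is
  controlled by centered sums, whose size is the square root of the number of terms, divided by that
  number. The threshold is chosen before \<open>M\<close>, \<open>V\<close> and
  \<open>j\<close>.\<close>

lemma plugin_ratio_L1:
  fixes \<nu> :: "'w measure" and \<kappa> q :: "'w \<times> 'w \<Rightarrow> real"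
  assumes "prob_space \<nu>"
    and [measurable]: "\<kappa> \<in> borel_measurable (\<nu> \<Otimes>\<^sub>M \<nu>)" "q \<in> borel_measurable (\<nu> \<Otimes>\<^sub>M \<nu>)"
    and q: "\<And>w w'. w \<in> space \<nu> \<Longrightarrow> w' \<in> space \<nu> \<Longrightarrow> 0 \<le> q (w, w') \<and> q (w, w') \<le> \<kappa> (w, w')"
    and \<kappa>: "\<And>w w'. w \<in> space \<nu> \<Longrightarrow> w' \<in> space \<nu> \<Longrightarrow> \<kappa> (w, w') \<le> C"
    and pos: "AE w in \<nu>. (\<integral>w'. \<kappa> (w, w') \<partial>\<nu>) > 0"
    and "e > 0"
  shows "\<exists>n\<^sub>0. \<forall>n\<ge>n\<^sub>0. \<forall>(M :: 'a measure) V j. iid_sample M \<nu> V \<longrightarrow> j < n \<longrightarrow>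
    (\<integral>x. \<bar>(\<Sum>i\<in>{..<n} - {j}. q (V j x, V i x)) / (\<Sum>i\<in>{..<n} - {j}. \<kappa> (V j x, V i x)) -
      (\<integral>w'. q (V j x, w') \<partial>\<nu>) / (\<integral>w'. \<kappa> (V j x, w') \<partial>\<nu>)\<bar> \<partial>M) \<le> e"
proof -
  interpret law: prob_space \<nu> by fact
  define D Q where "D w = (\<integral>w'. \<kappa> (w, w') \<partial>\<nu>)" and "Q w = (\<integral>w'. q (w, w') \<partial>\<nu>)" for w
  have D_meas [measurable]: "D \<in> borel_measurable \<nu>" unfolding D_def by measurable
  have Q_meas [measurable]: "Q \<in> borel_measurable \<nu>" unfolding Q_def by measurable
  \<comment> \<open>\<open>L1_centered_sum\<close> wants a positive bound; the maximum with 1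
    provides one for every \<open>C\<close>.\<close>
  define C' where "C' = max C 1"
  have C': "C' \<ge> 1" "\<And>w w'. w \<in> space \<nu> \<Longrightarrow> w' \<in> space \<nu> \<Longrightarrow> \<kappa> (w, w') \<le> C'"
    using \<kappa> by (auto simp: C'_def le_max_iff_disj)
  have \<kappa>0: "0 \<le> \<kappa> (w, w')" if "w \<in> space \<nu>" "w' \<in> space \<nu>" for w w'
    using q[OF that] by linarith
  have int\<kappa>: "integrable \<nu> (\<lambda>w'. \<kappa> (w, w'))" if "w \<in> space \<nu>" for w
    by (rule law.integrable_const_bound[where B=C'])
       (use that C' q in \<open>force\<close>, use that in measurable)
  have intq: "integrable \<nu> (\<lambda>w'. q (w, w'))" if "w \<in> space \<nu>" for w
    by (rule law.integrable_const_bound[where B=C'])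
       (use that C' q in \<open>force\<close>, use that in measurable)
  have D: "0 \<le> D w" "D w \<le> C'" if "w \<in> space \<nu>" for w
    unfolding D_def using that C' \<kappa>0 int\<kappa>[OF that]
    by (auto intro!: law.integral_ge_const law.integral_le_const)
  have Q: "0 \<le> Q w" "Q w \<le> D w" if "w \<in> space \<nu>" for w
  proof -
    show "0 \<le> Q w" unfolding Q_def using that q by (intro integral_nonneg_AE) auto
    show "Q w \<le> D w" unfolding D_def Q_def
      using that q int\<kappa>[OF that] intq[OF that] by (intro integral_mono) auto
  qed
  obtain d where d: "d > 0" "law.prob {w \<in> space \<nu>. D w < d} < e / 4"
    by (rule law.small_prob_below[of D "e/4"]) (use pos \<open>e > 0\<close> in \<open>auto simp: D_def[symmetric]\<close>)
  have "(\<lambda>m. 2 * C' * sqrt (real m) / (real m * d)) \<longlonglongrightarrow> 0"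
  proof -
    have "(\<lambda>m. 2 * C' / d * inverse (sqrt (real m))) \<longlonglongrightarrow> 2 * C' / d * 0"
      by (intro tendsto_mult tendsto_const tendsto_inverse_0_at_top
          filterlim_compose[OF sqrt_at_top filterlim_real_sequentially])
    moreover have "2 * C' / d * inverse (sqrt (real m)) = 2 * C' * sqrt (real m) / (real m * d)" for m
    proof (cases "m = 0")
      case False
      then have "real m = sqrt (real m) * sqrt (real m)" "sqrt (real m) > 0" by simp_all
      then show ?thesis using d by (simp add: divide_simps)
    qed simp
    ultimately show ?thesis by simp
  qed
  then have "eventually (\<lambda>m. 2 * C' * sqrt (real m) / (real m * d) < e / 4) sequentially"
    using \<open>e > 0\<close> by (intro order_tendstoD) auto
  then obtain m0 where m0: "\<And>m. m \<ge> m0 \<Longrightarrow> 2 * C' * sqrt (real m) / (real m * d) < e / 4"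
    by (auto simp: eventually_sequentially)
  show ?thesis
  \<comment> \<open>Without \<open>j\<close> there are \<open>n - 1\<close> summands; the offset 2
    makes this number both positive and at least \<open>m0\<close>.\<close>
  proof (intro exI[of _ "m0 + 2"] allI impI)
    fix n M V j assume n: "n \<ge> m0 + 2" and iid: "iid_sample (M :: 'a measure) \<nu> V" and j: "j < n"
    interpret iid_sample M \<nu> V by fact
    define I where "I = {..<n} - {j}"
    define m where "m = card I"
    have m: "m = n - 1" using j by (simp add: m_def I_def)
    have m': "m \<ge> m0" "m > 0" using n m by auto
    have I: "finite I" "j \<notin> I" by (auto simp: I_def)
    have V: "V i x \<in> space \<nu>" if "x \<in> space M" for i x
      using measurable_space[OF measurable_sample that] .
    define u1 where "u1 = (\<lambda>(w, w'). q (w, w') - Q w)"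
    define u2 where "u2 = (\<lambda>(w, w'). \<kappa> (w, w') - D w)"
    have u_meas [measurable]: "u1 \<in> borel_measurable (\<nu> \<Otimes>\<^sub>M \<nu>)" "u2 \<in> borel_measurable (\<nu> \<Otimes>\<^sub>M \<nu>)"
      unfolding u1_def u2_def by measurable
    have b1: "\<bar>u1 (w, w')\<bar> \<le> C'" if "w \<in> space \<nu>" "w' \<in> space \<nu>" for w w'
      using q[OF that] C'(2)[OF that] Q[OF that(1)] D[OF that(1)] unfolding u1_def by auto
    have b2: "\<bar>u2 (w, w')\<bar> \<le> C'" if "w \<in> space \<nu>" "w' \<in> space \<nu>" for w w'
      using q[OF that] C'(2)[OF that] D[OF that(1)] unfolding u2_def by auto
    have E1: "expectation (\<lambda>x. \<bar>\<Sum>i\<in>I. u1 (V j x, V i x)\<bar>) \<le> C' * sqrt (card I)"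
      by (rule L1_centered_sum)
         (use b1 C' I intq in \<open>auto simp: u1_def Q_def law.prob_space\<close>)
    have E2: "expectation (\<lambda>x. \<bar>\<Sum>i\<in>I. u2 (V j x, V i x)\<bar>) \<le> C' * sqrt (card I)"
      by (rule L1_centered_sum)
         (use b2 C' I int\<kappa> in \<open>auto simp: u2_def D_def law.prob_space\<close>)
    have int_u1: "integrable M (\<lambda>x. \<bar>\<Sum>i\<in>I. u1 (V j x, V i x)\<bar>)"
      by (rule Bochner_Integration.integrable_abs, rule Bochner_Integration.integrable_sum, rule integrable_const_bound[where B=C'])
         (auto intro!: b1 V)
    have int_u2: "integrable M (\<lambda>x. \<bar>\<Sum>i\<in>I. u2 (V j x, V i x)\<bar>)"
      by (rule Bochner_Integration.integrable_abs, rule Bochner_Integration.integrable_sum, rule integrable_const_bound[where B=C'])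
         (auto intro!: b2 V)
    let ?A = "\<lambda>x. \<Sum>i\<in>I. q (V j x, V i x)"
    let ?B = "\<lambda>x. \<Sum>i\<in>I. \<kappa> (V j x, V i x)"
    let ?U = "\<lambda>x. (\<bar>\<Sum>i\<in>I. u1 (V j x, V i x)\<bar> + \<bar>\<Sum>i\<in>I. u2 (V j x, V i x)\<bar>) / (real m * d)"
    let ?X = "\<lambda>x. indicator {w \<in> space \<nu>. D w < d} (V j x) :: real"
    have pw: "\<bar>?A x / ?B x - Q (V j x) / D (V j x)\<bar> \<le> ?U x + 2 * ?X x" if w: "x \<in> space M" for x
    proof -
      have AB: "0 \<le> ?A x" "?A x \<le> ?B x"
        using q V[OF w] by (auto intro!: sum_nonneg sum_mono)
      have QD: "0 \<le> Q (V j x)" "Q (V j x) \<le> D (V j x)" using Q V[OF w] by auto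
      have U0: "0 \<le> ?U x" using d by auto
      show ?thesis
      proof (cases "D (V j x) < d")
        case True
        have "?A x / ?B x \<in> {0..1}" "Q (V j x) / D (V j x) \<in> {0..1}"
          using AB QD by (auto intro!: ratio_in_unit simp del: atLeastAtMost_iff)
        then have "\<bar>?A x / ?B x - Q (V j x) / D (V j x)\<bar> \<le> 2" by auto
        then show ?thesis using True U0 V[OF w] by (simp add: indicator_def)
      next
        case False
        have "(\<Sum>i\<in>I. u1 (V j x, V i x)) = ?A x - real m * Q (V j x)"
          "(\<Sum>i\<in>I. u2 (V j x, V i x)) = ?B x - real m * D (V j x)"
          by (auto simp: u1_def u2_def sum_subtractf m_def)
        moreover have "\<bar>?A x / ?B x - Q (V j x) / D (V j x)\<bar> \<le>
            (\<bar>?A x - real m * Q (V j x)\<bar> + \<bar>?B x - real m * D (V j x)\<bar>) / (real m * d)"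
          using AB QD False d m' by (intro ratio_diff_bound) auto
        ultimately show ?thesis using False by simp
      qed
    qed
    have "expectation (\<lambda>x. \<bar>?A x / ?B x - Q (V j x) / D (V j x)\<bar>) \<le>
        expectation (\<lambda>x. ?U x + 2 * ?X x)"
    proof (rule integral_mono'[OF _ pw])
      have "integrable M ?X" by (rule integrable_const_bound[where B=1]) auto
      then show "integrable M (\<lambda>x. ?U x + 2 * ?X x)" using int_u1 int_u2 by auto
      show "0 \<le> ?U x + 2 * ?X x" for x using d by (intro add_nonneg_nonneg) auto
    qed
    also have "\<dots> = (expectation (\<lambda>x. \<bar>\<Sum>i\<in>I. u1 (V j x, V i x)\<bar>) +
        expectation (\<lambda>x. \<bar>\<Sum>i\<in>I. u2 (V j x, V i x)\<bar>)) / (real m * d) + 2 * expectation ?X"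
    proof -
      have "integrable M ?X" by (rule integrable_const_bound[where B=1]) auto
      then show ?thesis using int_u1 int_u2 by (simp add: add_divide_distrib)
    qed
    also have "expectation ?X = law.prob {w \<in> space \<nu>. D w < d}"
      by (subst integral_sample) auto
    finally have le: "expectation (\<lambda>x. \<bar>?A x / ?B x - Q (V j x) / D (V j x)\<bar>) \<le>
        (expectation (\<lambda>x. \<bar>\<Sum>i\<in>I. u1 (V j x, V i x)\<bar>) +
        expectation (\<lambda>x. \<bar>\<Sum>i\<in>I. u2 (V j x, V i x)\<bar>)) / (real m * d) +
        2 * law.prob {w \<in> space \<nu>. D w < d}" .
    have "(expectation (\<lambda>x. \<bar>\<Sum>i\<in>I. u1 (V j x, V i x)\<bar>) +
        expectation (\<lambda>x. \<bar>\<Sum>i\<in>I. u2 (V j x, V i x)\<bar>)) / (real m * d) \<le>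
        (C' * sqrt m + C' * sqrt m) / (real m * d)"
      using E1 E2 d unfolding m_def by (intro divide_right_mono add_mono) auto
    also have "\<dots> = 2 * C' * sqrt (real m) / (real m * d)" by simp
    also have "\<dots> < e / 4" by (rule m0) fact
    finally have "expectation (\<lambda>x. \<bar>?A x / ?B x - Q (V j x) / D (V j x)\<bar>) \<le> e"
      using le d(2) \<open>e > 0\<close> by linarith
    then show "(\<integral>x. \<bar>(\<Sum>i\<in>{..<n} - {j}. q (V j x, V i x)) / (\<Sum>i\<in>{..<n} - {j}. \<kappa> (V j x, V i x)) -
      (\<integral>w'. q (V j x, w') \<partial>\<nu>) / (\<integral>w'. \<kappa> (V j x, w') \<partial>\<nu>)\<bar> \<partial>M) \<le> e"
      by (simp add: I_def D_def Q_def)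
  qed
qed

lemma abs_diff_le_one:
  fixes a b :: real
  shows "a \<in> {0..1} \<Longrightarrow> b \<in> {0..1} \<Longrightarrow> \<bar>a - b\<bar> \<le> 1"
  by auto

text \<open>By Lipschitz continuity of the power, replacing a ratio by its limit costs at most
  \<open>p\<close> times the error in \<open>plugin_ratio_L1\<close>. What remains is an average of
  the independent variables \<open>\<phi> (V j)\<close>, to which the law of large numbers in L1
  applies.\<close>

lemma plugin_estimator_L1:
  fixes \<nu> :: "'w measure" and \<kappa> :: "'w \<times> 'w \<Rightarrow> real" and q :: "'k :: finite \<Rightarrow> 'w \<times> 'w \<Rightarrow> real"
    and z :: "'w \<Rightarrow> 'k \<Rightarrow> real"
  assumes "prob_space \<nu>"
    and [measurable]: "\<kappa> \<in> borel_measurable (\<nu> \<Otimes>\<^sub>M \<nu>)" "\<And>k. q k \<in> borel_measurable (\<nu> \<Otimes>\<^sub>M \<nu>)"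
      "\<And>k. (\<lambda>w. z w k) \<in> borel_measurable \<nu>"
    and q: "\<And>k w w'. w \<in> space \<nu> \<Longrightarrow> w' \<in> space \<nu> \<Longrightarrow> 0 \<le> q k (w, w') \<and> q k (w, w') \<le> \<kappa> (w, w')"
    and \<kappa>: "\<And>w w'. w \<in> space \<nu> \<Longrightarrow> w' \<in> space \<nu> \<Longrightarrow> \<kappa> (w, w') \<le> C"
    and pos: "AE w in \<nu>. (\<integral>w'. \<kappa> (w, w') \<partial>\<nu>) > 0"
    and z: "\<And>w k. w \<in> space \<nu> \<Longrightarrow> z w k \<in> {0..1}"
    and p: "p \<ge> 1" and "e > 0"
  shows "\<exists>n\<^sub>0. \<forall>n\<ge>n\<^sub>0. \<forall>(M :: 'a measure) V. iid_sample M \<nu> V \<longrightarrow>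
    (\<integral>x. \<bar>1 / real n * (\<Sum>j<n. \<Sum>k\<in>UNIV.
        \<bar>(\<Sum>i\<in>{..<n} - {j}. q k (V j x, V i x)) / (\<Sum>i\<in>{..<n} - {j}. \<kappa> (V j x, V i x)) - z (V j x) k\<bar> powr p) -
      (\<integral>w. (\<Sum>k\<in>UNIV. \<bar>(\<integral>w'. q k (w, w') \<partial>\<nu>) / (\<integral>w'. \<kappa> (w, w') \<partial>\<nu>) - z w k\<bar> powr p) \<partial>\<nu>)\<bar> \<partial>M) \<le> e"
proof -
  interpret law: prob_space \<nu> by fact
  define K where "K = real CARD('k)"
  have K: "K \<ge> 1" using Suc_leI[of 0 "CARD('k)"] by (simp add: K_def)
  define R where "R k w = (\<integral>w'. q k (w, w') \<partial>\<nu>) / (\<integral>w'. \<kappa> (w, w') \<partial>\<nu>)" for k w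
  have R_meas [measurable]: "R k \<in> borel_measurable \<nu>" for k unfolding R_def by measurable
  have R: "R k w \<in> {0..1}" if w: "w \<in> space \<nu>" for k w
  proof -
    have \<kappa>0: "0 \<le> \<kappa> (w, w')" if "w' \<in> space \<nu>" for w'
      using q[OF w that] by (meson order_trans)
    have "integrable \<nu> (\<lambda>w'. \<kappa> (w, w'))"
      by (rule law.integrable_const_bound[where B=C]) (use w \<kappa> \<kappa>0 in auto)
    moreover have "integrable \<nu> (\<lambda>w'. q k (w, w'))"
      by (rule Bochner_Integration.integrable_bound[OF \<open>integrable \<nu> (\<lambda>w'. \<kappa> (w, w'))\<close>])
         (use w q \<kappa>0 in auto)
    ultimately have "(\<integral>w'. q k (w, w') \<partial>\<nu>) \<le> (\<integral>w'. \<kappa> (w, w') \<partial>\<nu>)"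
      using w q by (intro integral_mono) auto
    moreover have "0 \<le> (\<integral>w'. q k (w, w') \<partial>\<nu>)" using w q by (intro integral_nonneg_AE) auto
    ultimately show ?thesis unfolding R_def by (intro ratio_in_unit)
  qed
  define \<phi> where "\<phi> w = (\<Sum>k\<in>UNIV. \<bar>R k w - z w k\<bar> powr p)" for w
  have \<phi>_meas [measurable]: "\<phi> \<in> borel_measurable \<nu>" unfolding \<phi>_def by measurable
  have \<phi>: "0 \<le> \<phi> w" "\<phi> w \<le> K" if "w \<in> space \<nu>" for w
  proof -
    show "0 \<le> \<phi> w" unfolding \<phi>_def by (intro sum_nonneg) auto
    have "\<phi> w \<le> (\<Sum>k\<in>(UNIV :: 'k set). 1)"
      unfolding \<phi>_def
    proof (rule sum_mono)
      fix k
      have "\<bar>R k w - z w k\<bar> \<le> 1" by (rule abs_diff_le_one[OF R[OF that] z[OF that]])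
      then show "\<bar>R k w - z w k\<bar> powr p \<le> 1" using p by (intro powr_le1) auto
    qed
    then show "\<phi> w \<le> K" by (simp add: K_def)
  qed
  define T where "T = (\<integral>w. \<phi> w \<partial>\<nu>)"
  have T: "0 \<le> T" "T \<le> K"
    unfolding T_def using \<phi> by (auto intro!: law.integral_ge_const law.integral_le_const law.integrable_const_bound[where B=K])
  \<comment> \<open>The \<open>K\<close> coordinates contribute \<open>p * e'\<close> each, which
    spends half of \<open>e\<close>; the other half is left to the law of large numbers.\<close>
  define e' where "e' = e / (2 * p * K)"
  have e': "e' > 0" using \<open>e > 0\<close> p K by (simp add: e'_def)
  have "\<exists>N. \<forall>k. \<forall>n\<ge>N k. \<forall>(M :: 'a measure) V j. iid_sample M \<nu> V \<longrightarrow> j < n \<longrightarrow>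
    (\<integral>x. \<bar>(\<Sum>i\<in>{..<n} - {j}. q k (V j x, V i x)) / (\<Sum>i\<in>{..<n} - {j}. \<kappa> (V j x, V i x)) -
      R k (V j x)\<bar> \<partial>M) \<le> e'"
    unfolding R_def using q \<kappa> pos e' \<open>prob_space \<nu>\<close>
    by (intro choice allI plugin_ratio_L1[where C=C]) auto
  then obtain N where N: "\<And>k n (M :: 'a measure) V j. n \<ge> N k \<Longrightarrow> iid_sample M \<nu> V \<Longrightarrow> j < n \<Longrightarrow>
    (\<integral>x. \<bar>(\<Sum>i\<in>{..<n} - {j}. q k (V j x, V i x)) / (\<Sum>i\<in>{..<n} - {j}. \<kappa> (V j x, V i x)) -
      R k (V j x)\<bar> \<partial>M) \<le> e'" by blast
  have "(\<lambda>n. K * inverse (sqrt (real n))) \<longlonglongrightarrow> K * 0"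
    by (intro tendsto_mult tendsto_const tendsto_inverse_0_at_top
        filterlim_compose[OF sqrt_at_top filterlim_real_sequentially])
  then have "eventually (\<lambda>n. K * inverse (sqrt (real n)) < e / 2) sequentially"
    using \<open>e > 0\<close> by (intro order_tendstoD) auto
  then obtain n1 where n1: "\<And>n. n \<ge> n1 \<Longrightarrow> K * inverse (sqrt (real n)) < e / 2"
    by (auto simp: eventually_sequentially)
  show ?thesis
  proof (intro exI[of _ "max (Suc n1) (Max (range N))"] allI impI)
    fix n M V assume n: "max (Suc n1) (Max (range N)) \<le> n" and iid: "iid_sample (M :: 'a measure) \<nu> V"
    interpret iid_sample M \<nu> V by fact
    have n0: "n > 0" "n \<ge> n1" and nN: "n \<ge> N k" for k
      using n Max_ge[of "range N" "N k"] by auto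
    have V: "V i x \<in> space \<nu>" if "x \<in> space M" for i x
      using measurable_space[OF measurable_sample that] .
    define r where "r j k x = (\<Sum>i\<in>{..<n} - {j}. q k (V j x, V i x)) / (\<Sum>i\<in>{..<n} - {j}. \<kappa> (V j x, V i x))" for j k x
    have r_meas [measurable]: "r j k \<in> borel_measurable M" for j k unfolding r_def by measurable
    have r: "r j k x \<in> {0..1}" if "x \<in> space M" for j k x
      unfolding r_def using q V[OF that] by (intro ratio_in_unit sum_nonneg sum_mono) auto
    let ?e = "\<lambda>j k x. \<bar>r j k x - R k (V j x)\<bar>"
    have int_e: "integrable M (?e j k)" for j k
    proof (rule integrable_const_bound[where B=1])
      show "AE x in M. norm (?e j k x) \<le> 1"
        unfolding real_norm_def abs_abs by (intro AE_I2 abs_diff_le_one r R V)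
    qed measurable
    let ?S = "\<lambda>x. \<Sum>j<n. \<phi> (V j x) - T"
    have int_S: "integrable M (\<lambda>x. \<bar>?S x\<bar>)"
    proof (rule Bochner_Integration.integrable_abs, rule Bochner_Integration.integrable_sum)
      show "integrable M (\<lambda>x. \<phi> (V j x) - T)" for j
      proof (rule integrable_const_bound[where B=K])
        show "AE x in M. norm (\<phi> (V j x) - T) \<le> K"
        proof (rule AE_I2)
          fix x assume "x \<in> space M"
          then show "norm (\<phi> (V j x) - T) \<le> K" using \<phi>[OF V, of x j] T by (simp add: abs_le_iff)
        qed
      qed measurable
    qed
    have S: "expectation (\<lambda>x. \<bar>?S x\<bar>) \<le> K * sqrt n"
    proof -
      \<comment> \<open>The law of large numbers is read off from the bound for pairs: the integrand
        ignores its first argument. There \<open>V n\<close> is a dummy, with an index outside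
        \<open>{..<n}\<close> as that bound demands.\<close>
      have "expectation (\<lambda>x. \<bar>\<Sum>i\<in>{..<n}. (\<lambda>(w, w'). \<phi> w' - T) (V n x, V i x)\<bar>) \<le> K * sqrt (card {..<n})"
      proof (rule L1_centered_sum)
        fix w w' assume "w \<in> space \<nu>" "w' \<in> space \<nu>"
        then show "\<bar>(\<lambda>(w, w'). \<phi> w' - T) (w, w')\<bar> \<le> K" using \<phi>[of w'] T by (auto simp: abs_le_iff)
      next
        have "integrable \<nu> \<phi>" using \<phi> by (intro law.integrable_const_bound[where B=K]) auto
        then show "(\<integral>w'. (\<lambda>(w, w'). \<phi> w' - T) (w, w') \<partial>\<nu>) = 0" for w
          by (simp add: T_def law.prob_space)
      qed (use K in auto)
      then show ?thesis by simp
    qed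
    let ?est = "\<lambda>x. 1 / real n * (\<Sum>j<n. \<Sum>k\<in>UNIV. \<bar>r j k x - z (V j x) k\<bar> powr p)"
    have pw: "\<bar>?est x - T\<bar> \<le> 1 / real n * (\<Sum>j<n. \<Sum>k\<in>UNIV. p * ?e j k x) + 1 / real n * \<bar>?S x\<bar>"
      if w: "x \<in> space M" for x
    proof -
      let ?d = "\<Sum>j<n. \<Sum>k\<in>UNIV. \<bar>r j k x - z (V j x) k\<bar> powr p - \<bar>R k (V j x) - z (V j x) k\<bar> powr p"
      have "?est x - T = 1 / real n * ?d + 1 / real n * ?S x"
        using n0 by (simp add: \<phi>_def sum_subtractf field_simps)
      then have "\<bar>?est x - T\<bar> \<le> 1 / real n * \<bar>?d\<bar> + 1 / real n * \<bar>?S x\<bar>"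
        using abs_triangle_ineq[of "1 / real n * ?d" "1 / real n * ?S x"] by (simp add: abs_mult)
      moreover have "\<bar>?d\<bar> \<le> (\<Sum>j<n. \<Sum>k\<in>UNIV. p * ?e j k x)"
      proof (intro order_trans[OF sum_abs] sum_mono)
        fix j k
        have "\<bar>\<bar>r j k x - z (V j x) k\<bar> powr p - \<bar>R k (V j x) - z (V j x) k\<bar> powr p\<bar> \<le>
          p * \<bar>(r j k x - z (V j x) k) - (R k (V j x) - z (V j x) k)\<bar>"
          using r[OF w, of j k] R[OF V[OF w], of k j] z[OF V[OF w], of j k] p
          by (intro abs_powr_lipschitz) auto
        then show "\<bar>\<bar>r j k x - z (V j x) k\<bar> powr p - \<bar>R k (V j x) - z (V j x) k\<bar> powr p\<bar> \<le> p * ?e j k x"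
          by simp
      qed
      then have "1 / real n * \<bar>?d\<bar> \<le> 1 / real n * (\<Sum>j<n. \<Sum>k\<in>UNIV. p * ?e j k x)"
        by (intro mult_left_mono) auto
      ultimately show ?thesis by linarith
    qed
    have "expectation (\<lambda>x. \<bar>?est x - T\<bar>) \<le>
       expectation (\<lambda>x. 1 / real n * (\<Sum>j<n. \<Sum>k\<in>UNIV. p * ?e j k x) + 1 / real n * \<bar>?S x\<bar>)"
    proof (rule integral_mono'[OF _ pw])
      show "0 \<le> 1 / real n * (\<Sum>j<n. \<Sum>k\<in>UNIV. p * ?e j k x) + 1 / real n * \<bar>?S x\<bar>" for x
        using p by (intro add_nonneg_nonneg mult_nonneg_nonneg sum_nonneg) auto
    qed (use int_e int_S in \<open>intro Bochner_Integration.integrable_add integrable_mult_right Bochner_Integration.integrable_sum\<close>)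
    also have "\<dots> = 1 / real n * (\<Sum>j<n. \<Sum>k\<in>UNIV. p * expectation (?e j k)) + 1 / real n * expectation (\<lambda>x. \<bar>?S x\<bar>)"
      using int_e int_S by (subst Bochner_Integration.integral_add)
        (auto intro!: integrable_mult_right Bochner_Integration.integrable_sum simp: Bochner_Integration.integral_sum simp del: times_divide_eq_left)
    also have "\<dots> \<le> 1 / real n * (\<Sum>j<n. \<Sum>k\<in>(UNIV :: 'k set). p * e') + 1 / real n * (K * sqrt n)"
      using S N[OF nN iid] p unfolding r_def
      by (intro add_mono mult_left_mono sum_mono) auto
    also have "1 / real n * (\<Sum>j<n. \<Sum>k\<in>(UNIV :: 'k set). p * e') = e / 2"
      using n0 p K by (simp add: e'_def K_def)
    also have "1 / real n * (K * sqrt n) = K * inverse (sqrt (real n))"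
    proof -
      have "real n = sqrt (real n) * sqrt (real n)" "sqrt (real n) > 0" using n0 by simp_all
      then show ?thesis by (simp add: divide_simps)
    qed
    finally have "expectation (\<lambda>x. \<bar>?est x - T\<bar>) \<le> e" using n1[OF n0(2)] by linarith
    then show "(\<integral>x. \<bar>1 / real n * (\<Sum>j<n. \<Sum>k\<in>UNIV.
        \<bar>(\<Sum>i\<in>{..<n} - {j}. q k (V j x, V i x)) / (\<Sum>i\<in>{..<n} - {j}. \<kappa> (V j x, V i x)) - z (V j x) k\<bar> powr p) -
      (\<integral>w. (\<Sum>k\<in>UNIV. \<bar>(\<integral>w'. q k (w, w') \<partial>\<nu>) / (\<integral>w'. \<kappa> (w, w') \<partial>\<nu>) - z w k\<bar> powr p) \<partial>\<nu>)\<bar> \<partial>M) \<le> e"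
      by (simp only: r_def T_def \<phi>_def R_def)
  qed
qed

section \<open>The Dirichlet distribution on the simplex\<close>

text \<open>The substitution \<open>y = x * y'\<close> brings out \<open>x\<close> from the Jacobian
  and from both powers. The induction on the number of coordinates meets one such integral per
  coordinate.\<close>

lemma nn_integral_Beta_scaled:
  fixes a b x :: real
  assumes a: "a > 0" and b: "b > 0" and x: "x > 0"
  shows "(\<integral>\<^sup>+y. ennreal (indicator {0..x} y * (y powr (a - 1) * (x - y) powr (b - 1))) \<partial>lborel) =
    ennreal (x powr (a + b - 1) * Beta a b)"
proof -
  have "(\<integral>\<^sup>+y. ennreal (indicator {0..x} y * (y powr (a - 1) * (x - y) powr (b - 1))) \<partial>lborel) =
     (\<integral>\<^sup>+y. ennreal x * ennreal (indicator {0..x} (0 + x * y) * ((0 + x * y) powr (a - 1) * (x - (0 + x * y)) powr (b - 1))) \<partial>lborel)"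
    using x by (subst nn_integral_real_affine[where c=x and t=0]) (auto simp: nn_integral_cmult)
  also have "\<dots> = (\<integral>\<^sup>+y. ennreal (x powr (a + b - 1)) *
      ennreal (indicator {0..1} y * (y powr (a - 1) * (1 - y) powr (b - 1))) \<partial>lborel)"
  proof (rule nn_integral_cong)
    fix y :: real
    have "indicator {0..x} (x * y) = (indicator {0..1} y :: real)"
      using x by (auto simp: indicator_def zero_le_mult_iff mult_le_cancel_left1)
    moreover have "x * ((x * y) powr (a - 1) * (x - x * y) powr (b - 1)) =
        x powr (a + b - 1) * (y powr (a - 1) * (1 - y) powr (b - 1))" if "y \<in> {0..1}"
    proof -
      have "x - x * y = x * (1 - y)" by (simp add: algebra_simps)
      then have "x * ((x * y) powr (a - 1) * (x - x * y) powr (b - 1)) =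
        (x * x powr (a - 1) * x powr (b - 1)) * (y powr (a - 1) * (1 - y) powr (b - 1))"
        using that x by (simp add: powr_mult)
      also have "x * x powr (a - 1) * x powr (b - 1) = x powr (a + b - 1)"
        using x by (simp add: powr_add[symmetric] powr_mult_base add_diff_eq)
      finally show ?thesis .
    qed
    ultimately show "ennreal x * ennreal (indicator {0..x} (0 + x * y) * ((0 + x * y) powr (a - 1) * (x - (0 + x * y)) powr (b - 1))) =
       ennreal (x powr (a + b - 1)) * ennreal (indicator {0..1} y * (y powr (a - 1) * (1 - y) powr (b - 1)))"
      using x by (auto simp: ennreal_mult[symmetric] indicator_def)
  qed
  also have "\<dots> = ennreal (x powr (a + b - 1)) *
      (\<integral>\<^sup>+y. ennreal (indicator {0..1} y * (y powr (a - 1) * (1 - y) powr (b - 1))) \<partial>lborel)"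
    by (rule nn_integral_cmult) measurable
  also have "(\<integral>\<^sup>+y. ennreal (indicator {0..1} y * (y powr (a - 1) * (1 - y) powr (b - 1))) \<partial>lborel) =
      ennreal (Beta a b)"
    by (rule nn_integral_has_integral_lebesgue[OF _ has_integral_Beta_real[OF a b]]) auto
  finally show ?thesis using x by (simp add: ennreal_mult')
qed

text \<open>The boundary faces \<open>u i = 0\<close> and \<open>(\<Sum>i\<in>I. u i) = x\<close> are excluded, so that the induction
  never meets the junk value \<open>0 powr 0 = 0\<close>.\<close>

definition dirichlet_density :: "'i set \<Rightarrow> ('i \<Rightarrow> real) \<Rightarrow> real \<Rightarrow> real \<Rightarrow> ('i \<Rightarrow> real) \<Rightarrow> real"
  where "dirichlet_density I a b x u =
    (\<Prod>i\<in>I. indicator {0<..} (u i) * u i powr (a i - 1)) *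
    (indicator {0<..} (x - (\<Sum>i\<in>I. u i)) * (x - (\<Sum>i\<in>I. u i)) powr (b - 1))"

lemma dirichlet_density_measurable [measurable]:
  "finite I \<Longrightarrow> dirichlet_density I a b x \<in> borel_measurable (\<Pi>\<^sub>M i\<in>I. lborel)"
  unfolding dirichlet_density_def by measurable

lemma dirichlet_density_nonneg [simp]: "dirichlet_density I a b x u \<ge> 0"
  unfolding dirichlet_density_def by (intro mult_nonneg_nonneg prod_nonneg ballI) auto

lemma dirichlet_density_insert:
  assumes "finite I" "i \<notin> I"
  shows "dirichlet_density (insert i I) a b x (u(i := y)) =
    indicator {0<..} y * y powr (a i - 1) * dirichlet_density I a b (x - y) u"
proof -
  have "(\<Prod>j\<in>I. indicator {0<..} ((u(i := y)) j) * (u(i := y)) j powr (a j - 1)) =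
      (\<Prod>j\<in>I. indicator {0<..} (u j) * u j powr (a j - 1))"
    by (rule prod.cong) (use assms in auto)
  moreover have "(\<Sum>j\<in>I. (u(i := y)) j) = (\<Sum>j\<in>I. u j)"
    by (rule sum.cong) (use assms in auto)
  ultimately show ?thesis
    unfolding dirichlet_density_def using assms by (simp add: algebra_simps)
qed

lemma dirichlet_density_zero:
  assumes "finite I" "x \<le> 0"
  shows "dirichlet_density I a b x u = 0"
proof (cases "\<forall>i\<in>I. u i > 0")
  case True
  then have "(\<Sum>i\<in>I. u i) \<ge> 0" by (intro sum_nonneg) (auto intro: less_imp_le)
  then show ?thesis using assms by (auto simp: dirichlet_density_def)
next
  case False
  then obtain i where "i \<in> I" "\<not> u i > 0" by auto
  then have "(\<Prod>i\<in>I. indicator {0<..} (u i) * u i powr (a i - 1)) = 0"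
    using assms by (intro prod_zero bexI[of _ i]) (auto simp: indicator_def)
  then show ?thesis by (simp add: dirichlet_density_def)
qed

text \<open>Fixing one coordinate at \<open>y\<close> leaves a density of the same shape with total
  \<open>x - y\<close>, hence an induction with \<open>x\<close> arbitrary. The power of
  \<open>x - y\<close> from the induction hypothesis and the factor of the new coordinate form a
  Beta integral, and the Gamma quotients telescope.\<close>

lemma nn_integral_dirichlet_density:
  fixes a :: "'i \<Rightarrow> real"
  assumes "finite I" and a: "\<And>i. i \<in> I \<Longrightarrow> a i > 0" and b: "b > 0" and x: "x > 0"
  shows "(\<integral>\<^sup>+u. ennreal (dirichlet_density I a b x u) \<partial>(\<Pi>\<^sub>M i\<in>I. lborel)) =
    ennreal (x powr ((\<Sum>i\<in>I. a i) + b - 1) * ((\<Prod>i\<in>I. Gamma (a i)) * Gamma b / Gamma ((\<Sum>i\<in>I. a i) + b)))"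
  using assms
proof (induction I arbitrary: x rule: finite_induct)
  case empty
  interpret product_sigma_finite "\<lambda>i::'i. lborel :: real measure" ..
  have "Gamma b > 0" using empty by (intro Gamma_real_pos)
  then have "Gamma b \<noteq> 0" by linarith
  then show ?case using empty by (simp add: PiM_empty nn_integral_count_space_finite dirichlet_density_def)
next
  case (insert i I)
  interpret product_sigma_finite "\<lambda>i::'i. lborel :: real measure" ..
  define A where "A = (\<Sum>i\<in>I. a i) + b"
  define G where "G = (\<Prod>i\<in>I. Gamma (a i)) * Gamma b / Gamma A"
  have A: "A > 0" using insert.prems insert.hyps unfolding A_def
    by (intro add_nonneg_pos sum_nonneg) (auto intro: less_imp_le)
  have ai: "a i > 0" using insert.prems by auto
  have G: "G \<ge> 0" using insert.prems A
    by (auto simp: G_def intro!: mult_nonneg_nonneg divide_nonneg_nonneg prod_nonneg Gamma_real_nonneg)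
  have IH: "(\<integral>\<^sup>+u. ennreal (dirichlet_density I a b y u) \<partial>(\<Pi>\<^sub>M i\<in>I. lborel)) =
      ennreal (y powr (A - 1) * G)" if "y > 0" for y
    using insert.IH[of y] insert.prems that by (simp add: A_def G_def algebra_simps)
  have "(\<integral>\<^sup>+u. ennreal (dirichlet_density (insert i I) a b x u) \<partial>(\<Pi>\<^sub>M i\<in>insert i I. lborel)) =
     (\<integral>\<^sup>+y. (\<integral>\<^sup>+u. ennreal (dirichlet_density (insert i I) a b x (u(i := y))) \<partial>(\<Pi>\<^sub>M i\<in>I. lborel)) \<partial>lborel)"
    using insert.hyps by (intro product_nn_integral_insert_rev) auto
  also have "\<dots> = (\<integral>\<^sup>+y. ennreal G * ennreal (indicator {0..x} y * (y powr (a i - 1) * (x - y) powr (A - 1))) \<partial>lborel)"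
  proof (rule nn_integral_cong)
    fix y :: real
    have "(\<integral>\<^sup>+u. ennreal (dirichlet_density (insert i I) a b x (u(i := y))) \<partial>(\<Pi>\<^sub>M i\<in>I. lborel)) =
      ennreal (indicator {0<..} y * y powr (a i - 1)) *
        (\<integral>\<^sup>+u. ennreal (dirichlet_density I a b (x - y) u) \<partial>(\<Pi>\<^sub>M i\<in>I. lborel))"
      using insert.hyps
      by (subst nn_integral_cmult[symmetric]) (auto simp: dirichlet_density_insert ennreal_mult)
    \<comment> \<open>The open support of the density and the closed interval differ only at
      \<open>y = 0\<close> and \<open>y = x\<close>, where the right side vanishes as well since
      \<open>0 powr _\<close> is 0.\<close>
    also have "\<dots> = ennreal G * ennreal (indicator {0..x} y * (y powr (a i - 1) * (x - y) powr (A - 1)))"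
    proof (cases "y < x")
      case True
      then have "y = 0 \<or> y < 0 \<or> y \<in> {0<..<x}" by auto
      then show ?thesis
        using IH[of "x - y"] True G by (auto simp: ennreal_mult[symmetric] mult_ac)
    next
      case False
      then show ?thesis
        using dirichlet_density_zero[OF insert.hyps(1), of "x - y"] by (cases "x = y") auto
    qed
    finally show "(\<integral>\<^sup>+u. ennreal (dirichlet_density (insert i I) a b x (u(i := y))) \<partial>(\<Pi>\<^sub>M i\<in>I. lborel)) = \<dots>" .
  qed
  also have "\<dots> = ennreal G * ennreal (x powr (a i + A - 1) * Beta (a i) A)"
    using A ai insert.prems by (subst nn_integral_cmult) (auto simp: nn_integral_Beta_scaled)
  also have "\<dots> = ennreal (x powr (a i + A - 1) * (G * Beta (a i) A))"
    using G by (simp add: ennreal_mult'[symmetric] mult_ac)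
  also have "G * Beta (a i) A = (\<Prod>i\<in>insert i I. Gamma (a i)) * Gamma b / Gamma (a i + A)"
    using insert.hyps Gamma_real_pos[OF A] by (simp add: G_def Beta_def)
  also have "a i + A = (\<Sum>i\<in>insert i I. a i) + b"
    using insert.hyps by (simp add: A_def)
  finally show ?case .
qed

section \<open>The simplex in coordinates and its reference measure\<close>

lemma simplex_chart_nth:
  "simplex_chart c u $ k = (if k = c then 1 - (\<Sum>i\<in>UNIV - {c}. u i) else u k)"
  by (simp add: simplex_chart_def)

lemma sum_simplex_chart: "(\<Sum>k\<in>UNIV. simplex_chart c u $ k) = 1"
proof -
  have "(\<Sum>k\<in>UNIV. simplex_chart c u $ k) = simplex_chart c u $ c + (\<Sum>k\<in>UNIV-{c}. simplex_chart c u $ k)"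
    by (subst sum.remove[of _ c]) auto
  also have "(\<Sum>k\<in>UNIV-{c}. simplex_chart c u $ k) = (\<Sum>k\<in>UNIV-{c}. u k)"
    by (rule sum.cong) (auto simp: simplex_chart_nth)
  finally show ?thesis by (simp add: simplex_chart_nth)
qed

lemma prob_simplex_iff: "s \<in> prob_simplex \<longleftrightarrow> (\<forall>k. 0 \<le> s $ k) \<and> (\<Sum>k\<in>UNIV. s $ k) = 1"
proof -
  have "s $ k \<le> 1" if "\<forall>k. 0 \<le> s $ k" "(\<Sum>k\<in>UNIV. s $ k) = 1" for k
    using member_le_sum[of k UNIV "\<lambda>k. s $ k"] that by auto
  then show ?thesis by (auto simp: prob_simplex_def)
qed

lemma prob_simplexD:
  assumes "s \<in> prob_simplex"
  shows "0 \<le> s $ k" "s $ k \<le> 1" "(\<Sum>k\<in>UNIV. s $ k) = 1"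
  using assms by (auto simp: prob_simplex_def)

lemma compact_prob_simplex: "compact (prob_simplex :: (real ^ 'k) set)"
proof -
  have "(prob_simplex :: (real ^ 'k) set) = cbox 0 1 \<inter> {s. (\<Sum>k\<in>UNIV. s $ k) = 1}"
    by (auto simp: prob_simplex_def mem_box_cart)
  moreover have "closed {s :: real ^ 'k. (\<Sum>k\<in>UNIV. s $ k) = 1}"
    by (intro closed_Collect_eq continuous_intros)
  ultimately show ?thesis by (metis compact_Int_closed compact_cbox)
qed

lemma prob_simplex_borel [measurable]: "prob_simplex \<in> sets borel"
  by (intro borel_closed compact_imp_closed compact_prob_simplex)

lemma space_simplex_lebesgue [simp]: "space (simplex_lebesgue c) = prob_simplex"
  by (simp add: simplex_lebesgue_def space_restrict_space)

lemma sets_simplex_lebesgue: "sets (simplex_lebesgue c) = sets (restrict_space borel prob_simplex)"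
  unfolding simplex_lebesgue_def by (rule sets_restrict_space_cong) simp

lemma measurable_simplex_lebesgue1:
  "f \<in> borel_measurable borel \<Longrightarrow> f \<in> borel_measurable (simplex_lebesgue c)"
  unfolding measurable_cong_sets[OF sets_simplex_lebesgue refl] by (rule measurable_restrict_space1)

lemma simplex_lebesgue_nth [measurable]: "(\<lambda>s. s $ k) \<in> borel_measurable (simplex_lebesgue c)"
  by (rule measurable_simplex_lebesgue1) measurable

lemma nn_integral_simplex_lebesgue:
  assumes "F \<in> borel_measurable (simplex_lebesgue c)"
  shows "(\<integral>\<^sup>+s. F s \<partial>simplex_lebesgue c) =
    (\<integral>\<^sup>+u. F (simplex_chart c u) * indicator prob_simplex (simplex_chart c u) \<partial>(\<Pi>\<^sub>M k\<in>UNIV - {c}. lborel))"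
proof -
  have F: "(\<lambda>s. F s * indicator prob_simplex s) \<in> borel_measurable borel"
    using assms unfolding measurable_cong_sets[OF sets_simplex_lebesgue refl]
    by (subst (asm) borel_measurable_restrict_space_iff_ennreal) auto
  have "(\<integral>\<^sup>+s. F s \<partial>simplex_lebesgue c) =
     (\<integral>\<^sup>+s. F s * indicator prob_simplex s \<partial>distr (\<Pi>\<^sub>M k\<in>UNIV - {c}. lborel) borel (simplex_chart c))"
    unfolding simplex_lebesgue_def by (rule nn_integral_restrict_space) auto
  also have "\<dots> = (\<integral>\<^sup>+u. F (simplex_chart c u) * indicator prob_simplex (simplex_chart c u) \<partial>(\<Pi>\<^sub>M k\<in>UNIV - {c}. lborel))"
    using F simplex_chart_measurable by (intro nn_integral_distr) auto
  finally show ?thesis .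
qed

lemma emeasure_simplex_lebesgue:
  assumes "A \<in> sets borel" "A \<subseteq> prob_simplex"
  shows "emeasure (simplex_lebesgue c) A =
    emeasure (\<Pi>\<^sub>M k\<in>UNIV - {c}. lborel) (simplex_chart c -` A \<inter> space (\<Pi>\<^sub>M k\<in>UNIV - {c}. lborel))"
  unfolding simplex_lebesgue_def using assms
  by (subst emeasure_restrict_space) (auto simp: emeasure_distr[OF simplex_chart_measurable])

text \<open>In the chart the simplex is contained in the unit cube, whose volume is 1.\<close>

lemma finite_measure_simplex_lebesgue: "finite_measure (simplex_lebesgue (c :: 'k :: finite))"
proof
  interpret product_sigma_finite "\<lambda>i::'k. lborel :: real measure" ..
  have "emeasure (simplex_lebesgue c) prob_simplex \<le>
    emeasure (\<Pi>\<^sub>M k\<in>UNIV - {c}. lborel) (Pi\<^sub>E (UNIV - {c}) (\<lambda>_. {0..1::real}))"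
  proof (subst emeasure_simplex_lebesgue[OF prob_simplex_borel subset_refl], rule emeasure_mono)
    show "simplex_chart c -` prob_simplex \<inter> space (\<Pi>\<^sub>M k\<in>UNIV - {c}. lborel) \<subseteq> Pi\<^sub>E (UNIV - {c}) (\<lambda>_. {0..1})"
    proof
      fix u assume u: "u \<in> simplex_chart c -` prob_simplex \<inter> space (\<Pi>\<^sub>M k\<in>UNIV - {c}. lborel)"
      then have "simplex_chart c u $ k \<in> {0..1}" for k by (auto simp: prob_simplex_def)
      then have "u k \<in> {0..1}" if "k \<noteq> c" for k
        using that by (metis simplex_chart_nth)
      with u show "u \<in> Pi\<^sub>E (UNIV - {c}) (\<lambda>_. {0..1})"
        by (auto simp: space_PiM PiE_def)
    qed
  qed (intro sets_PiM_I_finite; simp)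
  also have "\<dots> = 1" by (subst emeasure_PiM) auto
  finally show "emeasure (simplex_lebesgue c) (space (simplex_lebesgue c)) \<noteq> \<infinity>"
    by (auto simp: top_unique)
qed

text \<open>The exceptional set is the graph of a function of the other coordinates. Once these are
  frozen, a single value of coordinate \<open>i\<close> remains, a null set of the line.\<close>

lemma AE_PiM_lborel_avoid:
  fixes b :: "('i \<Rightarrow> real) \<Rightarrow> real"
  assumes "finite I" "i \<in> I"
    and b [measurable]: "b \<in> borel_measurable (\<Pi>\<^sub>M i\<in>I. lborel)"
    and indep_of_i: "\<And>u y. b (u(i := y)) = b u"
  shows "AE u in (\<Pi>\<^sub>M i\<in>I. lborel). u i \<noteq> b u"
proof -
  interpret product_sigma_finite "\<lambda>i::'i. lborel :: real measure" ..
  have I: "insert i (I - {i}) = I" using assms by auto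
  have m: "{u \<in> space (\<Pi>\<^sub>M i\<in>I. lborel). u i = b u} \<in> sets (\<Pi>\<^sub>M i\<in>I. lborel)"
    using assms by measurable
  have "emeasure (\<Pi>\<^sub>M i\<in>I. lborel) {u \<in> space (\<Pi>\<^sub>M i\<in>I. lborel). u i = b u} =
      (\<integral>\<^sup>+u. indicator {u \<in> space (\<Pi>\<^sub>M i\<in>I. lborel). u i = b u} u \<partial>(\<Pi>\<^sub>M i\<in>I. lborel))"
    using m by simp
  also have "\<dots> = (\<integral>\<^sup>+u. indicator {u \<in> space (\<Pi>\<^sub>M i\<in>I. lborel). u i = b u} u \<partial>(\<Pi>\<^sub>M i\<in>insert i (I - {i}). lborel))"
    by (simp only: I)
  also have "\<dots> = (\<integral>\<^sup>+u. (\<integral>\<^sup>+y. indicator {u \<in> space (\<Pi>\<^sub>M i\<in>I. lborel). u i = b u} (u(i := y)) \<partial>lborel) \<partial>(\<Pi>\<^sub>M i\<in>I - {i}. lborel))"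
    using assms(1) m by (intro product_nn_integral_insert) (simp_all only: I borel_measurable_indicator finite_Diff Diff_iff singleton_iff simp_thms)
  also have "\<dots> \<le> (\<integral>\<^sup>+u. (\<integral>\<^sup>+y. indicator {b u} y \<partial>lborel) \<partial>(\<Pi>\<^sub>M i\<in>I - {i}. lborel))"
    by (intro nn_integral_mono) (auto simp: indicator_def indep_of_i)
  also have "\<dots> = 0" by simp
  finally have "emeasure (\<Pi>\<^sub>M i\<in>I. lborel) {u \<in> space (\<Pi>\<^sub>M i\<in>I. lborel). u i = b u} = 0" by simp
  then show ?thesis using m by (intro AE_I[where N="{u \<in> space (\<Pi>\<^sub>M i\<in>I. lborel). u i = b u}"]) auto
qed

text \<open>It allows the kernel and the Dirichlet density to be exchanged under the integral. The
  face of the dependent coordinate \<open>c\<close> is a graph over any other coordinate; if there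
  is no other one, coordinate \<open>c\<close> is constantly 1.\<close>

lemma AE_simplex_lebesgue_pos: "AE s in simplex_lebesgue (c :: 'k :: finite). \<forall>k. s $ k > 0"
proof -
  let ?P = "\<Pi>\<^sub>M k\<in>UNIV - {c}. (lborel :: real measure)"
  have ne: "AE u in ?P. simplex_chart c u $ k \<noteq> 0" for k
  proof (cases "k = c")
    case False
    then show ?thesis using AE_PiM_lborel_avoid[of "UNIV - {c}" k "\<lambda>_. 0"] by (simp add: simplex_chart_nth)
  next
    case True
    show ?thesis
    proof (cases "UNIV - {c} = {}")
      case True
      then have "simplex_chart c u $ k = 1" for u using \<open>k = c\<close> by (simp only: simplex_chart_nth) simp
      then show ?thesis by simp
    next
      case False
      then obtain i where i: "i \<in> UNIV - {c}" by auto
      have "AE u in ?P. u i \<noteq> 1 - (\<Sum>j\<in>UNIV - {c} - {i}. u j)"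
        using i by (intro AE_PiM_lborel_avoid) (auto intro!: sum.cong)
      then show ?thesis
      proof (rule AE_mp, intro AE_I2 impI)
        fix u :: "'k \<Rightarrow> real"
        assume "u i \<noteq> 1 - (\<Sum>j\<in>UNIV - {c} - {i}. u j)"
        then show "simplex_chart c u $ k \<noteq> 0"
          using \<open>k = c\<close> sum.remove[of "UNIV - {c}" i u] i by (simp add: simplex_chart_nth)
      qed
    qed
  qed
  have "AE u in ?P. \<forall>k. simplex_chart c u $ k \<noteq> 0"
    using ne by (simp add: AE_all_countable)
  then have "AE u in ?P. simplex_chart c u \<in> prob_simplex \<longrightarrow> (\<forall>k. simplex_chart c u $ k > 0)"
    by eventually_elim (auto simp: prob_simplex_iff less_le)
  moreover have "{s \<in> space borel. s \<in> prob_simplex \<longrightarrow> (\<forall>k. s $ k > 0)} \<in> sets (borel :: (real ^ 'k) measure)"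
    by measurable
  ultimately have "AE s in distr ?P borel (simplex_chart c). s \<in> prob_simplex \<longrightarrow> (\<forall>k. s $ k > 0)"
    using simplex_chart_measurable by (subst AE_distr_iff) auto
  then show ?thesis unfolding simplex_lebesgue_def by (subst AE_restrict_space_iff) auto
qed

text \<open>The parameters are free because multiplication by a coordinate shifts them. The powers
  are taken as they are, with \<open>0 powr 0 = 0\<close>, so the comparison with the kernel is made
  where all coordinates are positive.\<close>

definition dirichlet_pdf :: "('k \<Rightarrow> real) \<Rightarrow> real ^ 'k \<Rightarrow> real"
  where "dirichlet_pdf a s =
    Gamma (\<Sum>k\<in>UNIV. a k) / (\<Prod>k\<in>UNIV. Gamma (a k)) * (\<Prod>k\<in>UNIV. (s $ k) powr (a k - 1))"

text \<open>On the faces both sides are 0, the left one because \<open>0 powr _\<close> is 0;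
  outside the simplex some indicator vanishes on either side. So the identity holds at every point
  and not just almost everywhere.\<close>

lemma simplex_chart_dirichlet_density:
  "indicator prob_simplex (simplex_chart c u) * (\<Prod>k\<in>UNIV. (simplex_chart c u $ k) powr (a k - 1)) =
    dirichlet_density (UNIV - {c}) a (a c) 1 u"
proof -
  let ?s = "simplex_chart c u"
  have "dirichlet_density (UNIV - {c}) a (a c) 1 u =
      (\<Prod>k\<in>UNIV. indicator {0<..} (?s $ k) * (?s $ k) powr (a k - 1))"
  proof -
    have "(\<Prod>k\<in>UNIV. indicator {0<..} (?s $ k) * (?s $ k) powr (a k - 1)) =
       (indicator {0<..} (?s $ c) * (?s $ c) powr (a c - 1)) *
       (\<Prod>k\<in>UNIV-{c}. indicator {0<..} (?s $ k) * (?s $ k) powr (a k - 1))"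
      by (subst prod.remove[of _ c]) auto
    also have "(\<Prod>k\<in>UNIV-{c}. indicator {0<..} (?s $ k) * (?s $ k) powr (a k - 1)) =
        (\<Prod>k\<in>UNIV-{c}. indicator {0<..} (u k) * (u k) powr (a k - 1))"
      by (rule prod.cong) (auto simp: simplex_chart_nth)
    finally show ?thesis by (simp add: dirichlet_density_def simplex_chart_nth mult_ac)
  qed
  also have "\<dots> = (\<Prod>k\<in>UNIV. indicator {0<..} (?s $ k)) * (\<Prod>k\<in>UNIV. (?s $ k) powr (a k - 1))"
    by (rule prod.distrib)
  also have "\<dots> = indicator prob_simplex ?s * (\<Prod>k\<in>UNIV. (?s $ k) powr (a k - 1))"
  proof (cases "\<forall>k. ?s $ k > 0")
    case True
    then have "?s \<in> prob_simplex" by (auto simp: prob_simplex_iff sum_simplex_chart less_imp_le)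
    then show ?thesis using True by simp
  next
    case False
    then obtain k where k: "\<not> ?s $ k > 0" by auto
    have "(\<Prod>k\<in>UNIV. indicator {0<..} (?s $ k) :: real) = 0"
      using k by (intro prod_zero bexI[of _ k]) (auto simp: indicator_def)
    moreover have "(\<Prod>k\<in>UNIV. (?s $ k) powr (a k - 1)) = 0" if "?s \<in> prob_simplex"
      using prob_simplexD(1)[OF that, of k] k by (intro prod_zero bexI[of _ k]) auto
    ultimately show ?thesis by (auto simp: indicator_def)
  qed
  finally show ?thesis ..
qed

lemma Gamma_sum_pos:
  fixes a :: "'k :: finite \<Rightarrow> real"
  assumes "\<And>k. a k > 0"
  shows "(\<Sum>k\<in>UNIV. a k) > 0" "Gamma (\<Sum>k\<in>UNIV. a k) > 0" "(\<Prod>k\<in>UNIV. Gamma (a k)) > 0"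
  using assms by (auto intro!: Gamma_real_pos sum_pos prod_pos)

lemma dirichlet_pdf_measurable [measurable]:
  "dirichlet_pdf a \<in> borel_measurable (simplex_lebesgue c)"
  unfolding dirichlet_pdf_def by measurable

lemma dirichlet_pdf_nonneg:
  assumes "\<And>k. a k > 0"
  shows "dirichlet_pdf a s \<ge> 0"
  unfolding dirichlet_pdf_def using Gamma_sum_pos[of a, OF assms]
  by (intro mult_nonneg_nonneg divide_nonneg_pos less_imp_le[of 0 "Gamma _"]) (auto intro: prod_nonneg)

lemma nn_integral_dirichlet_pdf:
  fixes c :: "'k :: finite"
  assumes a: "\<And>k. a k > 0"
  shows "(\<integral>\<^sup>+s. ennreal (dirichlet_pdf a s) \<partial>simplex_lebesgue c) = 1"
proof -
  let ?P = "\<Pi>\<^sub>M k\<in>UNIV - {c}. (lborel :: real measure)"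
  define Z where "Z = Gamma (\<Sum>k\<in>UNIV. a k) / (\<Prod>k\<in>UNIV. Gamma (a k))"
  have Z: "Z > 0" using Gamma_sum_pos[of a, OF a] by (simp add: Z_def)
  have "(\<integral>\<^sup>+s. ennreal (dirichlet_pdf a s) \<partial>simplex_lebesgue c) =
      (\<integral>\<^sup>+u. ennreal (dirichlet_pdf a (simplex_chart c u)) * indicator prob_simplex (simplex_chart c u) \<partial>?P)"
    by (rule nn_integral_simplex_lebesgue) measurable
  also have "\<dots> = (\<integral>\<^sup>+u. ennreal Z * ennreal (dirichlet_density (UNIV - {c}) a (a c) 1 u) \<partial>?P)"
    using Z by (intro nn_integral_cong)
      (simp add: simplex_chart_dirichlet_density[symmetric] dirichlet_pdf_def Z_def[symmetric]
        ennreal_mult' ennreal_indicator mult_ac)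
  also have "\<dots> = ennreal Z * ennreal (1 powr ((\<Sum>i\<in>UNIV-{c}. a i) + a c - 1) *
      ((\<Prod>i\<in>UNIV-{c}. Gamma (a i)) * Gamma (a c) / Gamma ((\<Sum>i\<in>UNIV-{c}. a i) + a c)))"
    using a by (subst nn_integral_cmult) (auto simp: nn_integral_dirichlet_density)
  also have "(\<Sum>i\<in>UNIV-{c}. a i) + a c = (\<Sum>k\<in>UNIV. a k)"
    by (subst (2) sum.remove[of _ c]) auto
  also have "(\<Prod>i\<in>UNIV-{c}. Gamma (a i)) * Gamma (a c) = (\<Prod>k\<in>UNIV. Gamma (a k))"
    by (subst (2) prod.remove[of _ c]) (auto simp: mult_ac)
  also have "ennreal Z * ennreal (1 powr ((\<Sum>k\<in>UNIV. a k) - 1) * ((\<Prod>k\<in>UNIV. Gamma (a k)) / Gamma (\<Sum>k\<in>UNIV. a k))) = 1"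
  proof -
    have "G / P * (1 * (P / G)) = 1" if "G > 0" "P > 0" for G P :: real
      using that by simp
    from this[OF Gamma_sum_pos(2,3)[of a, OF a]]
    have "Z * (1 powr ((\<Sum>k\<in>UNIV. a k) - 1) * ((\<Prod>k\<in>UNIV. Gamma (a k)) / Gamma (\<Sum>k\<in>UNIV. a k))) = 1"
      by (simp only: Z_def powr_one_eq_one)
    then show ?thesis
      using Z by (metis ennreal_mult' ennreal_1 less_imp_le)
  qed
  finally show ?thesis .
qed

lemma dirichlet_pdf_integral:
  fixes c :: "'k :: finite"
  assumes a: "\<And>k. a k > 0"
  shows "integrable (simplex_lebesgue c) (dirichlet_pdf a)"
    and "(\<integral>s. dirichlet_pdf a s \<partial>simplex_lebesgue c) = 1"
proof -
  show int: "integrable (simplex_lebesgue c) (dirichlet_pdf a)"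
    using nn_integral_dirichlet_pdf[of a c, OF a] dirichlet_pdf_nonneg[of a, OF a]
    by (intro integrableI_nonneg) auto
  show "(\<integral>s. dirichlet_pdf a s \<partial>simplex_lebesgue c) = 1"
    using nn_integral_dirichlet_pdf[of a c, OF a] dirichlet_pdf_nonneg[of a, OF a]
    by (subst integral_eq_nn_integral) auto
qed

section \<open>Moments of the Dirichlet distribution\<close>

lemma sum_increment:
  fixes a :: "'k :: finite \<Rightarrow> real"
  shows "(\<Sum>k\<in>UNIV. (a(j := a j + 1)) k) = (\<Sum>k\<in>UNIV. a k) + 1"
proof -
  have "(\<Sum>k\<in>UNIV. (a(j := a j + 1)) k) = (\<Sum>k\<in>UNIV. a k + (if k = j then 1 else 0))"
    by (rule sum.cong) auto
  then show ?thesis by (simp add: sum.distrib)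
qed

text \<open>The functional equation of Gamma, applied to the parameter \<open>a j\<close> and to the
  total, produces the quotient. A coordinate factor is thereby traded for a raised
  parameter.\<close>

lemma dirichlet_pdf_mult_nth:
  assumes a: "\<And>k. a k > 0" and s: "s \<in> prob_simplex"
  shows "dirichlet_pdf a s * s $ j =
    a j / (\<Sum>k\<in>UNIV. a k) * dirichlet_pdf (a(j := a j + 1)) s"
proof -
  let ?a = "a(j := a j + 1)"
  have G: "(\<Prod>k\<in>UNIV. Gamma (?a k)) = a j * (\<Prod>k\<in>UNIV. Gamma (a k))"
  proof -
    have "(\<Prod>k\<in>UNIV. Gamma (?a k)) = Gamma (?a j) * (\<Prod>k\<in>UNIV-{j}. Gamma (?a k))"
      by (rule prod.remove) auto
    also have "(\<Prod>k\<in>UNIV-{j}. Gamma (?a k)) = (\<Prod>k\<in>UNIV-{j}. Gamma (a k))"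
      by (rule prod.cong) auto
    also have "Gamma (?a j) = a j * Gamma (a j)"
      using a[of j] by (simp add: Gamma_plus1 nonpos_Ints_def)
    finally show ?thesis by (subst prod.remove[of _ j "\<lambda>k. Gamma (a k)"]) auto
  qed
  have P: "(\<Prod>k\<in>UNIV. (s $ k) powr (?a k - 1)) = s $ j * (\<Prod>k\<in>UNIV. (s $ k) powr (a k - 1))"
  proof -
    have "(\<Prod>k\<in>UNIV. (s $ k) powr (?a k - 1)) = (s $ j) powr (?a j - 1) * (\<Prod>k\<in>UNIV-{j}. (s $ k) powr (?a k - 1))"
      by (rule prod.remove) auto
    also have "(\<Prod>k\<in>UNIV-{j}. (s $ k) powr (?a k - 1)) = (\<Prod>k\<in>UNIV-{j}. (s $ k) powr (a k - 1))"
      by (rule prod.cong) auto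
    also have "(s $ j) powr (?a j - 1) = s $ j * (s $ j) powr (a j - 1)"
      using prob_simplexD(1)[OF s, of j] by (simp add: powr_mult_base)
    finally show ?thesis by (subst prod.remove[of _ j "\<lambda>k. (s $ k) powr (a k - 1)"]) auto
  qed
  have "Gamma ((\<Sum>k\<in>UNIV. a k) + 1) = (\<Sum>k\<in>UNIV. a k) * Gamma (\<Sum>k\<in>UNIV. a k)"
    using Gamma_sum_pos(1)[of a, OF a] by (intro Gamma_plus1) (auto simp: nonpos_Ints_def)
  then show ?thesis
    using Gamma_sum_pos[of a, OF a] a[of j] unfolding dirichlet_pdf_def sum_increment G P
    by (simp add: field_simps)
qed

text \<open>After each trade by \<open>dirichlet_pdf_mult_nth\<close> the remaining density
  integrates to 1, so no new integral has to be computed. The square takes two trades, the second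
  with total \<open>A + 1\<close>.\<close>

lemma dirichlet_pdf_moments:
  fixes c :: "'k :: finite"
  assumes a: "\<And>k. a k > 0"
  defines "A \<equiv> \<Sum>k\<in>UNIV. a k"
  shows "integrable (simplex_lebesgue c) (\<lambda>s. dirichlet_pdf a s * s $ j)"
    and "(\<integral>s. dirichlet_pdf a s * s $ j \<partial>simplex_lebesgue c) = a j / A"
    and "integrable (simplex_lebesgue c) (\<lambda>s. dirichlet_pdf a s * (s $ j)\<^sup>2)"
    and "(\<integral>s. dirichlet_pdf a s * (s $ j)\<^sup>2 \<partial>simplex_lebesgue c) = a j * (a j + 1) / (A * (A + 1))"
proof -
  have 1: "integrable (simplex_lebesgue c) (\<lambda>s. dirichlet_pdf b s * s $ j)"
    "(\<integral>s. dirichlet_pdf b s * s $ j \<partial>simplex_lebesgue c) = b j / (\<Sum>k\<in>UNIV. b k)"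
    if b: "\<And>k. b k > 0" for b
  proof -
    have b': "(b(j := b j + 1)) k > 0" for k using b[of k] by auto
    have eq: "dirichlet_pdf b s * s $ j = b j / (\<Sum>k\<in>UNIV. b k) * dirichlet_pdf (b(j := b j + 1)) s"
      if "s \<in> space (simplex_lebesgue c)" for s
      using dirichlet_pdf_mult_nth[of b s j, OF b] that by simp
    note I = dirichlet_pdf_integral[of "b(j := b j + 1)" c, OF b']
    show "integrable (simplex_lebesgue c) (\<lambda>s. dirichlet_pdf b s * s $ j)"
      by (subst Bochner_Integration.integrable_cong[OF refl eq]) (auto intro: I integrable_mult_right simp del: times_divide_eq_left)
    show "(\<integral>s. dirichlet_pdf b s * s $ j \<partial>simplex_lebesgue c) = b j / (\<Sum>k\<in>UNIV. b k)"
      by (subst Bochner_Integration.integral_cong[OF refl eq]) (auto simp: I)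
  qed
  show "integrable (simplex_lebesgue c) (\<lambda>s. dirichlet_pdf a s * s $ j)"
    "(\<integral>s. dirichlet_pdf a s * s $ j \<partial>simplex_lebesgue c) = a j / A"
    using 1[of a, OF a] by (auto simp: A_def)
  have a': "(a(j := a j + 1)) k > 0" for k using a[of k] by auto
  have sum: "(\<Sum>k\<in>UNIV. (a(j := a j + 1)) k) = A + 1" unfolding A_def by (rule sum_increment)
  have eq: "dirichlet_pdf a s * (s $ j)\<^sup>2 = a j / A * (dirichlet_pdf (a(j := a j + 1)) s * s $ j)"
    if "s \<in> space (simplex_lebesgue c)" for s
    using dirichlet_pdf_mult_nth[of a s j, OF a] that
    by (simp add: A_def power2_eq_square mult.assoc[symmetric])
  note I = 1[of "a(j := a j + 1)", OF a']
  show "integrable (simplex_lebesgue c) (\<lambda>s. dirichlet_pdf a s * (s $ j)\<^sup>2)"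
    by (subst Bochner_Integration.integrable_cong[OF refl eq]) (auto intro: I integrable_mult_right simp del: times_divide_eq_left)
  show "(\<integral>s. dirichlet_pdf a s * (s $ j)\<^sup>2 \<partial>simplex_lebesgue c) = a j * (a j + 1) / (A * (A + 1))"
    by (subst Bochner_Integration.integral_cong[OF refl eq]) (auto simp: I sum sum[simplified])
qed

definition dirichlet_param :: "real \<Rightarrow> real ^ 'k \<Rightarrow> 'k \<Rightarrow> real"
  where "dirichlet_param h t k = t $ k / h + 1"

lemma dirichlet_param_pos: "h > 0 \<Longrightarrow> t \<in> prob_simplex \<Longrightarrow> dirichlet_param h t k > 0"
  by (auto simp: dirichlet_param_def prob_simplexD intro!: add_nonneg_pos)

lemma sum_dirichlet_param:
  fixes t :: "real ^ 'k"
  shows "t \<in> prob_simplex \<Longrightarrow> (\<Sum>k\<in>UNIV. dirichlet_param h t k) = 1 / h + CARD('k)"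
  by (simp add: dirichlet_param_def sum.distrib prob_simplexD sum_divide_distrib[symmetric])

lemma dirichlet_kernel_eq_pdf:
  assumes "\<And>k. s $ k > 0"
  shows "dirichlet_kernel h s t = dirichlet_pdf (dirichlet_param h t) s"
proof -
  have "s $ k \<noteq> 0" for k using assms[of k] by simp
  then show ?thesis unfolding dirichlet_kernel_def dirichlet_pdf_def dirichlet_param_def Let_def
    by (intro arg_cong2[where f="(*)"] refl prod.cong) simp_all
qed

lemma AE_dirichlet_kernel_eq_pdf:
  "AE s in simplex_lebesgue (c :: 'k :: finite). dirichlet_kernel h s t = dirichlet_pdf (dirichlet_param h t) s"
  using AE_simplex_lebesgue_pos by eventually_elim (auto intro: dirichlet_kernel_eq_pdf)

lemma dirichlet_kernel_nonneg:
  assumes "h > 0" "t \<in> prob_simplex"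
  shows "dirichlet_kernel h s t \<ge> 0"
  unfolding dirichlet_kernel_def Let_def
  using Gamma_sum_pos[of "dirichlet_param h t", OF dirichlet_param_pos[OF assms]]
  by (intro mult_nonneg_nonneg divide_nonneg_pos less_imp_le[of 0 "Gamma _"])
     (auto simp: dirichlet_param_def intro: prod_nonneg)

lemma dirichlet_kernel_pos:
  assumes "h > 0" "t \<in> prob_simplex" "\<And>k. s $ k > 0"
  shows "dirichlet_kernel h s t > 0"
proof -
  have "s $ k \<noteq> 0" for k using assms(3)[of k] by simp
  then show ?thesis
    using Gamma_sum_pos[of "dirichlet_param h t"] dirichlet_param_pos[OF assms(1,2)]
    unfolding dirichlet_kernel_eq_pdf[OF assms(3)] dirichlet_pdf_def
    by (intro mult_pos_pos prod_pos divide_pos_pos) auto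
qed

section \<open>The Dirichlet kernel\<close>

text \<open>\<open>Gamma\<close> is continuous only away from its poles. Taking the maximum of its
  arguments with 1 changes nothing for \<open>t\<close> in the simplex and yields a continuous
  function; the Gamma value of the total parameter is a constant there.\<close>

lemma dirichlet_kernel_measurable_pair:
  fixes c :: "'k :: finite"
  assumes "h > 0"
  shows "(\<lambda>(s, t). dirichlet_kernel h s t) \<in> borel_measurable (simplex_lebesgue c \<Otimes>\<^sub>M simplex_lebesgue c)"
proof -
  have G: "(\<lambda>x. Gamma (max 1 x)) \<in> borel_measurable (borel :: real measure)"
    by (intro borel_measurable_continuous_onI continuous_on_compose2[OF continuous_on_Gamma[of "{1..}"]] continuous_intros)
       (auto simp: nonpos_Ints_def)
  let ?F = "\<lambda>(s :: real ^ 'k, t :: real ^ 'k). Gamma (1 / h + CARD('k)) / (\<Prod>k\<in>UNIV. Gamma (max 1 (t $ k / h + 1))) *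
        (\<Prod>k\<in>UNIV. if t $ k / h + 1 = 1 then 1 else (s $ k) powr (t $ k / h + 1 - 1))"
  have meas: "?F \<in> borel_measurable (simplex_lebesgue c \<Otimes>\<^sub>M simplex_lebesgue c)"
    using G by measurable
  have eq: "dirichlet_kernel h s t = ?F (s, t)" if "t \<in> prob_simplex" for s t :: "real ^ 'k"
  proof -
    have "max 1 (t $ k / h + 1) = t $ k / h + 1" for k
      using that assms by (simp add: max_def prob_simplexD)
    then show ?thesis using sum_dirichlet_param[OF that, of h]
      by (simp add: dirichlet_kernel_def Let_def dirichlet_param_def)
  qed
  have "(\<lambda>(s, t). dirichlet_kernel h s t) \<in> borel_measurable (simplex_lebesgue c \<Otimes>\<^sub>M simplex_lebesgue c) \<longleftrightarrow>
      ?F \<in> borel_measurable (simplex_lebesgue c \<Otimes>\<^sub>M simplex_lebesgue c)"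
    by (rule measurable_cong) (clarsimp simp only: space_pair_measure space_simplex_lebesgue eq split: prod.split)
  then show ?thesis using meas by (rule iffD2)
qed

text \<open>The powers are at most 1, and the Gamma values in the denominator stay above the minimum
  of \<open>Gamma\<close> on a compact interval. The bound depends on \<open>h\<close> and supplies
  boundedness at fixed \<open>h\<close>; the limit \<open>h \<rightarrow> 0\<close> never relies on
  it.\<close>

lemma dirichlet_kernel_bounded:
  assumes h: "h > 0"
  obtains B where "B > 0" "\<And>(s :: real ^ 'k) t. s \<in> prob_simplex \<Longrightarrow> t \<in> prob_simplex \<Longrightarrow> dirichlet_kernel h s t \<le> B"
proof -
  have "\<exists>x\<in>{1..1/h+1}. \<forall>y\<in>{1..1/h+1}. Gamma x \<le> (Gamma y :: real)"
    using h by (intro continuous_attains_inf continuous_on_Gamma) (auto simp: nonpos_Ints_def)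
  then obtain x where x: "x \<ge> 1" "\<And>y. y \<in> {1..1/h+1} \<Longrightarrow> Gamma x \<le> (Gamma y :: real)" by auto
  define m where "m = Gamma x"
  have m: "m > 0" unfolding m_def using x by (intro Gamma_real_pos) auto
  define B where "B = Gamma (1 / h + CARD('k)) / m ^ CARD('k)"
  have GK: "Gamma (1 / h + CARD('k)) > 0" using h by (intro Gamma_real_pos add_pos_nonneg) auto
  show ?thesis
  proof (rule that)
    show "B > 0" using m GK by (simp add: B_def)
    fix s t :: "real ^ 'k" assume s: "s \<in> prob_simplex" and t: "t \<in> prob_simplex"
    have "m ^ CARD('k) = (\<Prod>k\<in>(UNIV :: 'k set). m)" by simp
    also have "\<dots> \<le> (\<Prod>k\<in>UNIV. Gamma (t $ k / h + 1))"
      using m x h prob_simplexD[OF t] by (intro prod_mono) (auto simp: m_def divide_right_mono)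
    finally have 1: "Gamma (1 / h + CARD('k)) / (\<Prod>k\<in>UNIV. Gamma (t $ k / h + 1)) \<le> B"
      unfolding B_def using m GK by (intro divide_left_mono mult_pos_pos) (auto intro: less_le_trans[rotated])
    have 2: "(\<Prod>k\<in>UNIV. if t $ k / h + 1 = 1 then 1 else (s $ k) powr (t $ k / h + 1 - 1)) \<le> 1"
      using prob_simplexD[OF s] prob_simplexD[OF t] h by (intro prod_le_1) (auto intro!: powr_le1)
    have "dirichlet_kernel h s t =
      Gamma (1 / h + CARD('k)) / (\<Prod>k\<in>UNIV. Gamma (t $ k / h + 1)) *
        (\<Prod>k\<in>UNIV. if t $ k / h + 1 = 1 then 1 else (s $ k) powr (t $ k / h + 1 - 1))"
      using t sum_dirichlet_param[of t h] by (simp add: dirichlet_kernel_def Let_def dirichlet_param_def)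
    also have "\<dots> \<le> B * 1"
      using 1 2 \<open>B > 0\<close> by (intro mult_mono) (auto intro!: prod_nonneg)
    finally show "dirichlet_kernel h s t \<le> B" by simp
  qed
qed

lemma dirichlet_kernel_measurable1 [measurable]:
  "(\<lambda>s. dirichlet_kernel h s t) \<in> borel_measurable (simplex_lebesgue c)"
  unfolding dirichlet_kernel_def Let_def by measurable

lemma dirichlet_kernel_integral:
  fixes c :: "'k :: finite"
  assumes "h > 0" "t \<in> prob_simplex"
  shows "integrable (simplex_lebesgue c) (\<lambda>s. dirichlet_kernel h s t)"
    and "(\<integral>s. dirichlet_kernel h s t \<partial>simplex_lebesgue c) = 1"
proof -
  note I = dirichlet_pdf_integral[of "dirichlet_param h t" c, OF dirichlet_param_pos[OF assms]]
  show "integrable (simplex_lebesgue c) (\<lambda>s. dirichlet_kernel h s t)"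
    using I(1) by (subst integrable_cong_AE[OF _ _ AE_dirichlet_kernel_eq_pdf]) auto
  show "(\<integral>s. dirichlet_kernel h s t \<partial>simplex_lebesgue c) = 1"
    using I(2) by (subst integral_cong_AE[OF _ _ AE_dirichlet_kernel_eq_pdf]) auto
qed

text \<open>The square is centered at \<open>t\<close> and not at the mean of the Dirichlet law, so
  it collects variance and squared bias. With \<open>N = 1 / h\<close>, the terms of order
  \<open>N\<^sup>2\<close> cancel in the numerator, while the denominator \<open>A * (A + 1)\<close>
  is of that order; this leaves a bound linear in \<open>h\<close>.\<close>

lemma dirichlet_kernel_mean_square:
  fixes c j :: "'k :: finite" and h :: real
  assumes h: "h > 0" "h \<le> 1" and t: "t \<in> prob_simplex"
  shows "integrable (simplex_lebesgue c) (\<lambda>s. dirichlet_kernel h s t * (s $ j - t $ j)\<^sup>2)"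
    and "(\<integral>s. dirichlet_kernel h s t * (s $ j - t $ j)\<^sup>2 \<partial>simplex_lebesgue c) \<le> (CARD('k) + 1) * h"
proof -
  let ?a = "dirichlet_param h t" and ?\<tau> = "t $ j"
  define N K where "N = 1 / h" and "K = real CARD('k)"
  define A where "A = (\<Sum>k\<in>UNIV. ?a k)"
  note pos = dirichlet_param_pos[OF h(1) t]
  note M = dirichlet_pdf_moments[where a="?a" and c=c and j=j, OF pos, folded A_def]
  note I = dirichlet_pdf_integral[of ?a c, OF pos]
  have A: "A = N + K" using sum_dirichlet_param[OF t, of h] by (simp add: A_def N_def K_def)
  have aj: "?a j = N * ?\<tau> + 1" by (simp add: dirichlet_param_def N_def)
  have N: "N \<ge> 1" "N > 0" using h by (auto simp: N_def)
  have K: "K \<ge> 1" using Suc_leI[of 0 "CARD('k)"] by (simp add: K_def)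
  have \<tau>: "0 \<le> ?\<tau>" "?\<tau> \<le> 1" using prob_simplexD[OF t] by auto
  have eq: "AE s in simplex_lebesgue c. dirichlet_kernel h s t * (s $ j - t $ j)\<^sup>2 =
      dirichlet_pdf ?a s * (s $ j)\<^sup>2 - 2 * ?\<tau> * (dirichlet_pdf ?a s * s $ j) + ?\<tau>\<^sup>2 * dirichlet_pdf ?a s"
    using AE_dirichlet_kernel_eq_pdf[where c=c and h=h and t=t]
    by eventually_elim (simp add: power2_eq_square algebra_simps)
  have int: "integrable (simplex_lebesgue c) (\<lambda>s. dirichlet_pdf ?a s * (s $ j)\<^sup>2 -
      2 * ?\<tau> * (dirichlet_pdf ?a s * s $ j) + ?\<tau>\<^sup>2 * dirichlet_pdf ?a s)"
    by (intro Bochner_Integration.integrable_add Bochner_Integration.integrable_diff integrable_mult_right M I)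
  show "integrable (simplex_lebesgue c) (\<lambda>s. dirichlet_kernel h s t * (s $ j - t $ j)\<^sup>2)"
    using int by (subst integrable_cong_AE[OF _ _ eq]) auto
  have "(\<integral>s. dirichlet_kernel h s t * (s $ j - t $ j)\<^sup>2 \<partial>simplex_lebesgue c) =
    (\<integral>s. dirichlet_pdf ?a s * (s $ j)\<^sup>2 -
      2 * ?\<tau> * (dirichlet_pdf ?a s * s $ j) + ?\<tau>\<^sup>2 * dirichlet_pdf ?a s \<partial>simplex_lebesgue c)"
    by (rule integral_cong_AE[OF _ _ eq]) auto
  also have "\<dots> = ?a j * (?a j + 1) / (A * (A + 1)) - 2 * ?\<tau> * (?a j / A) + ?\<tau>\<^sup>2"
    using M I by (simp add: Bochner_Integration.integral_add Bochner_Integration.integral_diff)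
  also have "\<dots> = ((1 - K * ?\<tau>)\<^sup>2 + N * ?\<tau> * (1 - ?\<tau>) + (1 - 2 * ?\<tau>) + K * ?\<tau>\<^sup>2) / (A * (A + 1))"
  proof -
    have "A \<noteq> 0" "A + 1 \<noteq> 0" using A N K by auto
    then have "?a j * (?a j + 1) / (A * (A + 1)) - 2 * ?\<tau> * (?a j / A) + ?\<tau>\<^sup>2 =
       (?a j * (?a j + 1) - 2 * ?\<tau> * ?a j * (A + 1) + ?\<tau>\<^sup>2 * (A * (A + 1))) / (A * (A + 1))"
      by (simp add: divide_simps power2_eq_square)
    also have "?a j * (?a j + 1) - 2 * ?\<tau> * ?a j * (A + 1) + ?\<tau>\<^sup>2 * (A * (A + 1)) =
       (1 - K * ?\<tau>)\<^sup>2 + N * ?\<tau> * (1 - ?\<tau>) + (1 - 2 * ?\<tau>) + K * ?\<tau>\<^sup>2"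
      unfolding aj A by (simp add: power2_eq_square algebra_simps)
    finally show ?thesis .
  qed
  also have "\<dots> \<le> ((K + 1) * (N + K)) / (A * (A + 1))"
  proof (rule divide_right_mono)
    have "\<bar>1 - K * ?\<tau>\<bar> \<le> K" using K \<tau> mult_left_le[of ?\<tau> K] mult_nonneg_nonneg[of K ?\<tau>] by linarith
    then have 1: "(1 - K * ?\<tau>)\<^sup>2 \<le> K * K" using power_mono[of "\<bar>1 - K * ?\<tau>\<bar>" K 2] by (simp add: power2_eq_square)
    have 2: "N * ?\<tau> * (1 - ?\<tau>) \<le> N * 1 * 1" using \<tau> N by (intro mult_mono) auto
    have "?\<tau>\<^sup>2 \<le> 1" using \<tau> by (simp add: power_le_one)
    then have 3: "K * ?\<tau>\<^sup>2 \<le> K" using K mult_left_le[of "?\<tau>\<^sup>2" K] by auto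
    \<comment> \<open>It absorbs the constant coming from \<open>1 - 2 * ?\<tau>\<close> into the
      product \<open>(K + 1) * (N + K)\<close>.\<close>
    have "1 * 1 \<le> N * K" using N K by (intro mult_mono) auto
    then show "(1 - K * ?\<tau>)\<^sup>2 + N * ?\<tau> * (1 - ?\<tau>) + (1 - 2 * ?\<tau>) + K * ?\<tau>\<^sup>2 \<le> (K + 1) * (N + K)"
      using 1 2 3 \<tau> by (simp add: algebra_simps)
  qed (use A N K in auto)
  also have "\<dots> = (K + 1) / (A + 1)" using A N K by simp
  also have "\<dots> \<le> (K + 1) / N" using A N K by (intro divide_left_mono) auto
  also have "\<dots> = (CARD('k) + 1) * h" by (simp add: N_def K_def)
  finally show "(\<integral>s. dirichlet_kernel h s t * (s $ j - t $ j)\<^sup>2 \<partial>simplex_lebesgue c) \<le> (CARD('k) + 1) * h" .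
qed

text \<open>Chebyshev: on the event some squared deviation exceeds \<open>r\<^sup>2\<close>, hence
  so does the sum of all of them. The first factor \<open>CARD('k)\<close> counts the
  coordinates.\<close>

lemma dirichlet_kernel_tail:
  fixes c :: "'k :: finite" and h :: real
  assumes h: "h > 0" "h \<le> 1" and t: "t \<in> prob_simplex" and r: "r > 0"
  shows "(\<integral>s. dirichlet_kernel h s t * indicator {s. \<exists>j. \<bar>s $ j - t $ j\<bar> > r} s \<partial>simplex_lebesgue c)
    \<le> CARD('k) * (CARD('k) + 1) * h / r\<^sup>2"
proof -
  note M = dirichlet_kernel_mean_square[OF h t, of c]
  have "(\<integral>s. dirichlet_kernel h s t * indicator {s. \<exists>j. \<bar>s $ j - t $ j\<bar> > r} s \<partial>simplex_lebesgue c) \<le>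
    (\<integral>s. (\<Sum>j\<in>UNIV. dirichlet_kernel h s t * (s $ j - t $ j)\<^sup>2) / r\<^sup>2 \<partial>simplex_lebesgue c)"
  proof (rule integral_mono')
    show "integrable (simplex_lebesgue c) (\<lambda>s. (\<Sum>j\<in>UNIV. dirichlet_kernel h s t * (s $ j - t $ j)\<^sup>2) / r\<^sup>2)"
      using M by (intro integrable_divide Bochner_Integration.integrable_sum)
    fix s :: "real ^ 'k"
    have k: "dirichlet_kernel h s t \<ge> 0" by (rule dirichlet_kernel_nonneg) fact+
    show nn: "0 \<le> (\<Sum>j\<in>UNIV. dirichlet_kernel h s t * (s $ j - t $ j)\<^sup>2) / r\<^sup>2"
      using k by (intro divide_nonneg_nonneg sum_nonneg) auto
    show "dirichlet_kernel h s t * indicator {s. \<exists>j. \<bar>s $ j - t $ j\<bar> > r} s \<le>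
       (\<Sum>j\<in>UNIV. dirichlet_kernel h s t * (s $ j - t $ j)\<^sup>2) / r\<^sup>2"
    proof (cases "\<exists>j. \<bar>s $ j - t $ j\<bar> > r")
      case True
      then obtain j where j: "\<bar>s $ j - t $ j\<bar> > r" by auto
      have "r\<^sup>2 \<le> (s $ j - t $ j)\<^sup>2" using j r by (metis abs_le_square_iff abs_of_pos less_imp_le)
      then have "dirichlet_kernel h s t * r\<^sup>2 \<le> dirichlet_kernel h s t * (s $ j - t $ j)\<^sup>2"
        using k by (rule mult_left_mono)
      also have "\<dots> \<le> (\<Sum>j\<in>UNIV. dirichlet_kernel h s t * (s $ j - t $ j)\<^sup>2)"
        using k by (intro member_le_sum) auto
      finally show ?thesis using True r by (simp add: field_simps)
    qed (use nn in simp)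
  qed
  also have "\<dots> = (\<Sum>j\<in>UNIV. (\<integral>s. dirichlet_kernel h s t * (s $ j - t $ j)\<^sup>2 \<partial>simplex_lebesgue c)) / r\<^sup>2"
    using M by (simp add: Bochner_Integration.integral_sum)
  also have "\<dots> \<le> (\<Sum>j\<in>(UNIV :: 'k set). (CARD('k) + 1) * h) / r\<^sup>2"
    using M by (intro divide_right_mono sum_mono) auto
  also have "\<dots> = CARD('k) * (CARD('k) + 1) * h / r\<^sup>2" by (simp add: algebra_simps)
  finally show ?thesis .
qed

text \<open>The bound follows from \<open>ln x \<le> x - 1\<close>; in the exponent all three points have coordinate sum \<open>1\<close>.\<close>

lemma dirichlet_kernel_harnack:
  fixes s s' t :: "real ^ 'k"
  assumes h: "h > 0" and s: "s \<in> prob_simplex" "\<And>k. s $ k > 0"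
    and s': "s' \<in> prob_simplex" "\<And>k. s' $ k > 0" and t: "t \<in> prob_simplex"
  shows "dirichlet_kernel h s' t \<le> dirichlet_kernel h s t *
    exp ((\<Sum>k\<in>UNIV. (t $ k - s $ k) * (s' $ k - s $ k) / s $ k) / h)"
proof -
  define Z where "Z = Gamma (\<Sum>k\<in>UNIV. dirichlet_param h t k) / (\<Prod>k\<in>UNIV. Gamma (dirichlet_param h t k))"
  have Z: "Z \<ge> 0" using Gamma_sum_pos[of "dirichlet_param h t", OF dirichlet_param_pos[OF h t]] by (simp add: Z_def)
  have ker: "dirichlet_kernel h r t = Z * (\<Prod>k\<in>UNIV. (r $ k) powr (t $ k / h))" if "\<And>k. r $ k > 0" for r
    unfolding dirichlet_kernel_eq_pdf[OF that] dirichlet_pdf_def Z_def by (simp add: dirichlet_param_def)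
  have factor: "(s' $ k) powr (t $ k / h) \<le> (s $ k) powr (t $ k / h) * exp (t $ k / h * (s' $ k / s $ k - 1))" for k
  proof -
    have "(s' $ k) powr (t $ k / h) = exp (t $ k / h * ln (s $ k) + t $ k / h * ln (s' $ k / s $ k))"
      using s(2)[of k] s'(2)[of k] by (simp add: powr_def ln_div algebra_simps)
    also have "\<dots> \<le> exp (t $ k / h * ln (s $ k) + t $ k / h * (s' $ k / s $ k - 1))"
      using s(2)[of k] s'(2)[of k] prob_simplexD(1)[OF t, of k] h
      by (intro iffD2[OF exp_le_cancel_iff] add_left_mono mult_left_mono ln_le_minus_one) auto
    also have "\<dots> = (s $ k) powr (t $ k / h) * exp (t $ k / h * (s' $ k / s $ k - 1))"
      using s(2)[of k] by (simp add: powr_def exp_add)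
    finally show ?thesis .
  qed
  have "(\<Prod>k\<in>UNIV. (s' $ k) powr (t $ k / h)) \<le>
      (\<Prod>k\<in>UNIV. (s $ k) powr (t $ k / h) * exp (t $ k / h * (s' $ k / s $ k - 1)))"
    by (intro prod_mono) (auto intro: factor simp del: times_divide_eq_left)
  also have "\<dots> = (\<Prod>k\<in>UNIV. (s $ k) powr (t $ k / h)) * exp (\<Sum>k\<in>UNIV. t $ k / h * (s' $ k / s $ k - 1))"
    by (simp add: prod.distrib exp_sum)
  \<comment> \<open>The left side is of first order in \<open>s' - s\<close>, too large after
    division by \<open>h\<close> when the distances are of order \<open>sqrt h\<close>. The
    differences \<open>s' $ k - s $ k\<close> sum to 0, and subtracting them leaves a product of two
    small differences, which is of order \<open>h\<close>.\<close>
  also have "(\<Sum>k\<in>UNIV. t $ k / h * (s' $ k / s $ k - 1)) =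
      (\<Sum>k\<in>UNIV. (t $ k - s $ k) * (s' $ k - s $ k) / s $ k) / h"
  proof -
    have "(\<Sum>k\<in>UNIV. (t $ k - s $ k) * (s' $ k - s $ k) / s $ k) =
       (\<Sum>k\<in>UNIV. t $ k * (s' $ k / s $ k - 1) - s' $ k + s $ k)"
    proof (rule sum.cong)
      fix k
      have "s $ k \<noteq> 0" using s(2)[of k] by simp
      then show "(t $ k - s $ k) * (s' $ k - s $ k) / s $ k = t $ k * (s' $ k / s $ k - 1) - s' $ k + s $ k"
        by (simp add: field_simps)
    qed simp
    also have "\<dots> = (\<Sum>k\<in>UNIV. t $ k * (s' $ k / s $ k - 1))"
      using s s' by (simp add: sum.distrib sum_subtractf prob_simplexD)
    finally show ?thesis by (simp add: sum_divide_distrib mult.commute)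
  qed
  finally show ?thesis
    unfolding ker[OF s(2)] ker[OF s'(2)] using Z by (simp add: mult_left_mono mult.assoc)
qed

text \<open>Coordinate \<open>c\<close> is left free, so that away from the faces this is a cube in
  the chart, with exactly known volume.\<close>

definition simplex_box :: "'k \<Rightarrow> real ^ 'k \<Rightarrow> real \<Rightarrow> (real ^ 'k) set"
  where "simplex_box c s r = {s' \<in> prob_simplex. \<forall>k\<in>UNIV - {c}. \<bar>s' $ k - s $ k\<bar> \<le> r}"

lemma simplex_box_borel [measurable]: "simplex_box c s r \<in> sets borel"
proof -
  have "simplex_box c s r = {s' \<in> space borel. s' \<in> prob_simplex \<and> (\<forall>k\<in>UNIV - {c}. \<bar>s' $ k - s $ k\<bar> \<le> r)}"
    by (auto simp: simplex_box_def)
  also have "\<dots> \<in> sets borel" by measurable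
  finally show ?thesis .
qed

lemma simplex_box_subset: "simplex_box c s r \<subseteq> prob_simplex"
  by (auto simp: simplex_box_def)

lemma simplex_box_sets [measurable]: "simplex_box c s r \<in> sets (simplex_lebesgue c')"
proof -
  have "simplex_box c s r \<in> sets (restrict_space borel prob_simplex)"
    using simplex_box_subset by (subst sets_restrict_space_iff) auto
  then show ?thesis by (simp only: sets_simplex_lebesgue)
qed

text \<open>The deviation in coordinate \<open>c\<close> is minus the sum of all the others, because
  both points have coordinate sum 1; this is the source of the factor
  \<open>CARD('k)\<close>.\<close>

lemma simplex_box_nth:
  fixes s s' :: "real ^ 'k" and r :: real
  assumes s: "s \<in> prob_simplex" and s': "s' \<in> simplex_box c s r" and "r \<ge> 0"
  shows "\<bar>s' $ k - s $ k\<bar> \<le> CARD('k) * r"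
proof (cases "k = c")
  case False
  have "\<bar>s' $ k - s $ k\<bar> \<le> 1 * r" using s' False by (auto simp: simplex_box_def)
  also have "1 * r \<le> CARD('k) * r"
    using \<open>r \<ge> 0\<close> Suc_leI[of 0 "CARD('k)"] by (intro mult_right_mono) simp_all
  finally show ?thesis .
next
  case True
  have "(\<Sum>k\<in>UNIV. s' $ k - s $ k) = 0"
    using s s' by (simp add: simplex_box_def prob_simplexD sum_subtractf)
  then have "s' $ c - s $ c = - (\<Sum>k\<in>UNIV - {c}. s' $ k - s $ k)"
    by (subst (asm) sum.remove[of _ c]) auto
  then have "\<bar>s' $ c - s $ c\<bar> \<le> (\<Sum>k\<in>UNIV - {c}. \<bar>s' $ k - s $ k\<bar>)" by (simp add: sum_abs)
  also have "\<dots> \<le> (\<Sum>k\<in>UNIV - {c}. r)" using s' by (intro sum_mono) (auto simp: simplex_box_def)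
  also have "\<dots> \<le> (\<Sum>k\<in>(UNIV :: 'k set). r)" using \<open>r \<ge> 0\<close> by (intro sum_mono2) auto
  finally show ?thesis using True by simp
qed

text \<open>The smallness condition keeps every coordinate nonnegative throughout the cube,
  including the dependent one, which may drop by \<open>r\<close> for each of the others. So the
  simplex cuts nothing off.\<close>

lemma measure_simplex_box:
  fixes s :: "real ^ 'k" and r :: real
  assumes s: "s \<in> prob_simplex" and r: "r > 0" and small: "\<And>k. CARD('k) * r \<le> s $ k"
  shows "measure (simplex_lebesgue c) (simplex_box c s r) = (2 * r) ^ (CARD('k) - 1)"
proof -
  interpret product_sigma_finite "\<lambda>i::'k. lborel :: real measure" ..
  let ?P = "\<Pi>\<^sub>M k\<in>UNIV - {c}. (lborel :: real measure)"
  have "simplex_chart c -` simplex_box c s r \<inter> space ?P = Pi\<^sub>E (UNIV - {c}) (\<lambda>k. {s $ k - r..s $ k + r})"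
  proof (intro subset_antisym subsetI)
    fix u assume "u \<in> simplex_chart c -` simplex_box c s r \<inter> space ?P"
    then have ext: "u \<in> extensional (UNIV - {c})" by (auto simp: space_PiM PiE_def)
    have u: "\<bar>simplex_chart c u $ k - s $ k\<bar> \<le> r" if "k \<in> UNIV - {c}" for k
      using that \<open>u \<in> simplex_chart c -` _ \<inter> _\<close> by (auto simp: simplex_box_def)
    have "\<bar>u k - s $ k\<bar> \<le> r" if "k \<in> UNIV - {c}" for k
      using u[OF that] that by (simp add: simplex_chart_nth)
    then show "u \<in> Pi\<^sub>E (UNIV - {c}) (\<lambda>k. {s $ k - r..s $ k + r})"
      using ext by (force simp: PiE_def abs_le_iff)
  next
    fix u assume u: "u \<in> Pi\<^sub>E (UNIV - {c}) (\<lambda>k. {s $ k - r..s $ k + r})"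
    then have uk: "\<bar>u k - s $ k\<bar> \<le> r" if "k \<noteq> c" for k using that by (force simp: PiE_def abs_le_iff)
    have pos: "0 \<le> simplex_chart c u $ k" for k
    proof (cases "k = c")
      case False
      have "1 * r \<le> CARD('k) * r"
        using r Suc_leI[of 0 "CARD('k)"] by (intro mult_right_mono) simp_all
      then show ?thesis using uk[OF False] small[of k] False by (simp add: simplex_chart_nth)
    next
      case True
      have "(\<Sum>i\<in>UNIV - {c}. u i) \<le> (\<Sum>i\<in>UNIV - {c}. s $ i + r)"
      proof (rule sum_mono)
        fix i assume "i \<in> UNIV - {c}"
        then show "u i \<le> s $ i + r" using uk[of i] by auto
      qed
      also have "\<dots> = (\<Sum>i\<in>UNIV - {c}. s $ i) + (\<Sum>i\<in>UNIV - {c}. r)" by (rule sum.distrib)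
      also have "(\<Sum>i\<in>UNIV - {c}. s $ i) = 1 - s $ c"
        using prob_simplexD(3)[OF s] by (simp add: sum.remove[of UNIV c "\<lambda>i. s $ i"])
      also have "(\<Sum>i\<in>UNIV - {c}. r) \<le> (\<Sum>k\<in>(UNIV :: 'k set). r)" using r by (intro sum_mono2) auto
      finally show ?thesis using small[of c] True by (simp add: simplex_chart_nth)
    qed
    then have "simplex_chart c u \<in> prob_simplex" by (simp add: prob_simplex_iff sum_simplex_chart)
    then show "u \<in> simplex_chart c -` simplex_box c s r \<inter> space ?P"
      using u uk by (auto simp: simplex_box_def space_PiM simplex_chart_nth PiE_def)
  qed
  then have "emeasure (simplex_lebesgue c) (simplex_box c s r) =
      emeasure ?P (Pi\<^sub>E (UNIV - {c}) (\<lambda>k. {s $ k - r..s $ k + r}))"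
    by (simp add: emeasure_simplex_lebesgue simplex_box_subset)
  also have "\<dots> = (\<Prod>k\<in>UNIV - {c}. ennreal (2 * r))"
    using r by (subst emeasure_PiM) auto
  also have "\<dots> = ennreal ((2 * r) ^ (CARD('k) - 1))"
    using r by (simp add: ennreal_power card_Diff_singleton)
  finally show ?thesis using r by (intro measure_eq_emeasure_eq_ennreal) auto
qed

text \<open>The Dirichlet law with parameter \<open>t/h + 1\<close> puts half of its mass at distance \<open>O(sqrt h)\<close>
  from \<open>t\<close>, and by Harnack the kernel is comparable to \<open>k(s; t)\<close> there.\<close>

lemma dirichlet_kernel_lower_bound:
  fixes s t :: "real ^ 'k" and h r m :: real
  assumes h: "h > 0" "h \<le> 1" and s: "s \<in> prob_simplex"
    and r: "r > 0" "r\<^sup>2 = 2 * real CARD('k) * (real CARD('k) + 1) * h"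
    and m: "m > 0" "\<And>k. m \<le> s $ k" "2 * real CARD('k) * r \<le> m"
    and t: "t \<in> simplex_box c s r"
  shows "1 \<le> 2 * dirichlet_kernel h s t * exp (4 * real CARD('k) ^ 4 * (real CARD('k) + 1) / m) * (4 * r) ^ (CARD('k) - 1)"
proof -
  define K where "K = real CARD('k)"
  have K: "K \<ge> 1" using Suc_leI[of 0 "CARD('k)"] by (simp add: K_def)
  define C where "C = exp (4 * K ^ 4 * (K + 1) / m)"
  let ?L = "simplex_lebesgue c"
  interpret finite_measure ?L by (rule finite_measure_simplex_lebesgue)
  have tS: "t \<in> prob_simplex" using t by (simp add: simplex_box_def)
  have sp: "s $ k > 0" for k using m(1) m(2)[of k] by linarith
  \<comment> \<open>A point within \<open>r\<close> of \<open>t\<close> is within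
    \<open>2 * r\<close> of \<open>s\<close> in the coordinates that define the box. Hence the tail
    event \<open>?T\<close> and \<open>?B\<close> together cover the simplex.\<close>
  let ?B = "simplex_box c s (2 * r)"
  let ?T = "{s'. \<exists>j. \<bar>s' $ j - t $ j\<bar> > r}"
  let ?k = "\<lambda>s'. dirichlet_kernel h s' t"
  have k0: "?k s' \<ge> 0" for s' by (rule dirichlet_kernel_nonneg) fact+
  note I = dirichlet_kernel_integral[OF h(1) tS, of c]
  have T_sets: "(\<lambda>s'. indicator ?T s' :: real) \<in> borel_measurable ?L"
    by (rule measurable_simplex_lebesgue1) measurable
  have int_T: "integrable ?L (\<lambda>s'. ?k s' * indicator ?T s')"
    by (rule Bochner_Integration.integrable_bound[OF I(1)])
       (use T_sets k0 in \<open>auto simp: indicator_def\<close>)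
  have int_B: "integrable ?L (\<lambda>s'. ?k s' * indicator ?B s')"
    by (rule Bochner_Integration.integrable_bound[OF I(1)]) (use k0 in \<open>auto simp: indicator_def\<close>)
  have "1 = (\<integral>s'. ?k s' \<partial>?L)" using I by simp
  also have "\<dots> \<le> (\<integral>s'. ?k s' * indicator ?T s' + ?k s' * indicator ?B s' \<partial>?L)"
  proof (rule integral_mono)
    fix s' assume s': "s' \<in> space ?L"
    show "?k s' \<le> ?k s' * indicator ?T s' + ?k s' * indicator ?B s'"
    proof (cases "s' \<in> ?T")
      case False
      have "s' \<in> ?B"
        unfolding simplex_box_def
      proof (intro CollectI conjI ballI)
        fix k assume "k \<in> UNIV - {c}"
        then have "\<bar>t $ k - s $ k\<bar> \<le> r" using t by (auto simp: simplex_box_def)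
        moreover have "\<bar>s' $ k - t $ k\<bar> \<le> r" using False by (auto simp: not_less)
        ultimately show "\<bar>s' $ k - s $ k\<bar> \<le> 2 * r" by linarith
      qed (use s' in simp)
      then show ?thesis using False by simp
    qed (use k0 in \<open>auto simp: indicator_def\<close>)
  qed (use I int_T int_B in auto)
  also have "\<dots> = (\<integral>s'. ?k s' * indicator ?T s' \<partial>?L) + (\<integral>s'. ?k s' * indicator ?B s' \<partial>?L)"
    using int_T int_B by simp
  also have "(\<integral>s'. ?k s' * indicator ?T s' \<partial>?L) \<le> CARD('k) * (CARD('k) + 1) * h / r\<^sup>2"
    by (rule dirichlet_kernel_tail) fact+
  \<comment> \<open>The prescribed value of \<open>r\<^sup>2\<close> is twice the Chebyshev
    numerator, so at least half of the mass is left for the box.\<close>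
  also have "CARD('k) * (CARD('k) + 1) * h / r\<^sup>2 = 1 / 2"
  proof -
    define x where "x = CARD('k) * (CARD('k) + 1) * h"
    have "0 < CARD('k) * (CARD('k) + 1)" by simp
    then have "x > 0" unfolding x_def using h by (simp only: of_nat_0_less_iff zero_less_mult_iff simp_thms)
    moreover have "r\<^sup>2 = 2 * x" by (simp add: x_def r(2) algebra_simps)
    ultimately show ?thesis unfolding x_def[symmetric] by simp
  qed
  finally have "1 / 2 \<le> (\<integral>s'. ?k s' * indicator ?B s' \<partial>?L)" by simp
  also have "\<dots> \<le> (\<integral>s'. (?k s * C) * indicator ?B s' \<partial>?L)"
  proof (rule integral_mono_AE)
    show "AE s' in ?L. ?k s' * indicator ?B s' \<le> (?k s * C) * indicator ?B s'"
      using AE_simplex_lebesgue_pos[of c] AE_space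
    proof eventually_elim
      case (elim s')
      show ?case
      proof (cases "s' \<in> ?B")
        case True
        have s': "s' \<in> prob_simplex" using elim by simp
        have "?k s' \<le> ?k s * exp ((\<Sum>k\<in>UNIV. (t $ k - s $ k) * (s' $ k - s $ k) / s $ k) / h)"
          using h s sp s' elim tS by (intro dirichlet_kernel_harnack) auto
        also have "\<dots> \<le> ?k s * C"
        proof (intro mult_left_mono k0)
          have "(t $ k - s $ k) * (s' $ k - s $ k) / s $ k \<le> (K * r) * (K * (2 * r)) / m" for k
          proof -
            have "(t $ k - s $ k) * (s' $ k - s $ k) \<le> \<bar>t $ k - s $ k\<bar> * \<bar>s' $ k - s $ k\<bar>"
              by (metis abs_ge_self abs_mult)
            also have "\<dots> \<le> (K * r) * (K * (2 * r))"
              using simplex_box_nth[OF s t] simplex_box_nth[OF s True] r K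
              by (intro mult_mono) (auto simp: K_def)
            finally have "(t $ k - s $ k) * (s' $ k - s $ k) / s $ k \<le> (K * r) * (K * (2 * r)) / s $ k"
              using sp[of k] by (intro divide_right_mono) auto
            also have "\<dots> \<le> (K * r) * (K * (2 * r)) / m"
              using m(1) m(2)[of k] r K by (intro divide_left_mono mult_nonneg_nonneg mult_pos_pos) auto
            finally show ?thesis .
          qed
          \<comment> \<open>Origin of \<open>C\<close>: each of the \<open>K\<close> coordinates
            contributes at most \<open>2 * K\<^sup>2 * r\<^sup>2 / m\<close>, and
            \<open>r\<^sup>2 = 2 * K * (K + 1) * h\<close>. The factor \<open>h\<close> cancels the
            division by \<open>h\<close>, so \<open>C\<close> depends on \<open>s\<close> only
            through \<open>m\<close> and is the same for all \<open>h\<close>.\<close>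
          then have "(\<Sum>k\<in>UNIV. (t $ k - s $ k) * (s' $ k - s $ k) / s $ k) \<le>
              (\<Sum>k\<in>(UNIV :: 'k set). (K * r) * (K * (2 * r)) / m)"
            by (intro sum_mono)
          also have "\<dots> = 2 * K ^ 3 * r\<^sup>2 / m" by (simp add: K_def power2_eq_square power3_eq_cube)
          also have "\<dots> = 4 * K ^ 4 * (K + 1) / m * h"
            unfolding r(2) by (simp add: K_def power4_eq_xxxx power3_eq_cube algebra_simps)
          finally have "(\<Sum>k\<in>UNIV. (t $ k - s $ k) * (s' $ k - s $ k) / s $ k) / h \<le> 4 * K ^ 4 * (K + 1) / m"
            using h by (simp add: pos_divide_le_eq)
          then show "exp ((\<Sum>k\<in>UNIV. (t $ k - s $ k) * (s' $ k - s $ k) / s $ k) / h) \<le> C"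
            by (simp add: C_def)
        qed
        finally show ?thesis using True by simp
      qed simp
    qed
    have "integrable ?L (indicator ?B :: _ \<Rightarrow> real)"
      by (intro integrable_real_indicator) (auto simp: emeasure_eq_measure)
    then show "integrable ?L (\<lambda>s'. (?k s * C) * indicator ?B s')" by (rule integrable_mult_right)
  qed (rule int_B)
  also have "\<dots> = ?k s * C * measure ?L ?B"
    by (subst integral_mult_right_zero) (simp add: Int_absorb2 simplex_box_subset)
  also have "measure ?L ?B = (2 * (2 * r)) ^ (CARD('k) - 1)"
  proof (rule measure_simplex_box)
    show "CARD('k) * (2 * r) \<le> s $ k" for k using m(2)[of k] m(3) by (simp add: mult_ac)
  qed (use s r in auto)
  finally have "1 \<le> 2 * (?k s * C * (2 * (2 * r)) ^ (CARD('k) - 1))" by simp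
  moreover have "2 * (2 * r) = 4 * r" by simp
  ultimately show ?thesis by (simp only: C_def K_def mult.assoc)
qed

lemma integrable_dirichlet_kernel_right:
  fixes c :: "'k :: finite"
  assumes h: "h > 0" and s: "s \<in> prob_simplex"
    and g [measurable]: "g \<in> borel_measurable (simplex_lebesgue c)" and G: "\<And>t. t \<in> prob_simplex \<Longrightarrow> \<bar>g t\<bar> \<le> G"
  shows "integrable (simplex_lebesgue c) (\<lambda>t. dirichlet_kernel h s t * g t)"
proof -
  interpret finite_measure "simplex_lebesgue c" by (rule finite_measure_simplex_lebesgue)
  obtain B where B: "B > 0" "\<And>(s :: real ^ 'k) t. s \<in> prob_simplex \<Longrightarrow> t \<in> prob_simplex \<Longrightarrow> dirichlet_kernel h s t \<le> B"
    using dirichlet_kernel_bounded[OF h] by blast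
  have [measurable]: "(\<lambda>t. dirichlet_kernel h s t) \<in> borel_measurable (simplex_lebesgue c)"
    using measurable_compose[OF measurable_Pair1'[of s "simplex_lebesgue c" "simplex_lebesgue c"]
        dirichlet_kernel_measurable_pair[OF h, of c]] s by simp
  show ?thesis
  proof (rule integrable_const_bound[where B="B * G"])
    show "AE t in simplex_lebesgue c. norm (dirichlet_kernel h s t * g t) \<le> B * G"
      using B G s h dirichlet_kernel_nonneg[OF h, of _ s]
      by (intro AE_I2) (auto simp: abs_mult intro!: mult_mono)
  qed measurable
qed

text \<open>On a box with radius \<open>r\<close> of order \<open>sqrt h\<close>, the kernel is at
  least a constant divided by \<open>(4 * r) ^ (CARD('k) - 1)\<close> and \<open>g\<close> is at
  least \<open>g s / 2\<close>, while the box has volume \<open>(2 * r) ^ (CARD('k) - 1)\<close>.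
  The powers of \<open>r\<close> cancel, so that \<open>\<delta>\<close> is free of
  \<open>h\<close>.\<close>

lemma smoothed_density_lower_bound:
  fixes s :: "real ^ 'k" and g :: "real ^ 'k \<Rightarrow> real"
  assumes s: "s \<in> prob_simplex" "\<And>k. s $ k > 0" "g s > 0"
    and g: "continuous_on prob_simplex g" "\<And>t. t \<in> prob_simplex \<Longrightarrow> g t \<ge> 0"
  shows "\<exists>\<delta>>0. \<exists>h\<^sub>0>0. \<forall>h. 0 < h \<longrightarrow> h \<le> h\<^sub>0 \<longrightarrow> \<delta> \<le> (\<integral>t. dirichlet_kernel h s t * g t \<partial>simplex_lebesgue c)"
proof -
  define K where "K = real CARD('k)"
  have K: "K \<ge> 1" using Suc_leI[of 0 "CARD('k)"] by (simp add: K_def)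
  let ?L = "simplex_lebesgue c"
  interpret finite_measure ?L by (rule finite_measure_simplex_lebesgue)
  define m where "m = Min (range (\<lambda>k. s $ k))"
  have m: "m > 0" "\<And>k. m \<le> s $ k" using s(2) by (auto simp: m_def)
  define C where "C = exp (4 * K ^ 4 * (K + 1) / m)"
  have C: "C > 0" by (simp add: C_def)
  obtain d where d: "d > 0" "\<And>t. t \<in> prob_simplex \<Longrightarrow> dist t s < d \<Longrightarrow> dist (g t) (g s) < g s / 2"
    using g(1) s unfolding continuous_on_iff by (metis half_gt_zero)
  obtain G where G: "\<And>t. t \<in> prob_simplex \<Longrightarrow> \<bar>g t\<bar> \<le> G"
    using compact_imp_bounded[OF compact_continuous_image[OF g(1) compact_prob_simplex]]
    by (auto simp: bounded_iff)
  have g_meas [measurable]: "g \<in> borel_measurable ?L"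
    unfolding measurable_cong_sets[OF sets_simplex_lebesgue refl]
    by (rule borel_measurable_continuous_on_restrict[OF g(1)])
  \<comment> \<open>The first bound is what \<open>dirichlet_kernel_lower_bound\<close> asks of
    \<open>r\<close>. The second keeps the box within distance \<open>d\<close> of \<open>s\<close>:
    one \<open>K\<close> stems from coordinate \<open>c\<close>, the other from the l1 norm, and the
    2 makes the inequality strict.\<close>
  define r\<^sub>0 where "r\<^sub>0 = min (m / (2 * K)) (d / (2 * K * K))"
  have r\<^sub>0: "r\<^sub>0 > 0" using m d K by (simp add: r\<^sub>0_def)
  define h\<^sub>0 where "h\<^sub>0 = min 1 (r\<^sub>0\<^sup>2 / (2 * K * (K + 1)))"
  have h\<^sub>0: "h\<^sub>0 > 0" using r\<^sub>0 K by (simp add: h\<^sub>0_def)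
  define \<delta> where "\<delta> = g s / (4 * C * 2 ^ (CARD('k) - 1))"
  show ?thesis
  proof (rule exI[of _ \<delta>], rule conjI)
    show "\<delta> > 0" using s C by (simp add: \<delta>_def)
    show "\<exists>h\<^sub>0>0. \<forall>h. 0 < h \<longrightarrow> h \<le> h\<^sub>0 \<longrightarrow> \<delta> \<le> (\<integral>t. dirichlet_kernel h s t * g t \<partial>?L)"
  proof (intro exI[of _ h\<^sub>0] conjI allI impI)
    show "h\<^sub>0 > 0" by (rule h\<^sub>0)
    fix h :: real assume h: "0 < h" "h \<le> h\<^sub>0"
    define r where "r = sqrt (2 * K * (K + 1) * h)"
    have r: "r > 0" "r\<^sup>2 = 2 * K * (K + 1) * h" using h K by (simp_all add: r_def)
    have "r\<^sup>2 \<le> r\<^sub>0\<^sup>2" unfolding r(2) using h K by (simp add: h\<^sub>0_def pos_le_divide_eq mult.commute)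
    then have le: "r \<le> r\<^sub>0" by (rule power2_le_imp_le) (rule less_imp_le[OF r\<^sub>0])
    have "r \<le> m / (2 * K)" "r \<le> d / (2 * K * K)"
      by (rule order_trans[OF le], simp add: r\<^sub>0_def)+
    then have r1: "2 * K * r \<le> m" and r2: "2 * K * K * r \<le> d"
      using K by (simp_all add: pos_le_divide_eq mult_ac)
    define W where "W = (4 * r) ^ (CARD('k) - 1)"
    have W: "W > 0" using r by (simp add: W_def)
    let ?B = "simplex_box c s r"
    have lower: "1 / (2 * C * W) \<le> dirichlet_kernel h s t" if "t \<in> ?B" for t
    proof -
      have "1 \<le> 2 * dirichlet_kernel h s t * C * W"
        unfolding C_def W_def K_def
        using h s(1) r m r1 that by (intro dirichlet_kernel_lower_bound[where c=c]) (auto simp: K_def h\<^sub>0_def)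
      then show ?thesis using C W by (simp add: pos_divide_le_eq mult_ac)
    qed
    have near: "g s / 2 \<le> g t" if "t \<in> ?B" for t
    proof -
      have t: "t \<in> prob_simplex" using that by (simp add: simplex_box_def)
      have "norm (t - s) \<le> (\<Sum>k\<in>UNIV. \<bar>(t - s) $ k\<bar>)" by (rule norm_le_l1_cart)
      also have "\<dots> \<le> (\<Sum>k\<in>(UNIV :: 'k set). K * r)"
        using simplex_box_nth[OF s(1) that] r by (intro sum_mono) (auto simp: K_def)
      also have "\<dots> = K * K * r" by (simp add: K_def)
      also have "\<dots> < 2 * K * K * r" using K r by simp
      finally have "dist t s < d" using r2 by (simp add: dist_norm)
      then have "dist (g t) (g s) < g s / 2" using d t by blast
      then show ?thesis by (auto simp: dist_real_def abs_real_def split: if_splits)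
    qed
    have "\<delta> = (1 / (2 * C * W) * (g s / 2)) * (2 * r) ^ (CARD('k) - 1)"
    proof -
      have "4 * r = 2 * (2 * r)" by simp
      then have W': "W = 2 ^ (CARD('k) - 1) * (2 * r) ^ (CARD('k) - 1)"
        unfolding W_def by (simp only: power_mult_distrib)
      have "x / (4 * C * P) = (1 / (2 * C * (P * R)) * (x / 2)) * R" if "P > 0" "R > 0" for x P R :: real
        using that C by (simp add: field_simps)
      then show ?thesis unfolding \<delta>_def W' using r by simp
    qed
    also have "(2 * r) ^ (CARD('k) - 1) = measure ?L ?B"
    proof (rule measure_simplex_box[symmetric])
      show "CARD('k) * r \<le> s $ k" for k
        using r1 m(2)[of k] K r mult_nonneg_nonneg[of K r] unfolding K_def by linarith
    qed (use s r in auto)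
    also have "(1 / (2 * C * W) * (g s / 2)) * measure ?L ?B =
        (\<integral>t. (1 / (2 * C * W) * (g s / 2)) * indicator ?B t \<partial>?L)"
      by (subst integral_mult_right_zero) (simp add: Int_absorb2 simplex_box_subset)
    also have "\<dots> \<le> (\<integral>t. dirichlet_kernel h s t * g t \<partial>?L)"
    proof (rule integral_mono)
      show "integrable ?L (\<lambda>t. dirichlet_kernel h s t * g t)"
        using h s G by (intro integrable_dirichlet_kernel_right) auto
      fix t assume t: "t \<in> space ?L"
      show "(1 / (2 * C * W) * (g s / 2)) * indicator ?B t \<le> dirichlet_kernel h s t * g t"
      proof (cases "t \<in> ?B")
        case True
        then show ?thesis using lower[OF True] near[OF True] s W C
          by (auto intro!: mult_mono dirichlet_kernel_nonneg h g simp: simplex_box_def simp del: times_divide_eq_right times_divide_eq_left)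
      next
        case False
        then show ?thesis using t h g dirichlet_kernel_nonneg[of h t s] by simp
      qed
    next
      have "integrable ?L (indicator ?B :: _ \<Rightarrow> real)"
        by (intro integrable_real_indicator) (auto simp: emeasure_eq_measure)
      then show "integrable ?L (\<lambda>t. (1 / (2 * C * W) * (g s / 2)) * indicator ?B t)"
        by (rule integrable_mult_right)
    qed
    finally show "\<delta> \<le> (\<integral>t. dirichlet_kernel h s t * g t \<partial>?L)" .
  qed
  qed
qed

section \<open>Approximation by continuous functions and regression functions\<close>

text \<open>Regularity of finite Borel measures encloses \<open>B\<close> between a compact
  \<open>F\<close> and an open \<open>U\<close> of nearly the same mass. A Urysohn function for
  \<open>F\<close> and \<open>- U\<close> can differ from the indicator only on
  \<open>U - F\<close>.\<close>

lemma L1_continuous_approx_indicator: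
  fixes \<mu> :: "'a :: euclidean_space measure"
  assumes "prob_space \<mu>" and sets: "sets \<mu> = sets borel" and B: "B \<in> sets borel" and "e > 0"
  shows "\<exists>u :: 'a \<Rightarrow> real. continuous_on UNIV u \<and> range u \<subseteq> {0..1} \<and> (\<integral>x. \<bar>indicator B x - u x\<bar> \<partial>\<mu>) \<le> e"
proof -
  interpret prob_space \<mu> by fact
  note [measurable_cong] = sets
  have fin: "emeasure \<mu> (space \<mu>) \<noteq> \<infinity>" by simp
  have "emeasure \<mu> B < ennreal (prob B + e / 2)"
    using \<open>e > 0\<close> by (simp add: emeasure_eq_measure ennreal_lessI)
  then obtain U where U: "B \<subseteq> U" "open U" "emeasure \<mu> U < ennreal (prob B + e / 2)"
    unfolding outer_regular[OF sets fin B] Inf_less_iff by auto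
  obtain F where F: "F \<subseteq> B" "compact F" "prob B - e / 2 < prob F"
  \<comment> \<open>\<open>ennreal\<close> truncates negative numbers to 0, which would spoil the
    strict inequality for a null set \<open>B\<close>; in that case the empty set serves as
    \<open>F\<close>.\<close>
  proof (cases "prob B - e / 2 < 0")
    case True
    then show ?thesis by (intro that[of "{}"]) auto
  next
    case False
    then have "ennreal (prob B - e / 2) < emeasure \<mu> B"
      using \<open>e > 0\<close> by (simp add: emeasure_eq_measure ennreal_lessI)
    then obtain F where F: "F \<subseteq> B" "compact F" "ennreal (prob B - e / 2) < emeasure \<mu> F"
      unfolding inner_regular[OF sets fin B] less_SUP_iff by auto
    then show ?thesis using False by (intro that[of F]) (auto simp: emeasure_eq_measure ennreal_less_iff)
  qed
  have UF [measurable]: "U \<in> sets borel" "F \<in> sets borel"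
    using U F by (auto intro: borel_closed compact_imp_closed)
  have pU: "prob U < prob B + e / 2"
    using U(3) unfolding emeasure_eq_measure by (simp only: ennreal_less_iff measure_nonneg)
  have "closed F" using F by (simp add: compact_imp_closed)
  obtain u :: "'a \<Rightarrow> real" where u: "continuous_on UNIV u" "\<And>x. u x \<in> closed_segment 1 0"
    "\<And>x. x \<in> F \<Longrightarrow> u x = 1" "\<And>x. x \<in> - U \<Longrightarrow> u x = 0"
    using Urysohn[of F "- U" "1 :: real" 0] \<open>closed F\<close> U F by auto
  have u01: "u x \<in> {0..1}" for x using u(2)[of x] by (auto simp: closed_segment_eq_real_ivl)
  have [measurable]: "u \<in> borel_measurable borel" using u(1) by (rule borel_measurable_continuous_onI)
  have "(\<integral>x. \<bar>indicator B x - u x\<bar> \<partial>\<mu>) \<le> (\<integral>x. indicator (U - F) x \<partial>\<mu>)"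
  proof (rule integral_mono')
    show "integrable \<mu> (indicator (U - F) :: 'a \<Rightarrow> real)"
      by (rule integrable_const_bound[where B=1]) auto
    show "\<bar>indicator B x - u x\<bar> \<le> indicator (U - F) x" for x
      using u(3)[of x] u(4)[of x] u01[of x] U(1) F(1) by (auto simp: indicator_def split: if_splits)
  qed auto
  also have "\<dots> = prob (U - F)"
    using sets_eq_imp_space_eq[OF sets] by simp
  also have "\<dots> = prob U - prob F"
    using U F by (intro finite_measure_Diff) auto
  also have "\<dots> \<le> e" using pU F by linarith
  finally show ?thesis using u(1) u01 by (intro exI[of _ u]) auto
qed

text \<open>Layers: the average of the indicators of the superlevel sets \<open>B i\<close> rounds
  \<open>m\<close> down to a multiple of \<open>1 / n\<close>, and each indicator is then replaced
  by a continuous function. Averaging preserves both the error and the range.\<close>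

lemma L1_continuous_approx:
  fixes \<mu> :: "'a :: euclidean_space measure" and m :: "'a \<Rightarrow> real"
  assumes "prob_space \<mu>" and sets: "sets \<mu> = sets borel" and m: "m \<in> borel_measurable borel"
    and m01: "\<And>x. m x \<in> {0..1}" and "e > 0"
  obtains u :: "'a \<Rightarrow> real" where "continuous_on UNIV u" "range u \<subseteq> {0..1}" "(\<integral>x. \<bar>m x - u x\<bar> \<partial>\<mu>) \<le> e"
proof -
  interpret prob_space \<mu> by fact
  note [measurable_cong] = sets
  note [measurable] = m
  define n where "n = nat \<lceil>2 / e\<rceil>"
  have n: "n > 0" "1 / real n \<le> e / 2"
  proof -
    have "2 / e \<le> real n" unfolding n_def by linarith
    moreover have "2 / e > 0" using \<open>e > 0\<close> by simp
    ultimately show "n > 0" "1 / real n \<le> e / 2"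
      using \<open>e > 0\<close> by (auto simp: divide_simps mult_ac intro: Nat.gr0I)
  qed
  define B where "B i = {x. real (Suc i) / real n \<le> m x}" for i
  have B [measurable]: "B i \<in> sets borel" for i unfolding B_def by measurable
  have "\<forall>i. \<exists>u :: 'a \<Rightarrow> real. continuous_on UNIV u \<and> range u \<subseteq> {0..1} \<and> (\<integral>x. \<bar>indicator (B i) x - u x\<bar> \<partial>\<mu>) \<le> e / 2"
    by (intro allI L1_continuous_approx_indicator[OF \<open>prob_space \<mu>\<close> sets B] half_gt_zero \<open>e > 0\<close>)
  then obtain u :: "nat \<Rightarrow> 'a \<Rightarrow> real" where u: "\<And>i. continuous_on UNIV (u i)" "\<And>i x. u i x \<in> {0..1}"
    "\<And>i. (\<integral>x. \<bar>indicator (B i) x - u i x\<bar> \<partial>\<mu>) \<le> e / 2"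
    by (metis range_subsetD)
  have [measurable]: "u i \<in> borel_measurable borel" for i using u(1) by (rule borel_measurable_continuous_onI)
  define \<Psi> where "\<Psi> x = (\<Sum>i<n. u i x) / real n" for x
  define S where "S x = (\<Sum>i<n. indicator (B i) x) / real n" for x
  have [measurable]: "\<Psi> \<in> borel_measurable borel" "S \<in> borel_measurable borel" unfolding \<Psi>_def S_def by measurable
  have int: "integrable \<mu> (\<lambda>x. \<bar>indicator (B i) x - u i x\<bar>)" for i
    using u(2)[of i] by (intro integrable_const_bound[where B=1] AE_I2) (auto simp: indicator_def)
  have mS: "\<bar>m x - S x\<bar> \<le> 1 / real n" for x
  proof -
    \<comment> \<open>This is the number of levels \<open>(i + 1) / n\<close> that
      \<open>m x\<close> reaches.\<close>
    define k where "k = nat \<lfloor>real n * m x\<rfloor>"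
    have nm: "0 \<le> real n * m x" "real n * m x \<le> real n" using m01[of x] n by (auto intro: mult_left_le)
    have k: "real k \<le> real n * m x" "real n * m x < real k + 1" unfolding k_def using nm by linarith+
    have kn: "k \<le> n" using k nm by linarith
    have "x \<in> B i \<longleftrightarrow> i < k" for i
    proof -
      have "x \<in> B i \<longleftrightarrow> real (Suc i) \<le> real n * m x" using n by (simp add: B_def field_simps)
      also have "\<dots> \<longleftrightarrow> Suc i \<le> k"
      proof
        assume "real (Suc i) \<le> real n * m x"
        then have "real (Suc i) < real k + 1" using k by linarith
        then show "Suc i \<le> k" by linarith
      next
        assume "Suc i \<le> k"
        then have "real (Suc i) \<le> real k" by simp
        then show "real (Suc i) \<le> real n * m x" using k by linarith
      qed
      finally show ?thesis by (simp add: Suc_le_eq)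
    qed
    then have "(\<Sum>i<n. indicator (B i) x :: real) = (\<Sum>i<n. indicator {..<k} i)"
      by (intro sum.cong) (auto simp: indicator_def)
    also have "\<dots> = (\<Sum>i\<in>{..<n} \<inter> {..<k}. 1)" by (simp add: indicator_def sum.inter_restrict lessThan_def)
    also have "{..<n} \<inter> {..<k} = {..<k}" using kn by auto
    finally have "(\<Sum>i<n. indicator (B i) x :: real) = real k" by simp
    then have "S x = real k / real n" by (simp add: S_def)
    then have "m x - S x = (real n * m x - real k) / real n" using n by (simp add: field_simps)
    then show ?thesis using k n by (simp add: divide_right_mono)
  qed
  have "(\<integral>x. \<bar>m x - \<Psi> x\<bar> \<partial>\<mu>) \<le> (\<integral>x. 1 / real n + (\<Sum>i<n. \<bar>indicator (B i) x - u i x\<bar>) / real n \<partial>\<mu>)"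
  proof (rule integral_mono')
    show "integrable \<mu> (\<lambda>x. 1 / real n + (\<Sum>i<n. \<bar>indicator (B i) x - u i x\<bar>) / real n)"
      using int by auto
    show "0 \<le> 1 / real n + (\<Sum>i<n. \<bar>indicator (B i) x - u i x\<bar>) / real n" for x
      by (intro add_nonneg_nonneg divide_nonneg_nonneg sum_nonneg) auto
    fix x
    have "S x - \<Psi> x = (\<Sum>i<n. indicator (B i) x - u i x) / real n"
      by (simp add: S_def \<Psi>_def sum_subtractf diff_divide_distrib)
    then have "\<bar>S x - \<Psi> x\<bar> \<le> (\<Sum>i<n. \<bar>indicator (B i) x - u i x\<bar>) / real n"
      by (simp add: abs_div divide_right_mono)
    then show "\<bar>m x - \<Psi> x\<bar> \<le> 1 / real n + (\<Sum>i<n. \<bar>indicator (B i) x - u i x\<bar>) / real n"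
      using mS[of x] by linarith
  qed
  also have "\<dots> = 1 / real n + (\<Sum>i<n. (\<integral>x. \<bar>indicator (B i) x - u i x\<bar> \<partial>\<mu>)) / real n"
    using int by (simp add: prob_space Bochner_Integration.integral_sum)
  also have "\<dots> \<le> e / 2 + (\<Sum>i<n. e / 2) / real n"
    using n u(3) by (intro add_mono divide_right_mono sum_mono) auto
  also have "\<dots> = e" using n by simp
  finally have "(\<integral>x. \<bar>m x - \<Psi> x\<bar> \<partial>\<mu>) \<le> e" .
  moreover have "continuous_on UNIV \<Psi>" unfolding \<Psi>_def using u(1) n by (intro continuous_intros) auto
  moreover have "\<Psi> x \<in> {0..1}" for x
  proof -
    have "(\<Sum>i<n. u i x) \<le> (\<Sum>i<n. 1)" using u(2)[of _ x] by (intro sum_mono) auto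
    moreover have "0 \<le> (\<Sum>i<n. u i x)" using u(2)[of _ x] by (intro sum_nonneg) auto
    ultimately show ?thesis using n by (simp add: \<Psi>_def)
  qed
  ultimately show ?thesis by (intro that[of \<Psi>]) auto
qed

text \<open>The Doob-Dynkin factorisation. Values in \<open>ennreal\<close> let it follow the
  induction for nonnegative measurable functions, where suprema always exist.\<close>

lemma vimage_algebra_factorization:
  fixes f :: "'a \<Rightarrow> ennreal"
  assumes "f \<in> borel_measurable (vimage_algebra X Z N)" and Z: "Z \<in> X \<rightarrow> space N"
  shows "\<exists>m\<in>borel_measurable N. \<forall>x\<in>X. f x = m (Z x)"
  using assms(1)
proof (induction rule: borel_measurable_induct)
  case (cong f g)
  then show ?case by simp
next
  case (set A)
  then obtain B where B: "B \<in> sets N" "A = Z -` B \<inter> X"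
    unfolding sets_vimage_algebra2[OF Z] by auto
  then show ?case by (intro bexI[of _ "indicator B"]) (auto simp: indicator_def)
next
  case (mult u a)
  then obtain m where "m \<in> borel_measurable N" "\<forall>x\<in>X. u x = m (Z x)" by blast
  then show ?case by (intro bexI[of _ "\<lambda>z. a * m z"]) auto
next
  case (add u v)
  then obtain m m' where "m \<in> borel_measurable N" "\<forall>x\<in>X. u x = m (Z x)"
    "m' \<in> borel_measurable N" "\<forall>x\<in>X. v x = m' (Z x)" by blast
  then show ?case by (intro bexI[of _ "\<lambda>z. m' z + m z"]) auto
next
  case (seq U)
  then obtain m where m: "\<And>i. m i \<in> borel_measurable N" "\<And>i x. x \<in> X \<Longrightarrow> U i x = m i (Z x)" by metis
  then show ?case by (intro bexI[of _ "\<lambda>z. SUP i. m i z"]) (auto simp: image_comp)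
qed

text \<open>The conditional expectation factors through \<open>Z\<close>, but lies in the unit
  interval only almost surely; clipping enforces this everywhere. The passage through
  \<open>ennreal\<close> loses nothing where the value is nonnegative. The last property identifies
  the limits of the numerators, with the kernel as test function \<phi>.\<close>

lemma (in prob_space) regression_function:
  fixes Z :: "'a \<Rightarrow> 'b :: topological_space" and Y :: "'a \<Rightarrow> real"
  assumes Z [measurable]: "Z \<in> M \<rightarrow>\<^sub>M borel" and Y [measurable]: "Y \<in> borel_measurable M"
    and Y01: "\<And>x. x \<in> space M \<Longrightarrow> Y x \<in> {0..1}"
  obtains m where "m \<in> borel_measurable borel" "\<And>z. m z \<in> {0..1}"
    "AE x in M. real_cond_exp M (vimage_algebra (space M) Z borel) Y x = m (Z x)"
    "\<And>\<phi>. \<phi> \<in> borel_measurable borel \<Longrightarrow> integrable M (\<lambda>x. \<phi> (Z x) * Y x) \<Longrightarrow>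
      expectation (\<lambda>x. \<phi> (Z x) * Y x) = expectation (\<lambda>x. \<phi> (Z x) * m (Z x))"
proof -
  let ?F = "vimage_algebra (space M) Z borel"
  have sub: "subalgebra M ?F"
  proof -
    have "sets ?F \<subseteq> sets M"
      by (auto simp: sets_vimage_algebra2 intro: measurable_sets[OF Z])
    then show ?thesis by (simp add: subalgebra_def)
  qed
  interpret finite_measure_subalgebra M ?F by unfold_locales (rule sub)
  have intY: "integrable M Y" using Y01 by (intro integrable_const_bound[where B=1]) auto
  let ?E = "real_cond_exp M ?F Y"
  have E_meas: "?E \<in> borel_measurable ?F" by simp
  then obtain m0 where m0: "m0 \<in> borel_measurable borel" "\<And>x. x \<in> space M \<Longrightarrow> ennreal (?E x) = m0 (Z x)"
    using vimage_algebra_factorization[of "\<lambda>x. ennreal (?E x)" "space M" Z borel] by auto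
  define m where "m z = max 0 (min 1 (enn2real (m0 z)))" for z
  have m_meas [measurable]: "m \<in> borel_measurable borel" unfolding m_def using m0(1) by measurable
  have E01: "AE x in M. 0 \<le> ?E x \<and> ?E x \<le> 1"
    using real_cond_exp_ge_c[OF intY, of 0] real_cond_exp_le_c[OF intY, of 1] Y01
    by (auto simp: AE_conj_iff)
  have Em: "AE x in M. ?E x = m (Z x)"
    using E01
  proof (rule AE_mp, intro AE_I2 impI)
    fix x assume x: "x \<in> space M" and "0 \<le> ?E x \<and> ?E x \<le> 1"
    then show "?E x = m (Z x)" by (simp add: m_def m0(2)[OF x, symmetric])
  qed
  have "expectation (\<lambda>x. \<phi> (Z x) * Y x) = expectation (\<lambda>x. \<phi> (Z x) * m (Z x))"
    if \<phi> [measurable]: "\<phi> \<in> borel_measurable borel" and int: "integrable M (\<lambda>x. \<phi> (Z x) * Y x)" for \<phi>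
  proof -
    have "Z \<in> ?F \<rightarrow>\<^sub>M borel" by (rule measurable_vimage_algebra1) simp
    then have "(\<lambda>x. \<phi> (Z x)) \<in> borel_measurable ?F" by measurable
    then have "expectation (\<lambda>x. \<phi> (Z x) * ?E x) = expectation (\<lambda>x. \<phi> (Z x) * Y x)"
      using int by (intro real_cond_exp_intg(2)) auto
    moreover have "expectation (\<lambda>x. \<phi> (Z x) * ?E x) = expectation (\<lambda>x. \<phi> (Z x) * m (Z x))"
      using Em by (intro integral_cong_AE) auto
    ultimately show ?thesis by simp
  qed
  then show ?thesis using Em by (intro that[of m]) (auto simp: m_def)
qed

section \<open>Smoothing with the Dirichlet kernel\<close>

text \<open>Closeness is measured coordinate by coordinate to match the event in
  \<open>dirichlet_kernel_tail\<close>.\<close>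

lemma uniformly_continuous_coordinates:
  fixes u :: "real ^ 'k \<Rightarrow> real"
  assumes "continuous_on prob_simplex u" "b > 0"
  obtains r where "r > 0" "\<And>s t. s \<in> prob_simplex \<Longrightarrow> t \<in> prob_simplex \<Longrightarrow>
    (\<And>j. \<bar>s $ j - t $ j\<bar> \<le> r) \<Longrightarrow> \<bar>u t - u s\<bar> \<le> b"
proof -
  have "uniformly_continuous_on prob_simplex u"
    using compact_uniformly_continuous[OF assms(1) compact_prob_simplex] .
  then obtain d where d: "d > 0" "\<And>s t. s \<in> prob_simplex \<Longrightarrow> t \<in> prob_simplex \<Longrightarrow> dist t s < d \<Longrightarrow> dist (u t) (u s) < b"
    unfolding uniformly_continuous_on_def using \<open>b > 0\<close> by metis
  define r where "r = d / (2 * real CARD('k))"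
  have r: "r > 0" "real CARD('k) * r < d" using d by (simp_all add: r_def)
  show ?thesis
  proof (rule that[OF r(1)])
    fix s t :: "real ^ 'k" assume st: "s \<in> prob_simplex" "t \<in> prob_simplex" "\<And>j. \<bar>s $ j - t $ j\<bar> \<le> r"
    have "norm (t - s) \<le> (\<Sum>k\<in>UNIV. \<bar>(t - s) $ k\<bar>)" by (rule norm_le_l1_cart)
    also have "\<dots> \<le> (\<Sum>k\<in>(UNIV :: 'k set). r)"
      using st(3) by (intro sum_mono) (simp add: abs_minus_commute)
    finally have "dist t s < d" using r(2) by (simp add: dist_norm)
    from d(2)[OF st(1,2) this] show "\<bar>u t - u s\<bar> \<le> b" by (simp add: dist_real_def)
  qed
qed

text \<open>Off the tail event the difference is at most \<open>b\<close> and the kernel has total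
  mass 1; on it the difference is at most 1 and Chebyshev bounds the mass.\<close>

lemma dirichlet_kernel_oscillation:
  fixes u :: "real ^ 'k \<Rightarrow> real" and h :: real
  assumes h: "h > 0" "h \<le> 1" and t: "t \<in> prob_simplex" and r: "r > 0" and b: "b \<ge> 0"
    and meas [measurable]: "u \<in> borel_measurable borel" and u01: "\<And>s. u s \<in> {0..1}"
    and osc: "\<And>s t. s \<in> prob_simplex \<Longrightarrow> t \<in> prob_simplex \<Longrightarrow>
      (\<And>j. \<bar>s $ j - t $ j\<bar> \<le> r) \<Longrightarrow> \<bar>u t - u s\<bar> \<le> b"
  shows "(\<integral>s. dirichlet_kernel h s t * \<bar>u t - u s\<bar> \<partial>simplex_lebesgue c) \<le>
    b + CARD('k) * (CARD('k) + 1) * h / r\<^sup>2"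
proof -
  let ?L = "simplex_lebesgue c" and ?k = "\<lambda>s. dirichlet_kernel h s t"
  let ?T = "{s. \<exists>j. \<bar>s $ j - t $ j\<bar> > r}"
  note I = dirichlet_kernel_integral[OF h(1) t, of c]
  have k0: "?k s \<ge> 0" for s by (rule dirichlet_kernel_nonneg) fact+
  have T_meas: "(\<lambda>s. indicator ?T s :: real) \<in> borel_measurable ?L"
    by (rule measurable_simplex_lebesgue1) measurable
  have int_T: "integrable ?L (\<lambda>s. ?k s * indicator ?T s)"
    by (rule Bochner_Integration.integrable_bound[OF I(1)])
       (use T_meas k0 in \<open>auto simp: indicator_def\<close>)
  have "(\<integral>s. ?k s * \<bar>u t - u s\<bar> \<partial>?L) \<le> (\<integral>s. b * ?k s + ?k s * indicator ?T s \<partial>?L)"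
  proof (rule integral_mono_AE')
    show "integrable ?L (\<lambda>s. b * ?k s + ?k s * indicator ?T s)"
      by (intro Bochner_Integration.integrable_add integrable_mult_right I int_T)
    show "AE s in ?L. ?k s * \<bar>u t - u s\<bar> \<le> b * ?k s + ?k s * indicator ?T s"
    proof (rule AE_I2)
      fix s assume "s \<in> space ?L"
      then have s: "s \<in> prob_simplex" by simp
      have "\<bar>u t - u s\<bar> \<le> b + indicator ?T s"
      proof (cases "s \<in> ?T")
        case True
        have "\<bar>u t - u s\<bar> \<le> 1" using u01[of t] u01[of s] by auto
        then show ?thesis using True b by simp
      next
        case False
        then have "\<bar>u t - u s\<bar> \<le> b" by (intro osc s t) (auto simp: not_less)
        then show ?thesis using False by simp
      qed
      from mult_left_mono[OF this k0[of s]]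
      show "?k s * \<bar>u t - u s\<bar> \<le> b * ?k s + ?k s * indicator ?T s" by (simp add: algebra_simps)
    qed
    show "AE s in ?L. 0 \<le> b * ?k s + ?k s * indicator ?T s" using k0 b by (simp add: indicator_def)
  qed
  also have "\<dots> = b * (\<integral>s. ?k s \<partial>?L) + (\<integral>s. ?k s * indicator ?T s \<partial>?L)"
    using I int_T by simp
  also have "\<dots> \<le> b * 1 + CARD('k) * (CARD('k) + 1) * h / r\<^sup>2"
    using I dirichlet_kernel_tail[OF h t r, of c] by simp
  finally show ?thesis by simp
qed

context
  fixes c :: "'k :: finite" and g :: "real ^ 'k \<Rightarrow> real"
  assumes g_cont: "continuous_on prob_simplex g"
    and g_nonneg: "\<And>s. s \<in> prob_simplex \<Longrightarrow> g s \<ge> 0"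
begin

text \<open>The population counterpart of a leave-one-out sum. The integration runs over the
  parameter \<open>t\<close>, where the kernel need not have mass 1, so
  \<open>smoothed h (\<lambda>_. 1)\<close> acts as the normalisation.\<close>

definition smoothed :: "real \<Rightarrow> (real ^ 'k \<Rightarrow> real) \<Rightarrow> real ^ 'k \<Rightarrow> real"
  where "smoothed h \<phi> s = (\<integral>t. dirichlet_kernel h s t * (\<phi> t * g t) \<partial>simplex_lebesgue c)"

lemma density_measurable [measurable]: "g \<in> borel_measurable (simplex_lebesgue c)"
  unfolding measurable_cong_sets[OF sets_simplex_lebesgue refl]
  by (rule borel_measurable_continuous_on_restrict[OF g_cont])

lemma density_bound: obtains G where "G > 0" "\<And>s. s \<in> prob_simplex \<Longrightarrow> g s \<le> G"
proof -
  obtain G where G: "\<And>t. t \<in> prob_simplex \<Longrightarrow> \<bar>g t\<bar> \<le> G"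
    using compact_imp_bounded[OF compact_continuous_image[OF g_cont compact_prob_simplex]]
    by (auto simp: bounded_iff)
  show ?thesis
  proof (rule that[of "\<bar>G\<bar> + 1"])
    show "g s \<le> \<bar>G\<bar> + 1" if "s \<in> prob_simplex" for s using G[OF that] by linarith
  qed simp
qed

lemma integrable_kernel_density:
  assumes h: "h > 0" and s: "s \<in> prob_simplex"
    and [measurable]: "\<phi> \<in> borel_measurable (simplex_lebesgue c)" and \<phi>: "\<And>t. t \<in> prob_simplex \<Longrightarrow> \<bar>\<phi> t\<bar> \<le> 1"
  shows "integrable (simplex_lebesgue c) (\<lambda>t. dirichlet_kernel h s t * (\<phi> t * g t))"
proof -
  obtain G where G: "G > 0" "\<And>s. s \<in> prob_simplex \<Longrightarrow> g s \<le> G" using density_bound by blast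
  show ?thesis
  proof (rule integrable_dirichlet_kernel_right[OF h s, where G="1 * G"])
    show "\<bar>\<phi> t * g t\<bar> \<le> 1 * G" if "t \<in> prob_simplex" for t
      unfolding abs_mult using that \<phi> G g_nonneg by (intro mult_mono) auto
  qed measurable
qed

lemma smoothed_measurable [measurable]:
  assumes h: "h > 0" and [measurable]: "\<phi> \<in> borel_measurable (simplex_lebesgue c)"
  shows "smoothed h \<phi> \<in> borel_measurable (simplex_lebesgue c)"
proof -
  interpret finite_measure "simplex_lebesgue c" by (rule finite_measure_simplex_lebesgue)
  note [measurable] = dirichlet_kernel_measurable_pair[OF h, of c]
  show ?thesis unfolding smoothed_def by measurable
qed

lemma smoothed_ratio:
  assumes h: "h > 0" and s: "s \<in> prob_simplex"
    and [measurable]: "\<phi> \<in> borel_measurable (simplex_lebesgue c)" and \<phi>: "\<And>t. t \<in> prob_simplex \<Longrightarrow> \<phi> t \<in> {0..1}"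
  shows "0 \<le> smoothed h \<phi> s" "smoothed h \<phi> s \<le> smoothed h (\<lambda>_. 1) s"
proof -
  have k0: "dirichlet_kernel h s t \<ge> 0" if "t \<in> prob_simplex" for t
    by (rule dirichlet_kernel_nonneg) fact+
  show "0 \<le> smoothed h \<phi> s"
    unfolding smoothed_def using k0 \<phi> g_nonneg by (intro integral_nonneg_AE AE_I2) auto
  show "smoothed h \<phi> s \<le> smoothed h (\<lambda>_. 1) s"
    unfolding smoothed_def
  proof (rule integral_mono)
    show "integrable (simplex_lebesgue c) (\<lambda>t. dirichlet_kernel h s t * (\<phi> t * g t))"
      using \<phi> by (intro integrable_kernel_density h s) auto
    show "integrable (simplex_lebesgue c) (\<lambda>t. dirichlet_kernel h s t * (1 * g t))"
      by (intro integrable_kernel_density h s) auto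
    show "dirichlet_kernel h s t * (\<phi> t * g t) \<le> dirichlet_kernel h s t * (1 * g t)"
      if "t \<in> space (simplex_lebesgue c)" for t
      using that \<phi>[of t] g_nonneg[of t] k0[of t] by (intro mult_left_mono mult_right_mono) auto
  qed
qed

text \<open>The kernel is strictly positive at interior points, so a vanishing integral would force
  \<open>g\<close> to vanish almost everywhere. This makes the limit denominators nonzero for each
  single \<open>h\<close>, without uniformity.\<close>

lemma smoothed_density_pos:
  assumes h: "h > 0" and s: "s \<in> prob_simplex" "\<And>k. s $ k > 0"
    and nz: "\<not> (AE t in simplex_lebesgue c. g t = 0)"
  shows "smoothed h (\<lambda>_. 1) s > 0"
proof -
  have k: "dirichlet_kernel h s t > 0" if "t \<in> prob_simplex" for t
    using dirichlet_kernel_pos[OF h that s(2)] .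
  have nn: "AE t in simplex_lebesgue c. 0 \<le> dirichlet_kernel h s t * (1 * g t)"
    using k g_nonneg by (intro AE_I2) (auto simp: less_imp_le)
  have int: "integrable (simplex_lebesgue c) (\<lambda>t. dirichlet_kernel h s t * (1 * g t))"
    by (intro integrable_kernel_density h s) auto
  have "smoothed h (\<lambda>_. 1) s \<noteq> 0"
  proof
    assume "smoothed h (\<lambda>_. 1) s = 0"
    then have "AE t in simplex_lebesgue c. dirichlet_kernel h s t * (1 * g t) = 0"
      using integral_nonneg_eq_0_iff_AE[OF int nn] by (simp add: smoothed_def)
    then have "AE t in simplex_lebesgue c. g t = 0"
      using AE_space by eventually_elim (use k in force)
    then show False using nz by contradiction
  qed
  moreover have "smoothed h (\<lambda>_. 1) s \<ge> 0" by (rule smoothed_ratio[OF h s(1)]) auto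
  ultimately show ?thesis by simp
qed

text \<open>An argument in the manner of Egorov: the constants of
  \<open>smoothed_density_lower_bound\<close> depend on \<open>s\<close>, and dominated convergence
  makes them uniform outside a set of small mass. Points with \<open>g s = 0\<close> contribute
  nothing to the integral.\<close>

lemma smoothed_density_eventually_large:
  fixes h :: "nat \<Rightarrow> real"
  assumes h: "\<And>n. h n > 0" "h \<longlonglongrightarrow> 0" and "e > 0"
  obtains d N where "d > 0" "\<And>n. n \<ge> N \<Longrightarrow>
    (\<integral>s. indicator {s. smoothed (h n) (\<lambda>_. 1) s < d} s * g s \<partial>simplex_lebesgue c) \<le> e"
proof -
  interpret finite_measure "simplex_lebesgue c" by (rule finite_measure_simplex_lebesgue)
  obtain G where G: "G > 0" "\<And>s. s \<in> prob_simplex \<Longrightarrow> g s \<le> G" using density_bound by blast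
  let ?D = "\<lambda>n s. smoothed (h n) (\<lambda>_. 1) s"
  have D_meas [measurable]: "?D n \<in> borel_measurable (simplex_lebesgue c)" for n
    using smoothed_measurable[OF h(1)[of n]] by simp
  \<comment> \<open>One index serves both as threshold and as starting time, so a single limit takes
    care of both constants that depend on \<open>s\<close>.\<close>
  define E where "E j = {s \<in> space (simplex_lebesgue c). \<exists>n\<ge>j. ?D n s < 1 / real (Suc j)}" for j
  have E_sets [measurable]: "E j \<in> sets (simplex_lebesgue c)" for j unfolding E_def by measurable
  have "(\<lambda>j. \<integral>s. indicator (E j) s * g s \<partial>simplex_lebesgue c) \<longlonglongrightarrow> (\<integral>s. 0 \<partial>simplex_lebesgue c)"
  proof (rule integral_dominated_convergence[where w="\<lambda>_. G"])
    show "AE s in simplex_lebesgue c. norm (indicator (E j) s * g s) \<le> G" for j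
      using G g_nonneg by (intro AE_I2) (auto simp: indicator_def)
    show "AE s in simplex_lebesgue c. (\<lambda>j. indicator (E j) s * g s) \<longlonglongrightarrow> 0"
      using AE_simplex_lebesgue_pos AE_space
    proof eventually_elim
      case (elim s)
      then have s: "s \<in> prob_simplex" by simp
      show ?case
      proof (cases "g s = 0")
        case False
        then have "g s > 0" using g_nonneg[OF s] by simp
        then obtain d h\<^sub>0 where d: "d > 0" "h\<^sub>0 > 0"
          "\<And>h. 0 < h \<Longrightarrow> h \<le> h\<^sub>0 \<Longrightarrow> d \<le> (\<integral>t. dirichlet_kernel h s t * g t \<partial>simplex_lebesgue c)"
          using smoothed_density_lower_bound[of s g c] s elim g_cont g_nonneg by blast
        have "eventually (\<lambda>n. h n < h\<^sub>0) sequentially" using h(2) d(2) by (rule order_tendstoD)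
        then obtain n0 where n0: "\<And>n. n \<ge> n0 \<Longrightarrow> h n < h\<^sub>0" by (auto simp: eventually_sequentially)
        obtain j0 where j0: "1 / real (Suc j0) < d"
          using reals_Archimedean[OF d(1)] by (auto simp: inverse_eq_divide)
        have "eventually (\<lambda>j. indicator (E j) s * g s = 0) sequentially"
          using eventually_ge_at_top[of "max n0 j0"]
        proof eventually_elim
          case (elim j)
          have "1 / real (Suc j) \<le> 1 / real (Suc j0)" using elim by (simp add: frac_le)
          then have "\<not> ?D n s < 1 / real (Suc j)" if "n \<ge> j" for n
            using d(3)[OF h(1)[of n]] n0[of n] that elim j0 by (simp add: smoothed_def)
          then show ?case by (auto simp: E_def indicator_def)
        qed
        then show ?thesis by (rule tendsto_eventually)
      qed simp
    qed
  qed auto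
  then have "eventually (\<lambda>j. (\<integral>s. indicator (E j) s * g s \<partial>simplex_lebesgue c) < e) sequentially"
    using \<open>e > 0\<close> by (intro order_tendstoD) auto
  then obtain j where j: "(\<integral>s. indicator (E j) s * g s \<partial>simplex_lebesgue c) < e"
    by (auto simp: eventually_sequentially)
  show ?thesis
  proof (rule that[of "1 / real (Suc j)" j])
    fix n assume "n \<ge> j"
    have "(\<integral>s. indicator {s. ?D n s < 1 / real (Suc j)} s * g s \<partial>simplex_lebesgue c) \<le>
        (\<integral>s. indicator (E j) s * g s \<partial>simplex_lebesgue c)"
    proof (rule integral_mono_AE')
      show "integrable (simplex_lebesgue c) (\<lambda>s. indicator (E j) s * g s)"
        using G g_nonneg by (intro integrable_const_bound[where B=G] AE_I2) (auto simp: indicator_def)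
    qed (use g_nonneg \<open>n \<ge> j\<close> in \<open>auto simp: E_def indicator_def intro!: AE_I2\<close>)
    then show "(\<integral>s. indicator {s. ?D n s < 1 / real (Suc j)} s * g s \<partial>simplex_lebesgue c) \<le> e"
      using j by linarith
  qed simp
qed

text \<open>Since \<open>k(s; t)\<close> has integral \<open>1\<close> in \<open>s\<close>, smoothing is an \<open>L\<^sup>1\<close> contraction, so it suffices to
  treat a continuous function close to \<open>m\<close>; the normalisation \<open>smoothed h 1\<close> only
  has to be bounded below outside a set of small mass.\<close>

lemma smoothing_L1:
  fixes h :: "nat \<Rightarrow> real" and m :: "real ^ 'k \<Rightarrow> real"
  assumes h: "\<And>n. h n > 0" "\<And>n. h n \<le> 1" "h \<longlonglongrightarrow> 0"
    and prob: "(\<integral>s. g s \<partial>simplex_lebesgue c) = 1"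
    and m [measurable]: "m \<in> borel_measurable borel" and m01: "\<And>s. m s \<in> {0..1}"
  shows "(\<lambda>n. \<integral>s. \<bar>smoothed (h n) m s / smoothed (h n) (\<lambda>_. 1) s - m s\<bar> * g s \<partial>simplex_lebesgue c) \<longlonglongrightarrow> 0"
proof (rule LIMSEQ_I)
  fix a :: real assume "a > 0"
  define e where "e = a / 3"
  have e: "e > 0" using \<open>a > 0\<close> by (simp add: e_def)
  let ?L = "simplex_lebesgue c"
  interpret finite_measure ?L by (rule finite_measure_simplex_lebesgue)
  interpret LL: pair_sigma_finite ?L ?L ..
  obtain G where G: "G > 0" "\<And>s. s \<in> prob_simplex \<Longrightarrow> g s \<le> G" using density_bound by blast
  let ?D = "\<lambda>n s. smoothed (h n) (\<lambda>_. 1) s" and ?N = "\<lambda>n s. smoothed (h n) m s"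
  have [measurable]: "m \<in> borel_measurable ?L" by (rule measurable_simplex_lebesgue1) fact
  have D_meas [measurable]: "?D n \<in> borel_measurable ?L" for n using smoothed_measurable[OF h(1)[of n]] by simp
  have N_meas [measurable]: "?N n \<in> borel_measurable ?L" for n using smoothed_measurable[OF h(1)[of n]] by simp
  obtain d N1 where d: "d > 0" "\<And>n. n \<ge> N1 \<Longrightarrow>
    (\<integral>s. indicator {s. ?D n s < d} s * g s \<partial>?L) \<le> e"
    using smoothed_density_eventually_large[of h e] h e by blast
  \<comment> \<open>Chosen so that the terms \<open>b + G / d * (3 * b)\<close> of the final
    estimate add up to exactly \<open>e\<close>.\<close>
  define b where "b = e / (1 + 3 * G / d)"
  have b: "b > 0" unfolding b_def using e G d by (intro divide_pos_pos add_pos_nonneg) auto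
  have int_g: "integrable ?L g"
    using G g_nonneg by (intro integrable_const_bound[where B=G] AE_I2) auto
  \<comment> \<open>The approximation lemma is about Borel measures on the whole Euclidean space;
    \<open>distr\<close> along the identity transports the law there.\<close>
  define \<mu> where "\<mu> = distr (density ?L (\<lambda>s. ennreal (g s))) borel (\<lambda>s. s)"
  have id_meas [measurable]: "(\<lambda>s. s) \<in> ?L \<rightarrow>\<^sub>M borel"
    unfolding measurable_cong_sets[OF sets_simplex_lebesgue refl] by (rule measurable_restrict_space1) simp
  have "prob_space (density ?L (\<lambda>s. ennreal (g s)))"
  proof (rule prob_spaceI)
    have "(\<integral>\<^sup>+s. ennreal (g s) \<partial>?L) = ennreal (\<integral>s. g s \<partial>?L)"
      using int_g g_nonneg by (intro nn_integral_eq_integral AE_I2) auto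
    moreover have "emeasure (density ?L (\<lambda>s. ennreal (g s))) (space ?L) =
        (\<integral>\<^sup>+s. ennreal (g s) * indicator (space ?L) s \<partial>?L)"
      by (rule emeasure_density[OF _ sets.top]) auto
    moreover have "\<dots> = (\<integral>\<^sup>+s. ennreal (g s) \<partial>?L)"
      by (rule nn_integral_cong) simp
    ultimately show "emeasure (density ?L (\<lambda>s. ennreal (g s))) (space (density ?L (\<lambda>s. ennreal (g s)))) = 1"
      using prob by simp
  qed
  then have "prob_space \<mu>" unfolding \<mu>_def by (rule prob_space.prob_space_distr) simp
  moreover have "sets \<mu> = sets borel" by (simp add: \<mu>_def)
  ultimately obtain u where u: "continuous_on UNIV u" "range u \<subseteq> {0..1}" "(\<integral>x. \<bar>m x - u x\<bar> \<partial>\<mu>) \<le> b"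
    using L1_continuous_approx[of \<mu> m b] m m01 b by blast
  have u01: "u x \<in> {0..1}" for x using u(2) by (rule subsetD) simp
  have u_meas [measurable]: "u \<in> borel_measurable borel" using u(1) by (rule borel_measurable_continuous_onI)
  have [measurable]: "u \<in> borel_measurable ?L" by (rule measurable_simplex_lebesgue1) fact
  have mu: "(\<integral>s. \<bar>m s - u s\<bar> * g s \<partial>?L) \<le> b"
  proof -
    have "(\<integral>x. \<bar>m x - u x\<bar> \<partial>\<mu>) = (\<integral>x. \<bar>m x - u x\<bar> \<partial>density ?L (\<lambda>s. ennreal (g s)))"
      unfolding \<mu>_def by (rule integral_distr) auto
    also have "\<dots> = (\<integral>s. g s *\<^sub>R \<bar>m s - u s\<bar> \<partial>?L)"
      using g_nonneg by (intro integral_density) auto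
    finally show ?thesis using u(3) by (simp add: mult.commute)
  qed
  have int_mu: "integrable ?L (\<lambda>s. \<bar>m s - u s\<bar> * g s)"
  proof (rule Bochner_Integration.integrable_bound[OF int_g])
    show "AE s in ?L. norm (\<bar>m s - u s\<bar> * g s) \<le> norm (g s)"
      using abs_diff_le_one[OF m01 u01] by (intro AE_I2) (simp add: abs_mult mult_left_le_one_le)
  qed measurable
  obtain r where r: "r > 0" "\<And>s t. s \<in> prob_simplex \<Longrightarrow> t \<in> prob_simplex \<Longrightarrow>
    (\<And>j. \<bar>s $ j - t $ j\<bar> \<le> r) \<Longrightarrow> \<bar>u t - u s\<bar> \<le> b"
    using uniformly_continuous_coordinates[of u b] continuous_on_subset[OF u(1)] b by blast
  have "(\<lambda>n. CARD('k) * (CARD('k) + 1) * h n / r\<^sup>2) \<longlonglongrightarrow> real (CARD('k) * (CARD('k) + 1)) * 0 / r\<^sup>2"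
    by (rule tendsto_divide[OF tendsto_mult[OF tendsto_const h(3)] tendsto_const]) (use r(1) in simp)
  then have "eventually (\<lambda>n. CARD('k) * (CARD('k) + 1) * h n / r\<^sup>2 < b) sequentially"
    using b by (intro order_tendstoD) auto
  then obtain N2 where N2: "\<And>n. n \<ge> N2 \<Longrightarrow> CARD('k) * (CARD('k) + 1) * h n / r\<^sup>2 < b"
    by (auto simp: eventually_sequentially)
  have le: "(\<integral>s. \<bar>?N n s / ?D n s - m s\<bar> * g s \<partial>?L) \<le> 2 * e" if n: "n \<ge> max N1 N2" for n
  proof -
    let ?k = "\<lambda>s t. dirichlet_kernel (h n) s t"
    obtain B where B: "B > 0" "\<And>(s :: real ^ 'k) t. s \<in> prob_simplex \<Longrightarrow> t \<in> prob_simplex \<Longrightarrow> ?k s t \<le> B"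
      using dirichlet_kernel_bounded[OF h(1)] by blast
    have k0: "?k s t \<ge> 0" if "t \<in> prob_simplex" for s t
      by (rule dirichlet_kernel_nonneg[OF h(1) that])
    note [measurable] = dirichlet_kernel_measurable_pair[OF h(1)[of n], of c]
    let ?f = "\<lambda>s t. ?k s t * (\<bar>m t - u s\<bar> * g t)"
    have f_meas: "(\<lambda>(s, t). ?f s t) \<in> borel_measurable (?L \<Otimes>\<^sub>M ?L)" by measurable
    have f_bnd: "0 \<le> ?f s t" "?f s t \<le> B * (1 * G)" if "s \<in> prob_simplex" "t \<in> prob_simplex" for s t
    proof -
      show "0 \<le> ?f s t" by (intro mult_nonneg_nonneg k0 g_nonneg that abs_ge_zero)
      show "?f s t \<le> B * (1 * G)"
        by (intro mult_mono B(2) G(2) abs_diff_le_one m01 u01 k0 g_nonneg that mult_nonneg_nonneg abs_ge_zero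
            less_imp_le[OF B(1)] zero_le_one)
    qed
    have int_f: "integrable (?L \<Otimes>\<^sub>M ?L) (\<lambda>(s, t). ?f s t)"
    proof (rule finite_measure.integrable_const_bound[where B="B * (1 * G)"])
      show "finite_measure (?L \<Otimes>\<^sub>M ?L)"
        by (intro finite_measure_pair_measure finite_measure_simplex_lebesgue)
      show "AE x in ?L \<Otimes>\<^sub>M ?L. norm ((\<lambda>(s, t). ?f s t) x) \<le> B * (1 * G)"
        by (rule AE_I2) (use f_bnd in \<open>auto simp: space_pair_measure simp del: mult_1 abs_mult\<close>)
    qed (rule f_meas)
    \<comment> \<open>\<open>E\<close> compares \<open>m\<close> at \<open>t\<close> with
      \<open>u\<close> at \<open>s\<close>. It dominates the distance between the numerator and
      \<open>u s\<close> times the denominator, and its integral can be taken over \<open>s\<close>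
      first, where the kernel has mass 1.\<close>
    define E where "E s = (\<integral>t. ?f s t \<partial>?L)" for s
    have int_E: "integrable ?L E" unfolding E_def by (rule LL.integrable_fst[OF int_f])
    have E0: "0 \<le> E s" if "s \<in> prob_simplex" for s
      unfolding E_def using f_bnd that by (intro integral_nonneg_AE AE_I2) auto
    have "(\<integral>s. E s \<partial>?L) = (\<integral>t. (\<integral>s. ?f s t \<partial>?L) \<partial>?L)"
      unfolding E_def by (rule LL.Fubini_integral[OF int_f, symmetric])
    also have "\<dots> \<le> (\<integral>t. \<bar>m t - u t\<bar> * g t + 2 * b * g t \<partial>?L)"
    proof (rule integral_mono)
      show "integrable ?L (\<lambda>t. \<integral>s. ?f s t \<partial>?L)" by (rule LL.integrable_snd[OF int_f])
      show "integrable ?L (\<lambda>t. \<bar>m t - u t\<bar> * g t + 2 * b * g t)"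
        using int_mu int_g by auto
      fix t assume "t \<in> space ?L"
      then have t: "t \<in> prob_simplex" by simp
      note I = dirichlet_kernel_integral[OF h(1)[of n] t, of c]
      have int_k: "integrable ?L (\<lambda>s. ?k s t * \<bar>u t - u s\<bar>)"
      proof (rule Bochner_Integration.integrable_bound[OF I(1)])
        show "AE s in ?L. norm (?k s t * \<bar>u t - u s\<bar>) \<le> norm (?k s t)"
          using abs_diff_le_one[OF u01 u01] k0[OF t] by (intro AE_I2) (simp add: abs_mult mult_left_le)
      qed measurable
      have "(\<integral>s. ?f s t \<partial>?L) \<le> (\<integral>s. (\<bar>m t - u t\<bar> * g t) * ?k s t + g t * (?k s t * \<bar>u t - u s\<bar>) \<partial>?L)"
      proof (rule integral_mono')
        show "integrable ?L (\<lambda>s. (\<bar>m t - u t\<bar> * g t) * ?k s t + g t * (?k s t * \<bar>u t - u s\<bar>))"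
          by (intro Bochner_Integration.integrable_add integrable_mult_right I int_k)
        fix s
        have "\<bar>m t - u s\<bar> \<le> \<bar>m t - u t\<bar> + \<bar>u t - u s\<bar>" by linarith
        from mult_left_mono[OF this, of "?k s t * g t"] k0[OF t, of s] g_nonneg[OF t]
        show "?f s t \<le> (\<bar>m t - u t\<bar> * g t) * ?k s t + g t * (?k s t * \<bar>u t - u s\<bar>)"
          by (simp add: algebra_simps)
        show "0 \<le> (\<bar>m t - u t\<bar> * g t) * ?k s t + g t * (?k s t * \<bar>u t - u s\<bar>)"
          using k0[OF t, of s] g_nonneg[OF t] by simp
      qed
      also have "\<dots> = (\<bar>m t - u t\<bar> * g t) * (\<integral>s. ?k s t \<partial>?L) + g t * (\<integral>s. ?k s t * \<bar>u t - u s\<bar> \<partial>?L)"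
        using I int_k by (subst Bochner_Integration.integral_add) auto
      \<comment> \<open>One \<open>b\<close> is the oscillation of \<open>u\<close> near
        \<open>t\<close>, the other the tail term, which is below \<open>b\<close> since
        \<open>n \<ge> N2\<close>.\<close>
      also have "\<dots> \<le> (\<bar>m t - u t\<bar> * g t) * 1 + g t * (b + b)"
      proof (intro add_mono mult_left_mono)
        have "(\<integral>s. ?k s t * \<bar>u t - u s\<bar> \<partial>?L) \<le> b + CARD('k) * (CARD('k) + 1) * h n / r\<^sup>2"
          using h r b t u01 by (intro dirichlet_kernel_oscillation u_meas) (auto simp del: atLeastAtMost_iff)
        then show "(\<integral>s. ?k s t * \<bar>u t - u s\<bar> \<partial>?L) \<le> b + b" using N2[of n] n by linarith
      qed (use I g_nonneg[OF t] in auto)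
      finally show "(\<integral>s. ?f s t \<partial>?L) \<le> \<bar>m t - u t\<bar> * g t + 2 * b * g t"
        by (simp only: mult_1_right mult_2 distrib_right distrib_left mult.commute[of "g t"])
    qed
    also have "\<dots> = (\<integral>t. \<bar>m t - u t\<bar> * g t \<partial>?L) + 2 * b * (\<integral>t. g t \<partial>?L)"
      using int_mu int_g by simp
    also have "\<dots> \<le> 3 * b" using mu prob by simp
    finally have E: "(\<integral>s. E s \<partial>?L) \<le> 3 * b" .
    let ?I = "\<lambda>s. indicator {s. ?D n s < d} s * g s"
    have int_I: "integrable ?L ?I"
    proof (rule Bochner_Integration.integrable_bound[OF int_g])
      have "(\<lambda>s. indicator {s \<in> space ?L. ?D n s < d} s * g s) \<in> borel_measurable ?L" by measurable
      moreover have "?I \<in> borel_measurable ?L \<longleftrightarrow> (\<lambda>s. indicator {s \<in> space ?L. ?D n s < d} s * g s) \<in> borel_measurable ?L"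
        by (rule measurable_cong) (simp add: indicator_def)
      ultimately show "?I \<in> borel_measurable ?L" by simp
    qed (auto simp: indicator_def)
    have pw: "\<bar>?N n s / ?D n s - m s\<bar> * g s \<le> ?I s + (\<bar>m s - u s\<bar> * g s + G / d * E s)"
      if s: "s \<in> prob_simplex" for s
    proof -
      have ND: "0 \<le> ?N n s" "?N n s \<le> ?D n s"
        using smoothed_ratio[OF h(1)[of n] s, of m] m01 by auto
      have pos: "0 \<le> \<bar>m s - u s\<bar> * g s" "0 \<le> G / d * E s"
        using g_nonneg[OF s] E0[OF s] G d by auto
      show ?thesis
      proof (cases "?D n s < d")
        case True
        have "\<bar>?N n s / ?D n s - m s\<bar> * g s \<le> 1 * g s"
          using g_nonneg[OF s] by (intro mult_right_mono abs_diff_le_one ratio_in_unit ND m01)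
        then show ?thesis using True pos by simp
      next
        case False
        then have D: "?D n s > 0" "d \<le> ?D n s" using d by auto
        have i1: "integrable ?L (\<lambda>t. ?k s t * (m t * g t))"
          using m01 abs_diff_le_one[OF m01, of 0] by (intro integrable_kernel_density h s) auto
        have i2: "integrable ?L (\<lambda>t. ?k s t * (1 * g t))"
          by (intro integrable_kernel_density h s) auto
        have "?N n s - u s * ?D n s = (\<integral>t. ?k s t * (m t * g t) - u s * (?k s t * (1 * g t)) \<partial>?L)"
          unfolding smoothed_def
          by (subst Bochner_Integration.integral_diff[OF i1 integrable_mult_right[OF i2]]) simp
        also have "\<bar>\<dots>\<bar> \<le> (\<integral>t. \<bar>?k s t * (m t * g t) - u s * (?k s t * (1 * g t))\<bar> \<partial>?L)"
          by (rule integral_abs_bound)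
        also have "\<dots> = E s"
          unfolding E_def
        proof (rule Bochner_Integration.integral_cong)
          fix t assume "t \<in> space ?L"
          then have t: "t \<in> prob_simplex" by simp
          have "?k s t * (m t * g t) - u s * (?k s t * (1 * g t)) = (?k s t * g t) * (m t - u s)"
            by (simp add: algebra_simps)
          then show "\<bar>?k s t * (m t * g t) - u s * (?k s t * (1 * g t))\<bar> = ?f s t"
            using k0[OF t, of s] g_nonneg[OF t] by (simp add: abs_mult)
        qed simp
        finally have "\<bar>?N n s - u s * ?D n s\<bar> \<le> E s" .
        then have "\<bar>?N n s - u s * ?D n s\<bar> / ?D n s \<le> E s / d"
          using D d by (intro frac_le) auto
        moreover have "?N n s / ?D n s - u s = (?N n s - u s * ?D n s) / ?D n s"
          using D by (simp add: field_simps)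
        ultimately have "\<bar>?N n s / ?D n s - u s\<bar> \<le> E s / d" using D by (simp add: abs_div)
        then have "\<bar>?N n s / ?D n s - u s\<bar> * g s \<le> E s / d * G"
          using g_nonneg[OF s] G(2)[OF s] E0[OF s] d by (intro mult_mono) auto
        moreover have "\<bar>?N n s / ?D n s - m s\<bar> * g s \<le> (\<bar>?N n s / ?D n s - u s\<bar> + \<bar>m s - u s\<bar>) * g s"
          using g_nonneg[OF s] by (intro mult_right_mono) auto
        ultimately show ?thesis using False by (simp add: algebra_simps)
      qed
    qed
    have "(\<integral>s. \<bar>?N n s / ?D n s - m s\<bar> * g s \<partial>?L) \<le>
        (\<integral>s. ?I s + (\<bar>m s - u s\<bar> * g s + G / d * E s) \<partial>?L)"
    proof (rule integral_mono_AE')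
      show "integrable ?L (\<lambda>s. ?I s + (\<bar>m s - u s\<bar> * g s + G / d * E s))"
        by (intro Bochner_Integration.integrable_add integrable_mult_right int_I int_mu int_E)
      show "AE s in ?L. \<bar>?N n s / ?D n s - m s\<bar> * g s \<le> ?I s + (\<bar>m s - u s\<bar> * g s + G / d * E s)"
        using pw by (intro AE_I2) simp
      show "AE s in ?L. 0 \<le> ?I s + (\<bar>m s - u s\<bar> * g s + G / d * E s)"
        using E0 g_nonneg G d by (intro AE_I2 add_nonneg_nonneg mult_nonneg_nonneg) (auto simp: indicator_def)
    qed
    also have "\<dots> = (\<integral>s. ?I s \<partial>?L) + ((\<integral>s. \<bar>m s - u s\<bar> * g s \<partial>?L) + G / d * (\<integral>s. E s \<partial>?L))"
      using int_I int_mu int_E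
      by (simp add: Bochner_Integration.integral_add Bochner_Integration.integrable_add integrable_mult_right del: times_divide_eq_left)
    also have "\<dots> \<le> e + (b + G / d * (3 * b))"
      using d(2)[of n] n mu E G d by (intro add_mono mult_left_mono) auto
    also have "b + G / d * (3 * b) = b * (1 + 3 * G / d)" by (simp add: algebra_simps)
    also have "\<dots> = e"
    proof -
      have "1 + 3 * G / d > 0" using G d by (intro add_pos_nonneg) auto
      then show ?thesis by (simp add: b_def)
    qed
    finally show ?thesis by simp
  qed
  have nonneg: "0 \<le> (\<integral>s. \<bar>?N n s / ?D n s - m s\<bar> * g s \<partial>?L)" for n
    using g_nonneg by (intro integral_nonneg_AE AE_I2) auto
  have "2 * e < a" using \<open>a > 0\<close> by (simp add: e_def)
  show "\<exists>no. \<forall>n\<ge>no. norm ((\<integral>s. \<bar>?N n s / ?D n s - m s\<bar> * g s \<partial>?L) - 0) < a"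
  proof (intro exI[of _ "max N1 N2"] allI impI)
    fix n assume "max N1 N2 \<le> n"
    from le_less_trans[OF le[OF this] \<open>2 * e < a\<close>]
    show "norm ((\<integral>s. \<bar>?N n s / ?D n s - m s\<bar> * g s \<partial>?L) - 0) < a"
      unfolding diff_0_right real_norm_def abs_of_nonneg[OF nonneg] .
  qed
qed

end

section \<open>Consistency of the calibration error estimator\<close>

lemma lp_norm_powr:
  assumes "p \<ge> 1"
  shows "lp_norm p v powr p = (\<Sum>k\<in>UNIV. \<bar>v $ k\<bar> powr p)"
proof -
  have "(\<Sum>k\<in>UNIV. \<bar>v $ k\<bar> powr p) \<ge> 0" by (intro sum_nonneg) auto
  then show ?thesis using assms by (simp add: lp_norm_def powr_powr)
qed

lemma calibration_estimator_eq:
  assumes "p \<ge> 1"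
  shows "calibration_estimator p h n z l = 1 / real n * (\<Sum>j<n. \<Sum>k\<in>UNIV.
    \<bar>(\<Sum>i\<in>{..<n} - {j}. dirichlet_kernel h (z j) (z i) * l i $ k) /
      (\<Sum>i\<in>{..<n} - {j}. dirichlet_kernel h (z j) (z i)) - z j $ k\<bar> powr p)"
  unfolding calibration_estimator_def lp_norm_powr[OF assms]
  by (simp add: sum_component divide_inverse mult.commute)

text \<open>Each \<open>N\<close> is good from time \<open>b N\<close> on. Taking the largest good
  \<open>N\<close> at time \<open>n\<close> lets the index grow as slowly as the thresholds demand;
  the bandwidth of the theorem is obtained along such an index.\<close>

lemma diagonal_sequence:
  fixes A :: "nat \<Rightarrow> nat \<Rightarrow> bool"
  assumes "\<And>N. eventually (A N) sequentially"
  obtains r where "filterlim r at_top sequentially" "eventually (\<lambda>n. A (r n) n) sequentially"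
proof -
  obtain b where b: "\<And>N n. n \<ge> b N \<Longrightarrow> A N n"
    using assms unfolding eventually_sequentially by metis
  \<comment> \<open>The clause \<open>N \<le> n\<close> bounds the candidates, so that a greatest
    one exists.\<close>
  define P where "P n N \<longleftrightarrow> N \<le> n \<and> b N \<le> n" for n N
  define r where "r n = (if \<exists>N. P n N then Greatest (P n) else 0)" for n
  have r: "P n (r n)" "N \<le> r n" if PN: "P n N" for n N
  proof -
    have bound: "\<And>y. P n y \<Longrightarrow> y \<le> n" by (simp add: P_def)
    have "r n = Greatest (P n)" unfolding r_def by (rule if_P) (use PN in blast)
    with GreatestI_nat[where P="P n", OF PN bound] Greatest_le_nat[where P="P n", OF PN bound]
    show "P n (r n)" "N \<le> r n" by simp_all
  qed
  show ?thesis
  proof (rule that)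
    show "filterlim r at_top sequentially"
      unfolding filterlim_at_top
    proof
      fix N
      show "eventually (\<lambda>n. N \<le> r n) sequentially"
        using eventually_ge_at_top[of "max N (b N)"] by eventually_elim (rule r(2), auto simp: P_def)
    qed
    show "eventually (\<lambda>n. A (r n) n) sequentially"
      using eventually_ge_at_top[of "b 0"]
    proof eventually_elim
      case (elim n)
      then have "P n (r n)" by (intro r(1)[of n 0]) (simp add: P_def)
      then show ?case by (intro b) (simp add: P_def)
    qed
  qed
qed

text \<open>Markov's inequality, with room for a modification \<open>U\<close>: bounds for the
  estimator itself are at hand only where the labels are one-hot, which holds almost surely.\<close>

lemma (in prob_space) tendsto_in_prob_L1:
  fixes V U :: "nat \<Rightarrow> 'a \<Rightarrow> real"
  assumes V: "\<And>n. V n \<in> borel_measurable M" and U: "\<And>n. integrable M (U n)"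
    and eq: "\<And>n. AE x in M. V n x = U n x"
    and lim: "(\<lambda>n. expectation (\<lambda>x. \<bar>U n x - c\<bar>)) \<longlonglongrightarrow> 0"
  shows "tendsto_in_prob M V c"
  unfolding tendsto_in_prob_def
proof (intro conjI allI impI V)
  fix \<epsilon> :: real assume \<epsilon>: "\<epsilon> > 0"
  note [measurable] = V borel_measurable_integrable[OF U]
  have le: "prob {x \<in> space M. \<bar>V n x - c\<bar> > \<epsilon>} \<le> expectation (\<lambda>x. \<bar>U n x - c\<bar>) / \<epsilon>" for n
  proof -
    have "prob {x \<in> space M. \<bar>V n x - c\<bar> > \<epsilon>} \<le> prob {x \<in> space M. \<epsilon> \<le> \<bar>U n x - c\<bar>}"
      using eq[of n] by (intro finite_measure_mono_AE) auto
    also have "\<dots> \<le> expectation (\<lambda>x. \<bar>U n x - c\<bar>) / \<epsilon>"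
      using U \<epsilon> by (intro integral_Markov_inequality_measure[where A="{}"]) auto
    finally show ?thesis .
  qed
  have lim': "(\<lambda>n. expectation (\<lambda>x. \<bar>U n x - c\<bar>) / \<epsilon>) \<longlonglongrightarrow> 0"
    using tendsto_divide[OF lim tendsto_const[of \<epsilon>]] \<epsilon> by simp
  show "(\<lambda>n. prob {x \<in> space M. \<bar>V n x - c\<bar> > \<epsilon>}) \<longlonglongrightarrow> 0"
  proof (rule tendsto_sandwich[OF _ _ tendsto_const lim'])
    show "eventually (\<lambda>n. 0 \<le> prob {x \<in> space M. \<bar>V n x - c\<bar> > \<epsilon>}) sequentially" by simp
    show "eventually (\<lambda>n. prob {x \<in> space M. \<bar>V n x - c\<bar> > \<epsilon>} \<le>
        expectation (\<lambda>x. \<bar>U n x - c\<bar>) / \<epsilon>) sequentially"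
      by (intro always_eventually allI le)
  qed
qed

theorem proposition3p5:
  fixes M :: "'a measure"
    and x :: "'a \<Rightarrow> real ^ 'd"
    and y :: "'a \<Rightarrow> real ^ 'k"
    and f :: "real ^ 'd \<Rightarrow> real ^ 'k"
    and c :: 'k
    and g :: "real ^ 'k \<Rightarrow> real"
    and L p :: real
  assumes "prob_space M"
    and "CARD('k) \<ge> 2"
    and "x \<in> M \<rightarrow>\<^sub>M borel"
    and "y \<in> M \<rightarrow>\<^sub>M borel"
    and "\<And>\<omega>. \<omega> \<in> space M \<Longrightarrow> y \<omega> \<in> range (\<lambda>k. axis k 1)"
    and "f \<in> borel \<rightarrow>\<^sub>M restrict_space borel prob_simplex"
    and "p \<ge> 1"
    and "distributed M (simplex_lebesgue c) (\<lambda>\<omega>. f (x \<omega>)) (\<lambda>s. ennreal (g s))"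
    and "\<And>s. s \<in> prob_simplex \<Longrightarrow> g s \<ge> 0"
    and "L-lipschitz_on prob_simplex g"
  shows "\<exists>h :: nat \<Rightarrow> real. (\<forall>n. h n > 0) \<and> h \<longlonglongrightarrow> 0 \<and>
    (\<forall>X Y. iid_copies M (\<lambda>\<omega>. (x \<omega>, y \<omega>)) (\<lambda>i \<omega>. (X i \<omega>, Y i \<omega>)) \<longrightarrow>
      tendsto_in_prob M
        (\<lambda>n \<omega>. calibration_estimator p (h n) n (\<lambda>i. f (X i \<omega>)) (\<lambda>i. Y i \<omega>))
        (prob_space.expectation M
          (\<lambda>\<omega>. lp_norm p (vec_cond_exp M (\<lambda>\<omega>. f (x \<omega>)) y \<omega> - f (x \<omega>)) powr p)))"
proof -
  interpret prob_space M by fact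
  note x [measurable] = assms(3) and y [measurable] = assms(4) and p = assms(7)
  let ?L = "simplex_lebesgue c"
  have g_cont: "continuous_on prob_simplex g" using assms(10) by (rule lipschitz_on_continuous_on)
  note g_nonneg = assms(9)
  note smoothing = smoothed_measurable[OF g_cont g_nonneg] smoothed_ratio[OF g_cont g_nonneg]
  have g_meas [measurable]: "g \<in> borel_measurable ?L"
    using density_measurable[OF g_cont g_nonneg] by simp
  let ?S = "smoothed c g"
  define Z where "Z \<omega> = f (x \<omega>)" for \<omega>
  have f_L [measurable]: "f \<in> borel \<rightarrow>\<^sub>M ?L"
    using assms(6) by (simp only: measurable_cong_sets[OF refl sets_simplex_lebesgue])
  have Z_L [measurable]: "Z \<in> M \<rightarrow>\<^sub>M ?L" unfolding Z_def by measurable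
  have id_L [measurable]: "(\<lambda>s. s) \<in> ?L \<rightarrow>\<^sub>M borel"
    unfolding measurable_cong_sets[OF sets_simplex_lebesgue refl] by (rule measurable_restrict_space1) simp
  have Z_borel [measurable]: "Z \<in> M \<rightarrow>\<^sub>M borel" using measurable_compose[OF Z_L id_L] .
  have Z_simplex: "Z \<omega> \<in> prob_simplex" if "\<omega> \<in> space M" for \<omega>
    using measurable_space[OF Z_L that] by simp
  have law_Z: "distr M ?L Z = density ?L (\<lambda>s. ennreal (g s))"
    using assms(8) unfolding distributed_def Z_def by simp
  have E_Z: "expectation (\<lambda>\<omega>. F (Z \<omega>)) = (\<integral>s. F s * g s \<partial>?L)" if [measurable]: "F \<in> borel_measurable ?L" for F :: "real ^ 'k \<Rightarrow> real"
  proof -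
    have "expectation (\<lambda>\<omega>. F (Z \<omega>)) = (\<integral>s. F s \<partial>density ?L (\<lambda>s. ennreal (g s)))"
      unfolding law_Z[symmetric] by (rule integral_distr[symmetric]) measurable
    also have "\<dots> = (\<integral>s. g s *\<^sub>R F s \<partial>?L)"
      using g_nonneg by (intro integral_density) auto
    finally show ?thesis by (simp add: mult.commute)
  qed
  have g_prob: "(\<integral>s. g s \<partial>?L) = 1" using E_Z[of "\<lambda>_. 1"] by (simp add: prob_space)
  have Z_pos: "AE \<omega> in M. \<forall>k. Z \<omega> $ k > 0"
  proof -
    have "AE s in density ?L (\<lambda>s. ennreal (g s)). \<forall>k. s $ k > 0"
      using AE_simplex_lebesgue_pos[of c] by (subst AE_density) auto
    then have "AE s in distr M ?L Z. \<forall>k. s $ k > 0" by (simp only: law_Z)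
    then show ?thesis by (rule AE_distrD[OF Z_L])
  qed
  have g_nz: "\<not> (AE t in ?L. g t = 0)"
  proof
    assume "AE t in ?L. g t = 0"
    then have "(\<integral>s. g s \<partial>?L) = (\<integral>s. 0 \<partial>?L)" by (intro integral_cong_AE) auto
    then show False using g_prob by simp
  qed

  have nth_borel [measurable]: "(\<lambda>s :: real ^ 'k. s $ k) \<in> borel_measurable borel" for k
    by (intro borel_measurable_continuous_onI continuous_intros)
  have y_nth [measurable]: "(\<lambda>\<omega>. y \<omega> $ k) \<in> borel_measurable M" for k
    using measurable_compose[OF y nth_borel] .
  have y01: "y \<omega> $ k \<in> {0..1}" if "\<omega> \<in> space M" for k \<omega>
    using assms(5)[OF that] by (auto simp: axis_def)
  let ?reg = "\<lambda>k m. m \<in> borel_measurable borel \<and> (\<forall>z. m z \<in> {0..1}) \<and>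
    (AE \<omega> in M. real_cond_exp M (vimage_algebra (space M) Z borel) (\<lambda>\<omega>. y \<omega> $ k) \<omega> = m (Z \<omega>)) \<and>
    (\<forall>\<phi>. \<phi> \<in> borel_measurable borel \<longrightarrow> integrable M (\<lambda>\<omega>. \<phi> (Z \<omega>) * y \<omega> $ k) \<longrightarrow>
      expectation (\<lambda>\<omega>. \<phi> (Z \<omega>) * y \<omega> $ k) = expectation (\<lambda>\<omega>. \<phi> (Z \<omega>) * m (Z \<omega>)))"
  have "\<exists>m. ?reg k m" for k
    by (rule regression_function[OF Z_borel y_nth y01]) (assumption, blast)
  then have "\<forall>k. \<exists>m. ?reg k m" ..
  from choice[OF this] obtain m where reg: "\<forall>k. ?reg k (m k)" ..
  have m [measurable]: "m k \<in> borel_measurable borel" and m01: "m k z \<in> {0..1}"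
    and cond: "AE \<omega> in M. real_cond_exp M (vimage_algebra (space M) Z borel) (\<lambda>\<omega>. y \<omega> $ k) \<omega> = m k (Z \<omega>)"
    for k z
    using reg[rule_format, of k] by blast+
  have E_m: "expectation (\<lambda>\<omega>. \<phi> (Z \<omega>) * y \<omega> $ k) = expectation (\<lambda>\<omega>. \<phi> (Z \<omega>) * m k (Z \<omega>))"
    if "\<phi> \<in> borel_measurable borel" "integrable M (\<lambda>\<omega>. \<phi> (Z \<omega>) * y \<omega> $ k)" for k \<phi>
    using reg[rule_format, of k] that by blast
  have m_L [measurable]: "m k \<in> borel_measurable ?L" for k by (rule measurable_simplex_lebesgue1) measurable

  define T where "T = expectation (\<lambda>\<omega>. lp_norm p (vec_cond_exp M (\<lambda>\<omega>. f (x \<omega>)) y \<omega> - f (x \<omega>)) powr p)"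
  have T: "T = expectation (\<lambda>\<omega>. \<Sum>k\<in>UNIV. \<bar>m k (Z \<omega>) - Z \<omega> $ k\<bar> powr p)"
  proof -
    have "AE \<omega> in M. \<forall>k. real_cond_exp M (vimage_algebra (space M) Z borel) (\<lambda>\<omega>. y \<omega> $ k) \<omega> = m k (Z \<omega>)"
      using cond by (simp add: AE_all_countable)
    then have eq: "AE \<omega> in M. lp_norm p (vec_cond_exp M Z y \<omega> - Z \<omega>) powr p = (\<Sum>k\<in>UNIV. \<bar>m k (Z \<omega>) - Z \<omega> $ k\<bar> powr p)"
      by eventually_elim (simp add: lp_norm_powr[OF p] vec_cond_exp_def)
    have [measurable]: "real_cond_exp M (vimage_algebra (space M) Z borel) u \<in> borel_measurable M" for u
      using borel_measurable_cond_exp2 by blast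
    have "expectation (\<lambda>\<omega>. lp_norm p (vec_cond_exp M Z y \<omega> - Z \<omega>) powr p) =
        expectation (\<lambda>\<omega>. \<Sum>k\<in>UNIV. \<bar>m k (Z \<omega>) - Z \<omega> $ k\<bar> powr p)"
    proof (rule integral_cong_AE[OF _ _ eq])
      show "(\<lambda>\<omega>. lp_norm p (vec_cond_exp M Z y \<omega> - Z \<omega>) powr p) \<in> borel_measurable M"
        unfolding lp_norm_powr[OF p] by (simp add: vec_cond_exp_def)
    qed measurable
    then show ?thesis by (simp add: T_def Z_def[abs_def])
  qed

  define \<nu> where "\<nu> = distr M (?L \<Otimes>\<^sub>M borel) (\<lambda>\<omega>. (Z \<omega>, y \<omega>))"
  have prob_\<nu>: "prob_space \<nu>" unfolding \<nu>_def by (rule prob_space_distr) measurable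
  interpret law: prob_space \<nu> by (rule prob_\<nu>)
  have sets_\<nu> [measurable_cong]: "sets \<nu> = sets (?L \<Otimes>\<^sub>M borel)" by (simp add: \<nu>_def)
  have space_\<nu>: "space \<nu> = prob_simplex \<times> UNIV" by (simp add: \<nu>_def space_pair_measure)
  have E_\<nu>: "(\<integral>w. F w \<partial>\<nu>) = expectation (\<lambda>\<omega>. F (Z \<omega>, y \<omega>))" if "F \<in> borel_measurable (?L \<Otimes>\<^sub>M borel)"
    for F :: "(real ^ 'k) \<times> (real ^ 'k) \<Rightarrow> real"
    unfolding \<nu>_def using that by (subst integral_distr) auto
  \<comment> \<open>A grid of bandwidths, each of which is first held fixed while the sample grows.
    The sequence of the theorem later moves along this grid at the pace set by
    \<open>r\<close>.\<close>
  define h where "h N = 1 / real (Suc N)" for N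
  have h: "h N > 0" "h N \<le> 1" for N by (simp_all add: h_def)
  have h_lim: "h \<longlonglongrightarrow> 0" unfolding h_def[abs_def] using LIMSEQ_inverse_real_of_nat by (simp add: inverse_eq_divide)
  define \<kappa> where "\<kappa> N = (\<lambda>(w :: (real ^ 'k) \<times> (real ^ 'k), w' :: (real ^ 'k) \<times> (real ^ 'k)). dirichlet_kernel (h N) (fst w) (fst w'))" for N
  \<comment> \<open>In \<open>space \<nu>\<close> the second component is an arbitrary vector. The
    indicator in place of the label coordinate gives \<open>0 \<le> q \<le> \<kappa>\<close> at
    every point, as the plug-in lemmas demand, and coincides with the coordinate for one-hot
    labels.\<close>
  define q where "q N k = (\<lambda>(w, w'). \<kappa> N (w, w') * (if snd w' $ k = 1 then 1 else 0))" for N and k :: 'k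
  have \<kappa>_meas [measurable]: "\<kappa> N \<in> borel_measurable (\<nu> \<Otimes>\<^sub>M \<nu>)" for N
  proof -
    have "(\<lambda>(w, w'). (fst w, fst w')) \<in> \<nu> \<Otimes>\<^sub>M \<nu> \<rightarrow>\<^sub>M ?L \<Otimes>\<^sub>M ?L" by measurable
    from measurable_compose[OF this dirichlet_kernel_measurable_pair[OF h(1)[of N], of c]]
    show ?thesis by (simp add: \<kappa>_def case_prod_unfold)
  qed
  have q_meas [measurable]: "q N k \<in> borel_measurable (\<nu> \<Otimes>\<^sub>M \<nu>)" for N k
    unfolding q_def by measurable
  have q\<kappa>: "0 \<le> q N k (w, w') \<and> q N k (w, w') \<le> \<kappa> N (w, w')" if "w \<in> space \<nu>" "w' \<in> space \<nu>" for N k w w'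
    using that dirichlet_kernel_nonneg[OF h(1)[of N], of "fst w'" "fst w"] by (auto simp: q_def \<kappa>_def space_\<nu>)
  have kernel_L: "(\<lambda>t. dirichlet_kernel (h N) s t) \<in> borel_measurable ?L" if "s \<in> prob_simplex" for N s
    using measurable_compose[OF measurable_Pair1'[of s ?L ?L] dirichlet_kernel_measurable_pair[OF h(1)[of N], of c]] that
    by simp
  have D: "(\<integral>w'. \<kappa> N (w, w') \<partial>\<nu>) = ?S (h N) (\<lambda>_. 1) (fst w)" if w: "w \<in> space \<nu>" for N w
  proof -
    have s: "fst w \<in> prob_simplex" using w by (auto simp: space_\<nu>)
    note [measurable] = kernel_L[OF s, of N]
    have "(\<integral>w'. \<kappa> N (w, w') \<partial>\<nu>) = expectation (\<lambda>\<omega>. dirichlet_kernel (h N) (fst w) (Z \<omega>))"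
      unfolding \<kappa>_def by (subst E_\<nu>) auto
    also have "\<dots> = ?S (h N) (\<lambda>_. 1) (fst w)"
      by (subst E_Z) (simp_all add: smoothed_def[OF g_cont g_nonneg])
    finally show ?thesis .
  qed
  have Q: "(\<integral>w'. q N k (w, w') \<partial>\<nu>) = ?S (h N) (m k) (fst w)" if w: "w \<in> space \<nu>" for N k w
  proof -
    have s: "fst w \<in> prob_simplex" using w by (auto simp: space_\<nu>)
    note [measurable] = kernel_L[OF s, of N]
    \<comment> \<open>Cut off at the simplex, because \<open>E_m\<close> takes test functions that
      are Borel on the whole space; \<open>Z\<close> stays in the simplex, so the values are
      unchanged.\<close>
    define \<phi> where "\<phi> t = dirichlet_kernel (h N) (fst w) t * indicator prob_simplex t" for t
    have \<phi>_meas [measurable]: "\<phi> \<in> borel_measurable borel"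
    proof -
      have "(\<lambda>t. dirichlet_kernel (h N) (fst w) t) \<in> borel_measurable (restrict_space borel prob_simplex)"
        using kernel_L[OF s, of N] by (simp only: measurable_cong_sets[OF sets_simplex_lebesgue refl])
      then show ?thesis unfolding \<phi>_def[abs_def]
        by (subst (asm) borel_measurable_restrict_space_iff) (auto simp: mult.commute)
    qed
    obtain B where B: "\<And>(s :: real ^ 'k) t. s \<in> prob_simplex \<Longrightarrow> t \<in> prob_simplex \<Longrightarrow> dirichlet_kernel (h N) s t \<le> B"
      using dirichlet_kernel_bounded[OF h(1)] by blast
    have int: "integrable M (\<lambda>\<omega>. \<phi> (Z \<omega>) * y \<omega> $ k)"
    proof (rule integrable_const_bound[where B="B * 1"])
      show "AE \<omega> in M. norm (\<phi> (Z \<omega>) * y \<omega> $ k) \<le> B * 1"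
      proof (rule AE_I2)
        fix \<omega> assume w: "\<omega> \<in> space M"
        have "0 \<le> dirichlet_kernel (h N) (fst w) (Z \<omega>)" "dirichlet_kernel (h N) (fst w) (Z \<omega>) \<le> B"
          using B[OF s Z_simplex[OF w]] dirichlet_kernel_nonneg[OF h(1) Z_simplex[OF w]] by auto
        then show "norm (\<phi> (Z \<omega>) * y \<omega> $ k) \<le> B * 1"
          unfolding real_norm_def abs_mult using y01[OF w, of k] Z_simplex[OF w]
          by (intro mult_mono) (auto simp: \<phi>_def)
      qed
    qed measurable
    have "(\<integral>w'. q N k (w, w') \<partial>\<nu>) =
        expectation (\<lambda>\<omega>. dirichlet_kernel (h N) (fst w) (Z \<omega>) * (if y \<omega> $ k = 1 then 1 else 0))"
      unfolding q_def \<kappa>_def by (subst E_\<nu>) auto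
    also have "\<dots> = expectation (\<lambda>\<omega>. \<phi> (Z \<omega>) * y \<omega> $ k)"
    proof (rule Bochner_Integration.integral_cong)
      fix \<omega> assume w: "\<omega> \<in> space M"
      have "y \<omega> $ k = (if y \<omega> $ k = 1 then 1 else 0)" using assms(5)[OF w] by (auto simp: axis_def)
      then show "dirichlet_kernel (h N) (fst w) (Z \<omega>) * (if y \<omega> $ k = 1 then 1 else 0) = \<phi> (Z \<omega>) * y \<omega> $ k"
        using Z_simplex[OF w] by (simp add: \<phi>_def)
    qed simp
    also have "\<dots> = expectation (\<lambda>\<omega>. \<phi> (Z \<omega>) * m k (Z \<omega>))" by (rule E_m[OF \<phi>_meas int])
    also have "\<dots> = (\<integral>t. (\<phi> t * m k t) * g t \<partial>?L)"
      by (rule E_Z) (auto intro: measurable_simplex_lebesgue1)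
    also have "\<dots> = (\<integral>t. dirichlet_kernel (h N) (fst w) t * (m k t * g t) \<partial>?L)"
      by (rule Bochner_Integration.integral_cong) (auto simp: \<phi>_def mult.assoc)
    also have "\<dots> = ?S (h N) (m k) (fst w)"
      by (simp add: smoothed_def[OF g_cont g_nonneg])
    finally show ?thesis .
  qed
  have S_L [measurable]: "?S (h N) (m k) \<in> borel_measurable ?L" "?S (h N) (\<lambda>_. 1) \<in> borel_measurable ?L" for N k
    by (intro smoothing h m_L; simp)+
  define R where "R N k s = ?S (h N) (m k) s / ?S (h N) (\<lambda>_. 1) s" for N k s
  have R_L [measurable]: "R N k \<in> borel_measurable ?L" for N k unfolding R_def by measurable
  have R01: "R N k s \<in> {0..1}" if "s \<in> prob_simplex" for N k s
    unfolding R_def by (intro ratio_in_unit smoothing h m_L m01 that)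
  have pos: "AE w in \<nu>. (\<integral>w'. \<kappa> N (w, w') \<partial>\<nu>) > 0" for N
  proof -
    have "AE \<omega> in M. ?S (h N) (\<lambda>_. 1) (Z \<omega>) > 0"
      using Z_pos AE_space
    proof eventually_elim
      case (elim \<omega>)
      then show ?case using smoothed_density_pos[OF g_cont g_nonneg h(1) Z_simplex _ g_nz] by blast
    qed
    then have "AE w in \<nu>. ?S (h N) (\<lambda>_. 1) (fst w) > 0"
      unfolding \<nu>_def by (subst AE_distr_iff) auto
    then show ?thesis using AE_space by eventually_elim (simp add: D)
  qed

  \<comment> \<open>The limit of the estimator at the fixed bandwidth \<open>h N\<close>. It still
    carries the smoothing bias \<open>T' N - T\<close>, which vanishes by
    \<open>smoothing_L1\<close>.\<close>
  define T' where "T' N = (\<integral>w. (\<Sum>k\<in>UNIV. \<bar>(\<integral>w'. q N k (w, w') \<partial>\<nu>) / (\<integral>w'. \<kappa> N (w, w') \<partial>\<nu>) - fst w $ k\<bar> powr p) \<partial>\<nu>)" for N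
  have T': "T' N = expectation (\<lambda>\<omega>. \<Sum>k\<in>UNIV. \<bar>R N k (Z \<omega>) - Z \<omega> $ k\<bar> powr p)" for N
  proof -
    have "T' N = (\<integral>w. (\<Sum>k\<in>UNIV. \<bar>R N k (fst w) - fst w $ k\<bar> powr p) \<partial>\<nu>)"
      unfolding T'_def by (rule Bochner_Integration.integral_cong) (simp_all add: D Q R_def)
    also have "\<dots> = expectation (\<lambda>\<omega>. \<Sum>k\<in>UNIV. \<bar>R N k (Z \<omega>) - Z \<omega> $ k\<bar> powr p)"
      by (subst E_\<nu>) auto
    finally show ?thesis .
  qed
  have int_p: "integrable M (\<lambda>\<omega>. \<bar>u \<omega> - Z \<omega> $ k\<bar> powr p)"
    if [measurable]: "u \<in> borel_measurable M" and "\<And>\<omega>. \<omega> \<in> space M \<Longrightarrow> u \<omega> \<in> {0..1}" for u k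
  proof (rule integrable_const_bound[where B=1])
    show "AE \<omega> in M. norm (\<bar>u \<omega> - Z \<omega> $ k\<bar> powr p) \<le> 1"
    proof (rule AE_I2)
      fix \<omega> assume w: "\<omega> \<in> space M"
      have "\<bar>u \<omega> - Z \<omega> $ k\<bar> \<le> 1"
        using that(2)[OF w] prob_simplexD(1,2)[OF Z_simplex[OF w], of k] by (intro abs_diff_le_one) auto
      then show "norm (\<bar>u \<omega> - Z \<omega> $ k\<bar> powr p) \<le> 1" using p by (simp add: powr_le1)
    qed
  qed measurable
  have T'_lim: "T' \<longlonglongrightarrow> T"
  proof -
    have bound: "\<bar>T' N - T\<bar> \<le> (\<Sum>k\<in>UNIV. p * (\<integral>s. \<bar>R N k s - m k s\<bar> * g s \<partial>?L))" for N
    proof -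
      let ?d = "\<lambda>k \<omega>. \<bar>R N k (Z \<omega>) - Z \<omega> $ k\<bar> powr p - \<bar>m k (Z \<omega>) - Z \<omega> $ k\<bar> powr p"
      have i1: "integrable M (\<lambda>\<omega>. \<bar>R N k (Z \<omega>) - Z \<omega> $ k\<bar> powr p)" for k
        by (rule int_p) (auto intro!: R01 Z_simplex simp del: atLeastAtMost_iff)
      have i2: "integrable M (\<lambda>\<omega>. \<bar>m k (Z \<omega>) - Z \<omega> $ k\<bar> powr p)" for k
        by (rule int_p) (auto intro!: m01 simp del: atLeastAtMost_iff)
      have i3: "integrable M (\<lambda>\<omega>. \<bar>R N k (Z \<omega>) - m k (Z \<omega>)\<bar>)" for k
      proof (rule integrable_const_bound[where B=1])
        show "AE \<omega> in M. norm \<bar>R N k (Z \<omega>) - m k (Z \<omega>)\<bar> \<le> 1"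
          unfolding real_norm_def abs_abs by (intro AE_I2 abs_diff_le_one R01 Z_simplex m01)
      qed measurable
      have "T' N - T = (\<Sum>k\<in>UNIV. expectation (?d k))"
        unfolding T' T using i1 i2 by (simp add: Bochner_Integration.integral_sum sum_subtractf)
      then have "\<bar>T' N - T\<bar> \<le> (\<Sum>k\<in>UNIV. \<bar>expectation (?d k)\<bar>)" by (simp add: sum_abs)
      also have "\<dots> \<le> (\<Sum>k\<in>UNIV. p * (\<integral>s. \<bar>R N k s - m k s\<bar> * g s \<partial>?L))"
      proof (rule sum_mono)
        fix k
        have "\<bar>expectation (?d k)\<bar> \<le> expectation (\<lambda>\<omega>. \<bar>?d k \<omega>\<bar>)" by (rule integral_abs_bound)
        also have "\<dots> \<le> expectation (\<lambda>\<omega>. p * \<bar>R N k (Z \<omega>) - m k (Z \<omega>)\<bar>)"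
        proof (rule integral_mono)
          fix \<omega> assume w: "\<omega> \<in> space M"
          have z: "Z \<omega> $ k \<in> {0..1}" using prob_simplexD(1,2)[OF Z_simplex[OF w], of k] by simp
          have "\<bar>?d k \<omega>\<bar> \<le> p * \<bar>(R N k (Z \<omega>) - Z \<omega> $ k) - (m k (Z \<omega>) - Z \<omega> $ k)\<bar>"
            by (intro abs_powr_lipschitz p abs_diff_le_one R01 m01 z Z_simplex w)
          then show "\<bar>?d k \<omega>\<bar> \<le> p * \<bar>R N k (Z \<omega>) - m k (Z \<omega>)\<bar>" by simp
        qed (intro integrable_mult_right i3 Bochner_Integration.integrable_abs Bochner_Integration.integrable_diff i1 i2)+
        also have "\<dots> = p * (\<integral>s. \<bar>R N k s - m k s\<bar> * g s \<partial>?L)"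
          using E_Z[of "\<lambda>s. \<bar>R N k s - m k s\<bar>"] by simp
        finally show "\<bar>expectation (?d k)\<bar> \<le> p * (\<integral>s. \<bar>R N k s - m k s\<bar> * g s \<partial>?L)" .
      qed
      finally show ?thesis .
    qed
    have "(\<lambda>N. \<Sum>k\<in>UNIV. p * (\<integral>s. \<bar>R N k s - m k s\<bar> * g s \<partial>?L)) \<longlonglongrightarrow> (\<Sum>k\<in>(UNIV :: 'k set). p * 0)"
      unfolding R_def
      by (intro tendsto_sum tendsto_mult tendsto_const smoothing_L1[OF g_cont g_nonneg] h h_lim g_prob m m01)
    then have lim0: "(\<lambda>N. \<Sum>k\<in>UNIV. p * (\<integral>s. \<bar>R N k s - m k s\<bar> * g s \<partial>?L)) \<longlonglongrightarrow> 0"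
      by (simp only: mult_zero_right sum.neutral_const)
    have "(\<lambda>N. T' N - T) \<longlonglongrightarrow> 0"
    proof (rule Lim_null_comparison[OF _ lim0], rule always_eventually, rule allI)
      show "norm (T' N - T) \<le> (\<Sum>k\<in>UNIV. p * (\<integral>s. \<bar>R N k s - m k s\<bar> * g s \<partial>?L))" for N
        unfolding real_norm_def by (rule bound)
    qed
    then show ?thesis by (rule LIM_zero_cancel)
  qed

  let ?r = "\<lambda>N n V j k \<omega>. (\<Sum>i\<in>{..<n} - {j}. q N k (V j \<omega>, V i \<omega>)) / (\<Sum>i\<in>{..<n} - {j}. \<kappa> N (V j \<omega>, V i \<omega>))"
  let ?est = "\<lambda>N n V \<omega>. 1 / real n * (\<Sum>j<n. \<Sum>k\<in>UNIV. \<bar>?r N n V j k \<omega> - fst (V j \<omega>) $ k\<bar> powr p)"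
  \<comment> \<open>The sample is quantified inside the predicate, so the index \<open>r\<close>
    obtained from it, and with it the bandwidth, is the same for all copies.\<close>
  define A where "A N n \<longleftrightarrow> (\<forall>V :: nat \<Rightarrow> 'a \<Rightarrow> (real ^ 'k) \<times> (real ^ 'k). iid_sample M \<nu> V \<longrightarrow>
    expectation (\<lambda>\<omega>. \<bar>?est N n V \<omega> - T' N\<bar>) \<le> 1 / real (Suc N))" for N n
  have A_eventually: "eventually (A N) sequentially" for N
  proof -
    obtain B where B: "\<And>(s :: real ^ 'k) t. s \<in> prob_simplex \<Longrightarrow> t \<in> prob_simplex \<Longrightarrow> dirichlet_kernel (h N) s t \<le> B"
      using dirichlet_kernel_bounded[OF h(1)] by blast
    have "\<exists>n\<^sub>0. \<forall>n\<ge>n\<^sub>0. \<forall>(M :: 'a measure) V. iid_sample M \<nu> V \<longrightarrow>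
      (\<integral>\<omega>. \<bar>?est N n V \<omega> - T' N\<bar> \<partial>M) \<le> 1 / real (Suc N)"
      unfolding T'_def
    proof (rule plugin_estimator_L1[where C=B and z="\<lambda>w k. fst w $ k", OF prob_\<nu> \<kappa>_meas q_meas])
      show "(\<lambda>w. fst w $ k) \<in> borel_measurable \<nu>" for k by measurable
      show "fst w $ k \<in> {0..1}" if "w \<in> space \<nu>" for w k
        using that prob_simplexD[of "fst w"] by (auto simp: space_\<nu>)
      show "\<kappa> N (w, w') \<le> B" if "w \<in> space \<nu>" "w' \<in> space \<nu>" for w w'
        using that B by (auto simp: \<kappa>_def space_\<nu>)
    qed (use q\<kappa> pos p in auto)
    then show ?thesis unfolding A_def eventually_sequentially by blast
  qed
  obtain r where r: "filterlim r at_top sequentially" "eventually (\<lambda>n. A (r n) n) sequentially"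
    by (rule diagonal_sequence[of A, OF A_eventually])

  show ?thesis
  proof (intro exI[of _ "\<lambda>n. h (r n)"] conjI allI impI)
    show "h (r n) > 0" for n by (rule h)
    show "(\<lambda>n. h (r n)) \<longlonglongrightarrow> 0" by (rule filterlim_compose[OF h_lim r(1)])
    fix X :: "nat \<Rightarrow> 'a \<Rightarrow> real ^ 'd" and Y :: "nat \<Rightarrow> 'a \<Rightarrow> real ^ 'k"
    assume iid: "iid_copies M (\<lambda>\<omega>. (x \<omega>, y \<omega>)) (\<lambda>i \<omega>. (X i \<omega>, Y i \<omega>))"
    define V where "V i \<omega> = (f (X i \<omega>), Y i \<omega>)" for i \<omega>
    let ?\<Phi> = "\<lambda>(a :: real ^ 'd, b :: real ^ 'k). (f a, b)"
    have \<Phi>: "?\<Phi> \<in> borel \<rightarrow>\<^sub>M ?L \<Otimes>\<^sub>M borel"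
      unfolding borel_prod[symmetric] by measurable
    then have \<Phi>': "?\<Phi> \<in> borel \<rightarrow>\<^sub>M \<nu>" by (simp only: measurable_cong_sets[OF refl sets_\<nu>])
    have XY_meas: "(\<lambda>\<omega>. (X i \<omega>, Y i \<omega>)) \<in> M \<rightarrow>\<^sub>M borel" for i
      using iid by (auto simp: iid_copies_def indep_vars_def2)
    have xy_meas: "(\<lambda>\<omega>. (x \<omega>, y \<omega>)) \<in> M \<rightarrow>\<^sub>M borel" unfolding borel_prod[symmetric] by measurable
    have V_distr: "distr M \<nu> (V i) = \<nu>" for i
    proof -
      have "distr M \<nu> (V i) = distr M (?L \<Otimes>\<^sub>M borel) (\<lambda>\<omega>. ?\<Phi> (X i \<omega>, Y i \<omega>))"
        by (rule distr_cong) (simp_all add: V_def sets_\<nu>)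
      also have "\<dots> = distr (distr M borel (\<lambda>\<omega>. (X i \<omega>, Y i \<omega>))) (?L \<Otimes>\<^sub>M borel) ?\<Phi>"
        using distr_distr[OF \<Phi> XY_meas] by (simp add: comp_def)
      also have "\<dots> = distr (distr M borel (\<lambda>\<omega>. (x \<omega>, y \<omega>))) (?L \<Otimes>\<^sub>M borel) ?\<Phi>"
        using iid by (simp add: iid_copies_def)
      also have "\<dots> = \<nu>" using distr_distr[OF \<Phi> xy_meas] by (simp add: comp_def \<nu>_def Z_def)
      finally show ?thesis .
    qed
    have V: "iid_sample M \<nu> V"
    proof (unfold_locales)
      have "indep_vars (\<lambda>_. borel) (\<lambda>i \<omega>. (X i \<omega>, Y i \<omega>)) UNIV" using iid by (simp add: iid_copies_def)
      from indep_vars_compose2[OF this, of "\<lambda>_. ?\<Phi>" "\<lambda>_. \<nu>"] \<Phi>'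
      show "indep_vars (\<lambda>_. \<nu>) V UNIV" by (simp add: V_def[abs_def])
    qed (rule V_distr)
    then interpret iid_sample M \<nu> V .
    have V_space: "V i \<omega> \<in> space \<nu>" if "\<omega> \<in> space M" for i \<omega>
      using measurable_space[OF measurable_sample that] .
    \<comment> \<open>Only \<open>y\<close> is one-hot at every point; its copies inherit this
      through their law, hence merely almost surely, but for all of them at once since they are
      countably many.\<close>
    have labels: "AE \<omega> in M. \<forall>i. \<forall>k. snd (V i \<omega>) $ k = (if snd (V i \<omega>) $ k = 1 then 1 else 0)"
    proof -
      have "AE w in \<nu>. \<forall>k. snd w $ k = (if snd w $ k = 1 then 1 else 0)"
        unfolding \<nu>_def
      proof (subst AE_distr_iff)
        show "AE \<omega> in M. \<forall>k. snd (Z \<omega>, y \<omega>) $ k = (if snd (Z \<omega>, y \<omega>) $ k = 1 then 1 else 0)"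
          using assms(5) by (intro AE_I2) (force simp: axis_def)
      qed measurable
      then have "AE w in distr M \<nu> (V i). \<forall>k. snd w $ k = (if snd w $ k = 1 then 1 else 0)" for i
        by (simp only: V_distr)
      then have "AE \<omega> in M. \<forall>k. snd (V i \<omega>) $ k = (if snd (V i \<omega>) $ k = 1 then 1 else 0)" for i
        by (rule AE_distrD[OF measurable_sample])
      then show ?thesis by (subst AE_all_countable) (rule allI)
    qed
    have est_eq: "calibration_estimator p (h N) n (\<lambda>i. f (X i \<omega>)) (\<lambda>i. Y i \<omega>) =
       1 / real n * (\<Sum>j<n. \<Sum>k\<in>UNIV. \<bar>(\<Sum>i\<in>{..<n} - {j}. \<kappa> N (V j \<omega>, V i \<omega>) * snd (V i \<omega>) $ k) /
         (\<Sum>i\<in>{..<n} - {j}. \<kappa> N (V j \<omega>, V i \<omega>)) - fst (V j \<omega>) $ k\<bar> powr p)" for N n \<omega>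
      unfolding calibration_estimator_eq[OF p] by (simp add: \<kappa>_def V_def)
    have "(\<lambda>w. fst w $ k) \<in> borel_measurable \<nu>" "(\<lambda>w. snd w $ k) \<in> borel_measurable \<nu>" for k by measurable
    note coord_meas [measurable] = this[THEN measurable_compose[OF measurable_sample]]
    have r_meas [measurable]: "(\<lambda>\<omega>. ?r N n V j k \<omega>) \<in> borel_measurable M" for N n j k by measurable
    have r01: "?r N n V j k \<omega> \<in> {0..1}" if "\<omega> \<in> space M" for N n j k \<omega>
      using q\<kappa> V_space[OF that] by (intro ratio_in_unit sum_nonneg sum_mono) auto
    have int_est: "integrable M (?est N n V)" for N n
    proof (intro integrable_mult_right Bochner_Integration.integrable_sum)
      fix j k
      show "integrable M (\<lambda>\<omega>. \<bar>?r N n V j k \<omega> - fst (V j \<omega>) $ k\<bar> powr p)"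
      proof (rule integrable_const_bound[where B=1])
        show "AE \<omega> in M. norm (\<bar>?r N n V j k \<omega> - fst (V j \<omega>) $ k\<bar> powr p) \<le> 1"
        proof (rule AE_I2)
          fix \<omega> assume w: "\<omega> \<in> space M"
          have "fst (V j \<omega>) $ k \<in> {0..1}"
            using V_space[OF w, of j] prob_simplexD(1,2)[of "fst (V j \<omega>)" k] by (auto simp: space_\<nu>)
          then have "\<bar>?r N n V j k \<omega> - fst (V j \<omega>) $ k\<bar> \<le> 1" by (intro abs_diff_le_one r01 w)
          then show "norm (\<bar>?r N n V j k \<omega> - fst (V j \<omega>) $ k\<bar> powr p) \<le> 1" using p by (simp add: powr_le1)
        qed
        show "(\<lambda>\<omega>. \<bar>?r N n V j k \<omega> - fst (V j \<omega>) $ k\<bar> powr p) \<in> borel_measurable M"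
          by (intro powr_real_measurable borel_measurable_abs borel_measurable_diff r_meas coord_meas borel_measurable_const)
      qed
    qed
    have "tendsto_in_prob M (\<lambda>n \<omega>. calibration_estimator p (h (r n)) n (\<lambda>i. f (X i \<omega>)) (\<lambda>i. Y i \<omega>)) T"
    proof (rule tendsto_in_prob_L1[where U="\<lambda>n. ?est (r n) n V"])
      show "(\<lambda>\<omega>. calibration_estimator p (h (r n)) n (\<lambda>i. f (X i \<omega>)) (\<lambda>i. Y i \<omega>)) \<in> borel_measurable M" for n
        unfolding est_eq by measurable
      show "integrable M (?est (r n) n V)" for n by (rule int_est)
      show "AE \<omega> in M. calibration_estimator p (h (r n)) n (\<lambda>i. f (X i \<omega>)) (\<lambda>i. Y i \<omega>) = ?est (r n) n V \<omega>" for n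
        using labels
      proof eventually_elim
        case (elim \<omega>)
        have "\<kappa> (r n) (V j \<omega>, V i \<omega>) * snd (V i \<omega>) $ k = q (r n) k (V j \<omega>, V i \<omega>)" for i j k
          using elim[rule_format, of i k] by (simp add: q_def)
        then show ?case unfolding est_eq by simp
      qed
      show "(\<lambda>n. expectation (\<lambda>\<omega>. \<bar>?est (r n) n V \<omega> - T\<bar>)) \<longlonglongrightarrow> 0"
      proof (rule tendsto_sandwich[where f="\<lambda>_. 0" and h="\<lambda>n. 1 / real (Suc (r n)) + \<bar>T' (r n) - T\<bar>"])
        show "eventually (\<lambda>n. expectation (\<lambda>\<omega>. \<bar>?est (r n) n V \<omega> - T\<bar>) \<le> 1 / real (Suc (r n)) + \<bar>T' (r n) - T\<bar>) sequentially"
          using r(2)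
        proof eventually_elim
          case (elim n)
          \<comment> \<open>Sampling error at the bandwidth \<open>h (r n)\<close>, controlled by
            \<open>A\<close>, plus the bias at that bandwidth.\<close>
          have "expectation (\<lambda>\<omega>. \<bar>?est (r n) n V \<omega> - T\<bar>) \<le>
              expectation (\<lambda>\<omega>. \<bar>?est (r n) n V \<omega> - T' (r n)\<bar> + \<bar>T' (r n) - T\<bar>)"
            by (intro integral_mono Bochner_Integration.integrable_add Bochner_Integration.integrable_abs
                Bochner_Integration.integrable_diff int_est) auto
          also have "\<dots> = expectation (\<lambda>\<omega>. \<bar>?est (r n) n V \<omega> - T' (r n)\<bar>) + \<bar>T' (r n) - T\<bar>"
            by (subst Bochner_Integration.integral_add)
               (auto simp only: prob_space prob_space_axioms lebesgue_integral_const scaleR_one real_scaleR_def mult_1_left mult_1_right intro!: Bochner_Integration.integrable_abs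
                Bochner_Integration.integrable_diff int_est integrable_const)
          also have "expectation (\<lambda>\<omega>. \<bar>?est (r n) n V \<omega> - T' (r n)\<bar>) \<le> 1 / real (Suc (r n))"
            using elim V by (simp add: A_def)
          finally show ?case by simp
        qed
        have "(\<lambda>N. 1 / real (Suc N) + \<bar>T' N - T\<bar>) \<longlonglongrightarrow> 0 + \<bar>T - T\<bar>"
          using h_lim T'_lim unfolding h_def[abs_def] by (intro tendsto_intros)
        then show "(\<lambda>n. 1 / real (Suc (r n)) + \<bar>T' (r n) - T\<bar>) \<longlonglongrightarrow> 0"
          using filterlim_compose[OF _ r(1)] by fastforce
      qed (auto intro!: always_eventually integral_nonneg_AE)
    qed
    then show "tendsto_in_prob M (\<lambda>n \<omega>. calibration_estimator p (h (r n)) n (\<lambda>i. f (X i \<omega>)) (\<lambda>i. Y i \<omega>))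
        (expectation (\<lambda>\<omega>. lp_norm p (vec_cond_exp M (\<lambda>\<omega>. f (x \<omega>)) y \<omega> - f (x \<omega>)) powr p))"
      by (simp only: T_def)
  qed
qed

end
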